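(* Let $k$ be a commutative ring. The 2-category ${}_{\mathcal M_k}\mathrm{Cat}$ of $k$-linear categories and the 2-category ${}_k\mathrm{Mor}$ of Morita contexts are isomorphic.
   Context: **${}_{\mathcal M_k}\mathrm{Cat}$.** 0-cells ($k$-linear categories): a class $X$, $k$-modules $A_{x,y}$ ($x,y\in X$), $k$-linear maps $m_{x,y,z}:A_{x,y}\otimes_kA_{y,z}\to A_{x,z}$, and units $1_x\in A_{x,x}$, associative and unital. 1-cells $f:A\to B$: a map $f:X\to Y$ between underlying classes and $k$-linear maps $f_{x,y}:A_{x,y}\to B_{f(x),f(y)}$ preserving multiplications and units. 2-cells $\alpha:f\Rightarrow g$ ($f,g:A\to B$): families of elements $\alpha_x\in B_{g(x),f(x)}$ with $g_{x,y}(a)\alpha_y=\alpha_xf_{x,y}(a)$ for all $x,y\in X$, $a\in A_{x,y}$. Compositions: $(g\circ f)_{x,y}=g_{f(x),f(y)}\circ f_{x,y}$; vertical $(\beta\circ\alpha)_x=\beta_x\alpha_x$; horizontal, for $\alpha:f\Rightarrow f'$, $\beta:g\Rightarrow g'$, $(\alpha*\beta)_x=g'_{f'(x),f(x)}(\alpha_x)\,\beta_{f(x)}$. **${}_k\mathrm{Mor}$.** 0-cells (Morita contexts): a class $X$; for every $x\in X$ a $k$-algebra $A_{x,x}$; for all $x,y\in X$ an $(A_{x,x},A_{y,y})$-bimodule $A_{x,y}$ (being $A_{x,x}$ with its regular structure if $x=y$); and $(A_{x,x},A_{z,z})$-bimodule maps $\overline m_{x,y,z}:A_{x,y}\otimes_{A_{y,y}}A_{y,z}\to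 A_{x,z}$ such that $\overline m_{x,x,y}:A_{x,x}\otimes_{A_{x,x}}A_{x,y}\to A_{x,y}$ and $\overline m_{x,y,y}:A_{x,y}\otimes_{A_{y,y}}A_{y,y}\to A_{x,y}$ are the canonical isomorphisms and, for all $x,y,z,u\in X$, $$\overline m_{x,y,u}\circ(A_{x,y}\otimes_{A_{y,y}}\overline m_{y,z,u})=\overline m_{x,z,u}\circ(\overline m_{x,y,z}\otimes_{A_{z,z}}A_{z,u}).$$ 1-cells $f:A\to B$: a map $f:X\to Y$ and $k$-linear maps $f_{x,y}:A_{x,y}\to B_{f(x),f(y)}$ such that every $f_{x,x}$ is an algebra map; $f_{x,y}(a'aa'')=f_{x,x}(a')f_{x,y}(a)f_{y,y}(a'')$ for $a'\in A_{x,x}$, $a\in A_{x,y}$, $a''\in A_{y,y}$; and $f_{x,z}\circ\overline m_{x,y,z}=\overline m_{f(x),f(y),f(z)}\circ(f_{x,y}\otimes_{f_{y,y}}f_{y,z})$, where $(f_{x,y}\otimes_{f_{y,y}}f_{y,z})(a\otimes_{A_{y,y}}b)=f_{x,y}(a)\otimes_{B_{f(y),f(y)}}f_{y,z}(b)$. 2-cells $\alpha:f\Rightarrow g$: families $\alpha_x\in B_{g(x),f(x)}$ with $$\overline m_{g(x),g(y),f(y)}(g_{x,y}(a)\otimes_{B_{g(y),g(y)}}\alpha_y)=\overline m_{g(x),f(x),f(y)}(\alpha_x\otimes_{B_{f(x),f(x)}}f_{x,y}(a))$$ for all $x,y\in X$, $a\in A_{x,y}$. Compositions are given by the same formulas as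 in ${}_{\mathcal M_k}\mathrm{Cat}$, writing $ab=\overline m_{x,y,z}(a\otimes_{A_{y,y}}b)$. Algebras and modules are unital, and bimodules are $k$-symmetric. *)

theory Defs
  imports "HOL-Algebra.Module" "HOL-Algebra.Free_Abelian_Groups" "HOL-Algebra.Generated_Groups"
begin

section \<open>Strict 2-categories\<close>

text \<open>
  Cells do not carry their source and target; cells of each dimension form a family of sets
  indexed by the boundary, and the operations take the boundary as explicit arguments:
  \<open>comp1 C A B D g f\<close> is \<open>g \<circ> f : A \<rightarrow> B \<rightarrow> D\<close>;
  \<open>vcomp C A B f g h \<beta> \<alpha>\<close> is \<open>\<beta> \<circ> \<alpha> : f \<Rightarrow> g \<Rightarrow> h\<close>;
  \<open>hcomp C A B D f f' g g' \<alpha> \<beta>\<close> is \<open>\<alpha> * \<beta> : g \<circ> f \<Rightarrow> g' \<circ> f'\<close> for \<open>\<alpha> : f \<Rightarrow> f'\<close> in \<open>(A, B)\<close> and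
  \<open>\<beta> : g \<Rightarrow> g'\<close> in \<open>(B, D)\<close>.
\<close>

record ('c0, 'c1, 'c2) two_cat =
  cells0 :: "'c0 set"
  cells1 :: "'c0 \<Rightarrow> 'c0 \<Rightarrow> 'c1 set"
  cells2 :: "'c0 \<Rightarrow> 'c0 \<Rightarrow> 'c1 \<Rightarrow> 'c1 \<Rightarrow> 'c2 set"
  id1 :: "'c0 \<Rightarrow> 'c1"
  comp1 :: "'c0 \<Rightarrow> 'c0 \<Rightarrow> 'c0 \<Rightarrow> 'c1 \<Rightarrow> 'c1 \<Rightarrow> 'c1"
  id2 :: "'c0 \<Rightarrow> 'c0 \<Rightarrow> 'c1 \<Rightarrow> 'c2"
  vcomp :: "'c0 \<Rightarrow> 'c0 \<Rightarrow> 'c1 \<Rightarrow> 'c1 \<Rightarrow> 'c1 \<Rightarrow> 'c2 \<Rightarrow> 'c2 \<Rightarrow> 'c2"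
  hcomp :: "'c0 \<Rightarrow> 'c0 \<Rightarrow> 'c0 \<Rightarrow> 'c1 \<Rightarrow> 'c1 \<Rightarrow> 'c1 \<Rightarrow> 'c1 \<Rightarrow> 'c2 \<Rightarrow> 'c2 \<Rightarrow> 'c2"

locale two_category =
  fixes C :: "('c0, 'c1, 'c2) two_cat"
  assumes id1_closed: "A \<in> cells0 C \<Longrightarrow> id1 C A \<in> cells1 C A A"
    and comp1_closed:
      "\<lbrakk>A \<in> cells0 C; B \<in> cells0 C; D \<in> cells0 C; f \<in> cells1 C A B; g \<in> cells1 C B D\<rbrakk>
        \<Longrightarrow> comp1 C A B D g f \<in> cells1 C A D"
    and comp1_id_left:
      "\<lbrakk>A \<in> cells0 C; B \<in> cells0 C; f \<in> cells1 C A B\<rbrakk> \<Longrightarrow> comp1 C A B B (id1 C B) f = f"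
    and comp1_id_right:
      "\<lbrakk>A \<in> cells0 C; B \<in> cells0 C; f \<in> cells1 C A B\<rbrakk> \<Longrightarrow> comp1 C A A B f (id1 C A) = f"
    and comp1_assoc:
      "\<lbrakk>A \<in> cells0 C; B \<in> cells0 C; D \<in> cells0 C; E \<in> cells0 C;
        f \<in> cells1 C A B; g \<in> cells1 C B D; h \<in> cells1 C D E\<rbrakk>
        \<Longrightarrow> comp1 C A B E (comp1 C B D E h g) f = comp1 C A D E h (comp1 C A B D g f)"
    and id2_closed:
      "\<lbrakk>A \<in> cells0 C; B \<in> cells0 C; f \<in> cells1 C A B\<rbrakk> \<Longrightarrow> id2 C A B f \<in> cells2 C A B f f"
    and vcomp_closed:
      "\<lbrakk>A \<in> cells0 C; B \<in> cells0 C; f \<in> cells1 C A B; g \<in> cells1 C A B; h \<in> cells1 C A B;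
        \<alpha> \<in> cells2 C A B f g; \<beta> \<in> cells2 C A B g h\<rbrakk>
        \<Longrightarrow> vcomp C A B f g h \<beta> \<alpha> \<in> cells2 C A B f h"
    and vcomp_id_left:
      "\<lbrakk>A \<in> cells0 C; B \<in> cells0 C; f \<in> cells1 C A B; g \<in> cells1 C A B; \<alpha> \<in> cells2 C A B f g\<rbrakk>
        \<Longrightarrow> vcomp C A B f g g (id2 C A B g) \<alpha> = \<alpha>"
    and vcomp_id_right:
      "\<lbrakk>A \<in> cells0 C; B \<in> cells0 C; f \<in> cells1 C A B; g \<in> cells1 C A B; \<alpha> \<in> cells2 C A B f g\<rbrakk>
        \<Longrightarrow> vcomp C A B f f g \<alpha> (id2 C A B f) = \<alpha>"
    and vcomp_assoc:
      "\<lbrakk>A \<in> cells0 C; B \<in> cells0 C;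
        e \<in> cells1 C A B; f \<in> cells1 C A B; g \<in> cells1 C A B; h \<in> cells1 C A B;
        \<alpha> \<in> cells2 C A B e f; \<beta> \<in> cells2 C A B f g; \<gamma> \<in> cells2 C A B g h\<rbrakk>
        \<Longrightarrow> vcomp C A B e f h (vcomp C A B f g h \<gamma> \<beta>) \<alpha>
          = vcomp C A B e g h \<gamma> (vcomp C A B e f g \<beta> \<alpha>)"
    and hcomp_closed:
      "\<lbrakk>A \<in> cells0 C; B \<in> cells0 C; D \<in> cells0 C;
        f \<in> cells1 C A B; f' \<in> cells1 C A B; g \<in> cells1 C B D; g' \<in> cells1 C B D;
        \<alpha> \<in> cells2 C A B f f'; \<beta> \<in> cells2 C B D g g'\<rbrakk>
        \<Longrightarrow> hcomp C A B D f f' g g' \<alpha> \<beta>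
          \<in> cells2 C A D (comp1 C A B D g f) (comp1 C A B D g' f')"
    and hcomp_id_left:
      "\<lbrakk>A \<in> cells0 C; B \<in> cells0 C; f \<in> cells1 C A B; f' \<in> cells1 C A B; \<alpha> \<in> cells2 C A B f f'\<rbrakk>
        \<Longrightarrow> hcomp C A A B (id1 C A) (id1 C A) f f' (id2 C A A (id1 C A)) \<alpha> = \<alpha>"
    and hcomp_id_right:
      "\<lbrakk>A \<in> cells0 C; B \<in> cells0 C; f \<in> cells1 C A B; f' \<in> cells1 C A B; \<alpha> \<in> cells2 C A B f f'\<rbrakk>
        \<Longrightarrow> hcomp C A B B f f' (id1 C B) (id1 C B) \<alpha> (id2 C B B (id1 C B)) = \<alpha>"
    and hcomp_assoc:
      "\<lbrakk>A \<in> cells0 C; B \<in> cells0 C; D \<in> cells0 C; E \<in> cells0 C;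
        f \<in> cells1 C A B; f' \<in> cells1 C A B; g \<in> cells1 C B D; g' \<in> cells1 C B D;
        h \<in> cells1 C D E; h' \<in> cells1 C D E;
        \<alpha> \<in> cells2 C A B f f'; \<beta> \<in> cells2 C B D g g'; \<gamma> \<in> cells2 C D E h h'\<rbrakk>
        \<Longrightarrow> hcomp C A D E (comp1 C A B D g f) (comp1 C A B D g' f') h h'
              (hcomp C A B D f f' g g' \<alpha> \<beta>) \<gamma>
          = hcomp C A B E f f' (comp1 C B D E h g) (comp1 C B D E h' g')
              \<alpha> (hcomp C B D E g g' h h' \<beta> \<gamma>)"
    and hcomp_id2:
      "\<lbrakk>A \<in> cells0 C; B \<in> cells0 C; D \<in> cells0 C; f \<in> cells1 C A B; g \<in> cells1 C B D\<rbrakk>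
        \<Longrightarrow> hcomp C A B D f f g g (id2 C A B f) (id2 C B D g) = id2 C A D (comp1 C A B D g f)"
    and interchange:
      "\<lbrakk>A \<in> cells0 C; B \<in> cells0 C; D \<in> cells0 C;
        f \<in> cells1 C A B; f' \<in> cells1 C A B; f'' \<in> cells1 C A B;
        g \<in> cells1 C B D; g' \<in> cells1 C B D; g'' \<in> cells1 C B D;
        \<alpha> \<in> cells2 C A B f f'; \<alpha>' \<in> cells2 C A B f' f'';
        \<beta> \<in> cells2 C B D g g'; \<beta>' \<in> cells2 C B D g' g''\<rbrakk>
        \<Longrightarrow> hcomp C A B D f f'' g g'' (vcomp C A B f f' f'' \<alpha>' \<alpha>) (vcomp C B D g g' g'' \<beta>' \<beta>)
          = vcomp C A D (comp1 C A B D g f) (comp1 C A B D g' f') (comp1 C A B D g'' f'')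
              (hcomp C A B D f' f'' g' g'' \<alpha>' \<beta>') (hcomp C A B D f f' g g' \<alpha> \<beta>)"

record ('b0, 'b1, 'b2, 'c0, 'c1, 'c2) two_fun =
  map0 :: "'b0 \<Rightarrow> 'c0"
  map1 :: "'b0 \<Rightarrow> 'b0 \<Rightarrow> 'b1 \<Rightarrow> 'c1"
  map2 :: "'b0 \<Rightarrow> 'b0 \<Rightarrow> 'b1 \<Rightarrow> 'b1 \<Rightarrow> 'b2 \<Rightarrow> 'c2"

locale two_functor = S: two_category S + T: two_category T
  for S :: "('b0, 'b1, 'b2) two_cat" and T :: "('c0, 'c1, 'c2) two_cat" +
  fixes F :: "('b0, 'b1, 'b2, 'c0, 'c1, 'c2) two_fun"
  assumes map0_closed: "A \<in> cells0 S \<Longrightarrow> map0 F A \<in> cells0 T"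
    and map1_closed:
      "\<lbrakk>A \<in> cells0 S; B \<in> cells0 S; f \<in> cells1 S A B\<rbrakk>
        \<Longrightarrow> map1 F A B f \<in> cells1 T (map0 F A) (map0 F B)"
    and map2_closed:
      "\<lbrakk>A \<in> cells0 S; B \<in> cells0 S; f \<in> cells1 S A B; g \<in> cells1 S A B; \<alpha> \<in> cells2 S A B f g\<rbrakk>
        \<Longrightarrow> map2 F A B f g \<alpha> \<in> cells2 T (map0 F A) (map0 F B) (map1 F A B f) (map1 F A B g)"
    and map_id1: "A \<in> cells0 S \<Longrightarrow> map1 F A A (id1 S A) = id1 T (map0 F A)"
    and map_comp1:
      "\<lbrakk>A \<in> cells0 S; B \<in> cells0 S; D \<in> cells0 S; f \<in> cells1 S A B; g \<in> cells1 S B D\<rbrakk>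
        \<Longrightarrow> map1 F A D (comp1 S A B D g f)
          = comp1 T (map0 F A) (map0 F B) (map0 F D) (map1 F B D g) (map1 F A B f)"
    and map_id2:
      "\<lbrakk>A \<in> cells0 S; B \<in> cells0 S; f \<in> cells1 S A B\<rbrakk>
        \<Longrightarrow> map2 F A B f f (id2 S A B f) = id2 T (map0 F A) (map0 F B) (map1 F A B f)"
    and map_vcomp:
      "\<lbrakk>A \<in> cells0 S; B \<in> cells0 S; f \<in> cells1 S A B; g \<in> cells1 S A B; h \<in> cells1 S A B;
        \<alpha> \<in> cells2 S A B f g; \<beta> \<in> cells2 S A B g h\<rbrakk>
        \<Longrightarrow> map2 F A B f h (vcomp S A B f g h \<beta> \<alpha>)
          = vcomp T (map0 F A) (map0 F B) (map1 F A B f) (map1 F A B g) (map1 F A B h)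
              (map2 F A B g h \<beta>) (map2 F A B f g \<alpha>)"
    and map_hcomp:
      "\<lbrakk>A \<in> cells0 S; B \<in> cells0 S; D \<in> cells0 S;
        f \<in> cells1 S A B; f' \<in> cells1 S A B; g \<in> cells1 S B D; g' \<in> cells1 S B D;
        \<alpha> \<in> cells2 S A B f f'; \<beta> \<in> cells2 S B D g g'\<rbrakk>
        \<Longrightarrow> map2 F A D (comp1 S A B D g f) (comp1 S A B D g' f') (hcomp S A B D f f' g g' \<alpha> \<beta>)
          = hcomp T (map0 F A) (map0 F B) (map0 F D)
              (map1 F A B f) (map1 F A B f') (map1 F B D g) (map1 F B D g')
              (map2 F A B f f' \<alpha>) (map2 F B D g g' \<beta>)"

definition left_inverse_two_fun ::
  "('b0, 'b1, 'b2) two_cat \<Rightarrow> ('c0, 'c1, 'c2, 'b0, 'b1, 'b2) two_fun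
    \<Rightarrow> ('b0, 'b1, 'b2, 'c0, 'c1, 'c2) two_fun \<Rightarrow> bool" where
  "left_inverse_two_fun S G F \<longleftrightarrow>
    (\<forall>A\<in>cells0 S. map0 G (map0 F A) = A) \<and>
    (\<forall>A\<in>cells0 S. \<forall>B\<in>cells0 S. \<forall>f\<in>cells1 S A B.
       map1 G (map0 F A) (map0 F B) (map1 F A B f) = f) \<and>
    (\<forall>A\<in>cells0 S. \<forall>B\<in>cells0 S. \<forall>f\<in>cells1 S A B. \<forall>g\<in>cells1 S A B. \<forall>\<alpha>\<in>cells2 S A B f g.
       map2 G (map0 F A) (map0 F B) (map1 F A B f) (map1 F A B g) (map2 F A B f g \<alpha>) = \<alpha>)"

text \<open>
  Since \<^locale>\<open>two_functor\<close> extends \<^locale>\<open>two_category\<close> for its source and target, isomorphy includes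
  that both sides satisfy the axioms of a 2-category.
\<close>

definition isomorphic_two_categories ::
  "('b0, 'b1, 'b2) two_cat \<Rightarrow> ('c0, 'c1, 'c2) two_cat \<Rightarrow> bool" where
  "isomorphic_two_categories S T \<longleftrightarrow>
    (\<exists>F G. two_functor S T F \<and> two_functor T S G \<and>
       left_inverse_two_fun S G F \<and> left_inverse_two_fun T F G)"


section \<open>Algebras, bimodules and tensor products\<close>

text \<open>
  \<open>Module.algebra\<close> of the library is commutative, and its modules are over commutative
  rings only, so noncommutative algebras and their bimodules are introduced here.
\<close>

locale assoc_algebra = Module.module k A + ring A
  for k :: "('k, 'e) ring_scheme" and A :: "('k, 'a, 'f) module_scheme" +
  assumes smult_mult_left:
      "\<lbrakk>c \<in> carrier k; a \<in> carrier A; b \<in> carrier A\<rbrakk>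
        \<Longrightarrow> (c \<odot>\<^bsub>A\<^esub> a) \<otimes>\<^bsub>A\<^esub> b = c \<odot>\<^bsub>A\<^esub> (a \<otimes>\<^bsub>A\<^esub> b)"
    and smult_mult_right:
      "\<lbrakk>c \<in> carrier k; a \<in> carrier A; b \<in> carrier A\<rbrakk>
        \<Longrightarrow> a \<otimes>\<^bsub>A\<^esub> (c \<odot>\<^bsub>A\<^esub> b) = c \<odot>\<^bsub>A\<^esub> (a \<otimes>\<^bsub>A\<^esub> b)"

text \<open>
  The multiplication and unit fields that bimodule records inherit from the library's module
  records are irrelevant.
\<close>

record ('k, 'r, 's, 'm) bimodule = "('k, 'm) module" +
  lact :: "'r \<Rightarrow> 'm \<Rightarrow> 'm"
  ract :: "'m \<Rightarrow> 's \<Rightarrow> 'm"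

locale is_bimodule = Module.module k M + R: assoc_algebra k R + S: assoc_algebra k S
  for k :: "('k, 'e) ring_scheme"
    and R :: "('k, 'r, 'f) module_scheme" and S :: "('k, 's, 'g) module_scheme"
    and M :: "('k, 'r, 's, 'm) bimodule" +
  assumes lact_closed: "\<lbrakk>r \<in> carrier R; m \<in> carrier M\<rbrakk> \<Longrightarrow> lact M r m \<in> carrier M"
    and lact_add_left:
      "\<lbrakk>r \<in> carrier R; r' \<in> carrier R; m \<in> carrier M\<rbrakk>
        \<Longrightarrow> lact M (r \<oplus>\<^bsub>R\<^esub> r') m = lact M r m \<oplus>\<^bsub>M\<^esub> lact M r' m"
    and lact_add_right:
      "\<lbrakk>r \<in> carrier R; m \<in> carrier M; m' \<in> carrier M\<rbrakk>
        \<Longrightarrow> lact M r (m \<oplus>\<^bsub>M\<^esub> m') = lact M r m \<oplus>\<^bsub>M\<^esub> lact M r m'"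
    and lact_mult:
      "\<lbrakk>r \<in> carrier R; r' \<in> carrier R; m \<in> carrier M\<rbrakk>
        \<Longrightarrow> lact M (r \<otimes>\<^bsub>R\<^esub> r') m = lact M r (lact M r' m)"
    and lact_one: "m \<in> carrier M \<Longrightarrow> lact M \<one>\<^bsub>R\<^esub> m = m"
    and ract_closed: "\<lbrakk>m \<in> carrier M; s \<in> carrier S\<rbrakk> \<Longrightarrow> ract M m s \<in> carrier M"
    and ract_add_left:
      "\<lbrakk>m \<in> carrier M; m' \<in> carrier M; s \<in> carrier S\<rbrakk>
        \<Longrightarrow> ract M (m \<oplus>\<^bsub>M\<^esub> m') s = ract M m s \<oplus>\<^bsub>M\<^esub> ract M m' s"
    and ract_add_right:
      "\<lbrakk>m \<in> carrier M; s \<in> carrier S; s' \<in> carrier S\<rbrakk>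
        \<Longrightarrow> ract M m (s \<oplus>\<^bsub>S\<^esub> s') = ract M m s \<oplus>\<^bsub>M\<^esub> ract M m s'"
    and ract_mult:
      "\<lbrakk>m \<in> carrier M; s \<in> carrier S; s' \<in> carrier S\<rbrakk>
        \<Longrightarrow> ract M m (s \<otimes>\<^bsub>S\<^esub> s') = ract M (ract M m s) s'"
    and ract_one: "m \<in> carrier M \<Longrightarrow> ract M m \<one>\<^bsub>S\<^esub> = m"
    and lact_ract:
      "\<lbrakk>r \<in> carrier R; m \<in> carrier M; s \<in> carrier S\<rbrakk>
        \<Longrightarrow> ract M (lact M r m) s = lact M r (ract M m s)"
    and lact_symmetric:
      "\<lbrakk>c \<in> carrier k; m \<in> carrier M\<rbrakk> \<Longrightarrow> lact M (c \<odot>\<^bsub>R\<^esub> \<one>\<^bsub>R\<^esub>) m = c \<odot>\<^bsub>M\<^esub> m"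
    and ract_symmetric:
      "\<lbrakk>c \<in> carrier k; m \<in> carrier M\<rbrakk> \<Longrightarrow> ract M m (c \<odot>\<^bsub>S\<^esub> \<one>\<^bsub>S\<^esub>) = c \<odot>\<^bsub>M\<^esub> m"

definition regular_bimodule :: "('k, 'a) module \<Rightarrow> ('k, 'a, 'a, 'a) bimodule" where
  "regular_bimodule A =
    \<lparr>carrier = carrier A, monoid.mult = undefined, monoid.one = undefined,
     ring.zero = ring.zero A, ring.add = ring.add A, smult = smult A,
     lact = monoid.mult A, ract = monoid.mult A\<rparr>"

text \<open>A \<open>k\<close>-module viewed as a symmetric \<open>(k, k)\<close>-bimodule.\<close>

definition symmetric_bimodule :: "('k, 'm) module \<Rightarrow> ('k, 'k, 'k, 'm) bimodule" where
  "symmetric_bimodule M =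
    \<lparr>carrier = carrier M, monoid.mult = undefined, monoid.one = undefined,
     ring.zero = ring.zero M, ring.add = ring.add M, smult = smult M,
     lact = smult M, ract = (\<lambda>m c. smult M c m)\<rparr>"

definition linear_map ::
  "('k, 'e) ring_scheme \<Rightarrow> ('k, 'm, 'f) module_scheme \<Rightarrow> ('k, 'n, 'g) module_scheme
    \<Rightarrow> ('m \<Rightarrow> 'n) \<Rightarrow> bool" where
  "linear_map k M N f \<longleftrightarrow>
    f \<in> carrier M \<rightarrow> carrier N \<and>
    (\<forall>a\<in>carrier M. \<forall>b\<in>carrier M. f (a \<oplus>\<^bsub>M\<^esub> b) = f a \<oplus>\<^bsub>N\<^esub> f b) \<and>
    (\<forall>c\<in>carrier k. \<forall>a\<in>carrier M. f (c \<odot>\<^bsub>M\<^esub> a) = c \<odot>\<^bsub>N\<^esub> f a)"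

definition bimodule_map ::
  "('r, 'e) ring_scheme \<Rightarrow> ('s, 'f) ring_scheme \<Rightarrow> ('k, 'r, 's, 'm) bimodule
    \<Rightarrow> ('k, 'r, 's, 'n) bimodule \<Rightarrow> ('m \<Rightarrow> 'n) \<Rightarrow> bool" where
  "bimodule_map R S M N f \<longleftrightarrow>
    f \<in> carrier M \<rightarrow> carrier N \<and>
    (\<forall>a\<in>carrier M. \<forall>b\<in>carrier M. f (a \<oplus>\<^bsub>M\<^esub> b) = f a \<oplus>\<^bsub>N\<^esub> f b) \<and>
    (\<forall>r\<in>carrier R. \<forall>a\<in>carrier M. f (lact M r a) = lact N r (f a)) \<and>
    (\<forall>s\<in>carrier S. \<forall>a\<in>carrier M. f (ract M a s) = ract N (f a) s)"

definition algebra_map ::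
  "('k, 'e) ring_scheme \<Rightarrow> ('k, 'a, 'f) module_scheme \<Rightarrow> ('k, 'b, 'g) module_scheme
    \<Rightarrow> ('a \<Rightarrow> 'b) \<Rightarrow> bool" where
  "algebra_map k A B f \<longleftrightarrow> f \<in> ring_hom A B \<and> linear_map k A B f"

text \<open>
  The tensor product over \<open>R\<close> of a right \<open>R\<close>-module and a left \<open>R\<close>-module: the free abelian group on
  pairs modulo the subgroup generated by biadditivity and \<open>R\<close>-balancedness, so that its elements
  are cosets of formal integer combinations of pairs.
\<close>

type_synonym ('m, 'n) tens = "(('m \<times> 'n) \<Rightarrow>\<^sub>0 int) set"

definition tensor_relations ::
  "('r, 'e) ring_scheme \<Rightarrow> ('k, 'l, 'r, 'm) bimodule \<Rightarrow> ('k, 'r, 's, 'n) bimodule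
    \<Rightarrow> (('m \<times> 'n) \<Rightarrow>\<^sub>0 int) set" where
  "tensor_relations R M N =
    {frag_of (m \<oplus>\<^bsub>M\<^esub> m', n) - frag_of (m, n) - frag_of (m', n) | m m' n.
      m \<in> carrier M \<and> m' \<in> carrier M \<and> n \<in> carrier N} \<union>
    {frag_of (m, n \<oplus>\<^bsub>N\<^esub> n') - frag_of (m, n) - frag_of (m, n') | m n n'.
      m \<in> carrier M \<and> n \<in> carrier N \<and> n' \<in> carrier N} \<union>
    {frag_of (ract M m r, n) - frag_of (m, lact N r n) | m r n.
      m \<in> carrier M \<and> r \<in> carrier R \<and> n \<in> carrier N}"

definition tensor_kernel ::
  "('r, 'e) ring_scheme \<Rightarrow> ('k, 'l, 'r, 'm) bimodule \<Rightarrow> ('k, 'r, 's, 'n) bimodule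
    \<Rightarrow> (('m \<times> 'n) \<Rightarrow>\<^sub>0 int) set" where
  "tensor_kernel R M N =
    generate (free_Abelian_group (carrier M \<times> carrier N)) (tensor_relations R M N)"

definition tensor_group ::
  "('r, 'e) ring_scheme \<Rightarrow> ('k, 'l, 'r, 'm) bimodule \<Rightarrow> ('k, 'r, 's, 'n) bimodule
    \<Rightarrow> ('m, 'n) tens ring" where
  "tensor_group R M N =
    (let Q = free_Abelian_group (carrier M \<times> carrier N) Mod tensor_kernel R M N
     in \<lparr>carrier = carrier Q, monoid.mult = undefined, monoid.one = undefined,
         ring.zero = monoid.one Q, ring.add = monoid.mult Q\<rparr>)"

definition pure_tensor ::
  "('r, 'e) ring_scheme \<Rightarrow> ('k, 'l, 'r, 'm) bimodule \<Rightarrow> ('k, 'r, 's, 'n) bimodule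
    \<Rightarrow> 'm \<Rightarrow> 'n \<Rightarrow> ('m, 'n) tens" where
  "pure_tensor R M N m n =
    tensor_kernel R M N #>\<^bsub>free_Abelian_group (carrier M \<times> carrier N)\<^esub> frag_of (m, n)"

text \<open>
  For biadditive balanced \<open>\<phi>\<close> with values in the abelian group \<open>P\<close>, \<open>tensor_lift P \<phi>\<close> is the
  induced group homomorphism \<open>m \<otimes> n \<mapsto> \<phi> (m, n)\<close>: extend \<open>\<phi>\<close> additively to formal
  combinations and take the common value on the coset.
\<close>

definition tensor_lift ::
  "('p, 'e) ring_scheme \<Rightarrow> ('m \<times> 'n \<Rightarrow> 'p) \<Rightarrow> ('m, 'n) tens \<Rightarrow> 'p" where
  "tensor_lift P \<phi> t =
    the_elem ((\<lambda>c. \<Oplus>\<^bsub>P\<^esub>p\<in>Poly_Mapping.keys c. [Poly_Mapping.lookup c p] \<cdot>\<^bsub>P\<^esub> \<phi> p) ` t)"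

text \<open>\<open>f \<otimes> g\<close> as a map into \<open>M \<otimes>\<^sub>R N\<close>.\<close>

definition tensor_map ::
  "('r, 'e) ring_scheme \<Rightarrow> ('k, 'l, 'r, 'm) bimodule \<Rightarrow> ('k, 'r, 's, 'n) bimodule
    \<Rightarrow> ('a \<Rightarrow> 'm) \<Rightarrow> ('b \<Rightarrow> 'n) \<Rightarrow> ('a, 'b) tens \<Rightarrow> ('m, 'n) tens" where
  "tensor_map R M N f g =
    tensor_lift (tensor_group R M N) (\<lambda>(a, b). pure_tensor R M N (f a) (g b))"

definition tensor ::
  "('r, 'e) ring_scheme \<Rightarrow> ('k, 'l, 'r, 'm) bimodule \<Rightarrow> ('k, 'r, 's, 'n) bimodule
    \<Rightarrow> ('k, 'l, 's, ('m, 'n) tens) bimodule" where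
  "tensor R M N =
    \<lparr>carrier = carrier (tensor_group R M N), monoid.mult = undefined, monoid.one = undefined,
     ring.zero = ring.zero (tensor_group R M N), ring.add = ring.add (tensor_group R M N),
     smult = (\<lambda>c. tensor_map R M N (smult M c) (\<lambda>n. n)),
     lact = (\<lambda>l. tensor_map R M N (lact M l) (\<lambda>n. n)),
     ract = (\<lambda>t s. tensor_map R M N (\<lambda>m. m) (\<lambda>n. ract N n s) t)\<rparr>"

text \<open>The associator \<open>(M \<otimes>\<^sub>R N) \<otimes>\<^sub>S P \<rightarrow> M \<otimes>\<^sub>R (N \<otimes>\<^sub>S P)\<close>, \<open>(m \<otimes> n) \<otimes> p \<mapsto> m \<otimes> (n \<otimes> p)\<close>.\<close>

definition tensor_assoc ::
  "('r, 'e) ring_scheme \<Rightarrow> ('s, 'f) ring_scheme \<Rightarrow> ('k, 'l, 'r, 'm) bimodule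
    \<Rightarrow> ('k, 'r, 's, 'n) bimodule \<Rightarrow> ('k, 's, 't, 'p) bimodule
    \<Rightarrow> (('m, 'n) tens, 'p) tens \<Rightarrow> ('m, ('n, 'p) tens) tens" where
  "tensor_assoc R S M N P =
    (let T = tensor_group R M (tensor S N P)
     in tensor_lift T (\<lambda>(t, p).
          tensor_lift T (\<lambda>(m, n). pure_tensor R M (tensor S N P) m (pure_tensor S N P n p)) t))"

text \<open>The canonical isomorphisms \<open>R \<otimes>\<^sub>R M \<rightarrow> M\<close> and \<open>M \<otimes>\<^sub>S S \<rightarrow> M\<close>.\<close>

definition tensor_lunit :: "('k, 'r, 's, 'm) bimodule \<Rightarrow> ('r, 'm) tens \<Rightarrow> 'm" where
  "tensor_lunit M = tensor_lift M (\<lambda>(r, m). lact M r m)"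

definition tensor_runit :: "('k, 'r, 's, 'm) bimodule \<Rightarrow> ('m, 's) tens \<Rightarrow> 'm" where
  "tensor_runit M = tensor_lift M (\<lambda>(m, s). ract M m s)"


section \<open>1-cells\<close>

text \<open>
  HOL functions are total. So that cells are equal exactly when they are given by the same
  mathematical data, all components are required to be \<^const>\<open>undefined\<close> outside their domain
  (this is what the extensional function spaces \<open>\<rightarrow>\<^sub>E\<close> and \<open>\<Pi>\<^sub>E\<close> express), and irrelevant record
  fields are fixed to \<^const>\<open>undefined\<close>.

  In both 2-categories a 1-cell consists of a map \<open>omap\<close> on objects and maps \<open>hmap x y\<close>.
  Below, \<open>X\<close> and \<open>H x y\<close> are the objects and underlying sets of the source.
\<close>

record ('o, 'a) onecell =
  omap :: "'o \<Rightarrow> 'o"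
  hmap :: "'o \<Rightarrow> 'o \<Rightarrow> 'a \<Rightarrow> 'a"

definition onecell_data ::
  "'o set \<Rightarrow> ('o \<Rightarrow> 'o \<Rightarrow> 'a set) \<Rightarrow> 'o set \<Rightarrow> ('o \<Rightarrow> 'o \<Rightarrow> 'a set) \<Rightarrow> ('o, 'a) onecell set" where
  "onecell_data X H Y K =
    {f. omap f \<in> X \<rightarrow>\<^sub>E Y \<and>
        hmap f \<in> (\<Pi>\<^sub>E x\<in>X. \<Pi>\<^sub>E y\<in>X. H x y \<rightarrow>\<^sub>E K (omap f x) (omap f y))}"

definition onecell_id :: "'o set \<Rightarrow> ('o \<Rightarrow> 'o \<Rightarrow> 'a set) \<Rightarrow> ('o, 'a) onecell" where
  "onecell_id X H = \<lparr>omap = (\<lambda>x\<in>X. x), hmap = (\<lambda>x\<in>X. \<lambda>y\<in>X. \<lambda>a\<in>H x y. a)\<rparr>"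

definition onecell_comp ::
  "'o set \<Rightarrow> ('o \<Rightarrow> 'o \<Rightarrow> 'a set) \<Rightarrow> ('o, 'a) onecell \<Rightarrow> ('o, 'a) onecell \<Rightarrow> ('o, 'a) onecell" where
  "onecell_comp X H g f =
    \<lparr>omap = (\<lambda>x\<in>X. omap g (omap f x)),
     hmap = (\<lambda>x\<in>X. \<lambda>y\<in>X. \<lambda>a\<in>H x y. hmap g (omap f x) (omap f y) (hmap f x y a))\<rparr>"

definition extensional_module :: "('k, 'e) ring_scheme \<Rightarrow> ('k, 'a, 'f) module_scheme \<Rightarrow> bool" where
  "extensional_module k M \<longleftrightarrow>
    ring.add M \<in> carrier M \<rightarrow>\<^sub>E carrier M \<rightarrow>\<^sub>E carrier M \<and>
    smult M \<in> carrier k \<rightarrow>\<^sub>E carrier M \<rightarrow>\<^sub>E carrier M"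


section \<open>The 2-category of \<open>k\<close>-linear categories\<close>

text \<open>
  The class of objects is an arbitrary subset of the type \<open>'o\<close>, and the modules \<open>A\<^sub>x\<^sub>,\<^sub>y\<close> have
  carriers in the type \<open>'a\<close>; both types are parameters.
\<close>

record ('o, 'a, 'k) lincat =
  lobj :: "'o set"
  lhom :: "'o \<Rightarrow> 'o \<Rightarrow> ('k, 'a) module"
  lmult :: "'o \<Rightarrow> 'o \<Rightarrow> 'o \<Rightarrow> ('a, 'a) tens \<Rightarrow> 'a"
  lunit :: "'o \<Rightarrow> 'a"

definition khom_modules :: "('k, 'e) ring_scheme \<Rightarrow> ('k, 'a) module set" where
  "khom_modules k =
    {M. Module.module k M \<and> extensional_module k M \<and>
        monoid.mult M = undefined \<and> monoid.one M = undefined}"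

definition ltensor ::
  "('k, 'e) ring_scheme \<Rightarrow> ('o, 'a, 'k) lincat \<Rightarrow> 'o \<Rightarrow> 'o \<Rightarrow> 'o
    \<Rightarrow> ('k, 'k, 'k, ('a, 'a) tens) bimodule" where
  "ltensor k A x y z = tensor k (symmetric_bimodule (lhom A x y)) (symmetric_bimodule (lhom A y z))"

definition lprod ::
  "('k, 'e) ring_scheme \<Rightarrow> ('o, 'a, 'k) lincat \<Rightarrow> 'o \<Rightarrow> 'o \<Rightarrow> 'o \<Rightarrow> 'a \<Rightarrow> 'a \<Rightarrow> 'a" where
  "lprod k A x y z a b =
    lmult A x y z
      (pure_tensor k (symmetric_bimodule (lhom A x y)) (symmetric_bimodule (lhom A y z)) a b)"

definition lincats :: "('k, 'e) ring_scheme \<Rightarrow> ('o, 'a, 'k) lincat set" where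
  "lincats k =
    {A. lhom A \<in> lobj A \<rightarrow>\<^sub>E lobj A \<rightarrow>\<^sub>E khom_modules k \<and>
        lmult A \<in> (\<Pi>\<^sub>E x\<in>lobj A. \<Pi>\<^sub>E y\<in>lobj A. \<Pi>\<^sub>E z\<in>lobj A.
          carrier (ltensor k A x y z) \<rightarrow>\<^sub>E carrier (lhom A x z)) \<and>
        lunit A \<in> (\<Pi>\<^sub>E x\<in>lobj A. carrier (lhom A x x)) \<and>
        (\<forall>x\<in>lobj A. \<forall>y\<in>lobj A. \<forall>z\<in>lobj A.
          linear_map k (ltensor k A x y z) (lhom A x z) (lmult A x y z)) \<and>
        (\<forall>x\<in>lobj A. \<forall>y\<in>lobj A. \<forall>z\<in>lobj A. \<forall>u\<in>lobj A.
          \<forall>a\<in>carrier (lhom A x y). \<forall>b\<in>carrier (lhom A y z). \<forall>c\<in>carrier (lhom A z u).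
            lprod k A x y u a (lprod k A y z u b c) = lprod k A x z u (lprod k A x y z a b) c) \<and>
        (\<forall>x\<in>lobj A. \<forall>y\<in>lobj A. \<forall>a\<in>carrier (lhom A x y).
          lprod k A x x y (lunit A x) a = a \<and> lprod k A x y y a (lunit A y) = a)}"

definition lin_functors ::
  "('k, 'e) ring_scheme \<Rightarrow> ('o, 'a, 'k) lincat \<Rightarrow> ('o, 'a, 'k) lincat \<Rightarrow> ('o, 'a) onecell set" where
  "lin_functors k A B =
    {f \<in> onecell_data (lobj A) (\<lambda>x y. carrier (lhom A x y)) (lobj B) (\<lambda>x y. carrier (lhom B x y)).
      (\<forall>x\<in>lobj A. \<forall>y\<in>lobj A.
        linear_map k (lhom A x y) (lhom B (omap f x) (omap f y)) (hmap f x y)) \<and>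
      (\<forall>x\<in>lobj A. \<forall>y\<in>lobj A. \<forall>z\<in>lobj A. \<forall>a\<in>carrier (lhom A x y). \<forall>b\<in>carrier (lhom A y z).
        hmap f x z (lprod k A x y z a b)
          = lprod k B (omap f x) (omap f y) (omap f z) (hmap f x y a) (hmap f y z b)) \<and>
      (\<forall>x\<in>lobj A. hmap f x x (lunit A x) = lunit B (omap f x))}"

definition lin_transformations ::
  "('k, 'e) ring_scheme \<Rightarrow> ('o, 'a, 'k) lincat \<Rightarrow> ('o, 'a, 'k) lincat
    \<Rightarrow> ('o, 'a) onecell \<Rightarrow> ('o, 'a) onecell \<Rightarrow> ('o \<Rightarrow> 'a) set" where
  "lin_transformations k A B f g =
    {\<alpha> \<in> (\<Pi>\<^sub>E x\<in>lobj A. carrier (lhom B (omap g x) (omap f x))).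
      \<forall>x\<in>lobj A. \<forall>y\<in>lobj A. \<forall>a\<in>carrier (lhom A x y).
        lprod k B (omap g x) (omap g y) (omap f y) (hmap g x y a) (\<alpha> y)
          = lprod k B (omap g x) (omap f x) (omap f y) (\<alpha> x) (hmap f x y a)}"

definition kCat ::
  "('k, 'e) ring_scheme \<Rightarrow> (('o, 'a, 'k) lincat, ('o, 'a) onecell, 'o \<Rightarrow> 'a) two_cat" where
  "kCat k =
    \<lparr>cells0 = lincats k,
     cells1 = lin_functors k,
     cells2 = lin_transformations k,
     id1 = (\<lambda>A. onecell_id (lobj A) (\<lambda>x y. carrier (lhom A x y))),
     comp1 = (\<lambda>A B D g f. onecell_comp (lobj A) (\<lambda>x y. carrier (lhom A x y)) g f),
     id2 = (\<lambda>A B f. \<lambda>x\<in>lobj A. lunit B (omap f x)),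
     vcomp = (\<lambda>A B f g h \<beta> \<alpha>. \<lambda>x\<in>lobj A.
       lprod k B (omap h x) (omap g x) (omap f x) (\<beta> x) (\<alpha> x)),
     hcomp = (\<lambda>A B D f f' g g' \<alpha> \<beta>. \<lambda>x\<in>lobj A.
       lprod k D (omap g' (omap f' x)) (omap g' (omap f x)) (omap g (omap f x))
         (hmap g' (omap f' x) (omap f x) (\<alpha> x)) (\<beta> (omap f x)))\<rparr>"


section \<open>The 2-category of Morita contexts\<close>

record ('o, 'a, 'k) morita =
  mobj :: "'o set"
  malg :: "'o \<Rightarrow> ('k, 'a) module"
  mbim :: "'o \<Rightarrow> 'o \<Rightarrow> ('k, 'a, 'a, 'a) bimodule"
  mmult :: "'o \<Rightarrow> 'o \<Rightarrow> 'o \<Rightarrow> ('a, 'a) tens \<Rightarrow> 'a"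

definition kalgebras :: "('k, 'e) ring_scheme \<Rightarrow> ('k, 'a) module set" where
  "kalgebras k =
    {A. assoc_algebra k A \<and> extensional_module k A \<and>
        monoid.mult A \<in> carrier A \<rightarrow>\<^sub>E carrier A \<rightarrow>\<^sub>E carrier A}"

definition kbimodules ::
  "('k, 'e) ring_scheme \<Rightarrow> ('k, 'a) module \<Rightarrow> ('k, 'a) module
    \<Rightarrow> ('k, 'a, 'a, 'a) bimodule set" where
  "kbimodules k R S =
    {M. is_bimodule k R S M \<and> extensional_module k M \<and>
        monoid.mult M = undefined \<and> monoid.one M = undefined \<and>
        lact M \<in> carrier R \<rightarrow>\<^sub>E carrier M \<rightarrow>\<^sub>E carrier M \<and>
        ract M \<in> carrier M \<rightarrow>\<^sub>E carrier S \<rightarrow>\<^sub>E carrier M}"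

definition mtensor ::
  "('o, 'a, 'k) morita \<Rightarrow> 'o \<Rightarrow> 'o \<Rightarrow> 'o \<Rightarrow> ('k, 'a, 'a, ('a, 'a) tens) bimodule" where
  "mtensor A x y z = tensor (malg A y) (mbim A x y) (mbim A y z)"

definition mprod ::
  "('o, 'a, 'k) morita \<Rightarrow> 'o \<Rightarrow> 'o \<Rightarrow> 'o \<Rightarrow> 'a \<Rightarrow> 'a \<Rightarrow> 'a" where
  "mprod A x y z a b = mmult A x y z (pure_tensor (malg A y) (mbim A x y) (mbim A y z) a b)"

definition morita_contexts :: "('k, 'e) ring_scheme \<Rightarrow> ('o, 'a, 'k) morita set" where
  "morita_contexts k =
    {A. malg A \<in> mobj A \<rightarrow>\<^sub>E kalgebras k \<and>
        mbim A \<in> (\<Pi>\<^sub>E x\<in>mobj A. \<Pi>\<^sub>E y\<in>mobj A. kbimodules k (malg A x) (malg A y)) \<and>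
        (\<forall>x\<in>mobj A. mbim A x x = regular_bimodule (malg A x)) \<and>
        mmult A \<in> (\<Pi>\<^sub>E x\<in>mobj A. \<Pi>\<^sub>E y\<in>mobj A. \<Pi>\<^sub>E z\<in>mobj A.
          carrier (mtensor A x y z) \<rightarrow>\<^sub>E carrier (mbim A x z)) \<and>
        (\<forall>x\<in>mobj A. \<forall>y\<in>mobj A. \<forall>z\<in>mobj A.
          bimodule_map (malg A x) (malg A z) (mtensor A x y z) (mbim A x z) (mmult A x y z)) \<and>
        (\<forall>x\<in>mobj A. \<forall>y\<in>mobj A. \<forall>t\<in>carrier (mtensor A x x y).
          mmult A x x y t = tensor_lunit (mbim A x y) t) \<and>
        (\<forall>x\<in>mobj A. \<forall>y\<in>mobj A. \<forall>t\<in>carrier (mtensor A x y y).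
          mmult A x y y t = tensor_runit (mbim A x y) t) \<and>
        (\<forall>x\<in>mobj A. \<forall>y\<in>mobj A. \<forall>z\<in>mobj A. \<forall>u\<in>mobj A.
          \<forall>t\<in>carrier (tensor (malg A z) (mtensor A x y z) (mbim A z u)).
            mmult A x y u
              (tensor_map (malg A y) (mbim A x y) (mbim A y u) (\<lambda>a. a) (mmult A y z u)
                (tensor_assoc (malg A y) (malg A z) (mbim A x y) (mbim A y z) (mbim A z u) t))
            = mmult A x z u
                (tensor_map (malg A z) (mbim A x z) (mbim A z u) (mmult A x y z) (\<lambda>c. c) t))}"

definition morita_maps ::
  "('k, 'e) ring_scheme \<Rightarrow> ('o, 'a, 'k) morita \<Rightarrow> ('o, 'a, 'k) morita \<Rightarrow> ('o, 'a) onecell set" where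
  "morita_maps k A B =
    {f \<in> onecell_data (mobj A) (\<lambda>x y. carrier (mbim A x y)) (mobj B) (\<lambda>x y. carrier (mbim B x y)).
      (\<forall>x\<in>mobj A. \<forall>y\<in>mobj A.
        linear_map k (mbim A x y) (mbim B (omap f x) (omap f y)) (hmap f x y)) \<and>
      (\<forall>x\<in>mobj A. algebra_map k (malg A x) (malg B (omap f x)) (hmap f x x)) \<and>
      (\<forall>x\<in>mobj A. \<forall>y\<in>mobj A.
        \<forall>a'\<in>carrier (malg A x). \<forall>a\<in>carrier (mbim A x y). \<forall>a''\<in>carrier (malg A y).
          hmap f x y (ract (mbim A x y) (lact (mbim A x y) a' a) a'')
            = ract (mbim B (omap f x) (omap f y))
                (lact (mbim B (omap f x) (omap f y)) (hmap f x x a') (hmap f x y a))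
                (hmap f y y a'')) \<and>
      (\<forall>x\<in>mobj A. \<forall>y\<in>mobj A. \<forall>z\<in>mobj A. \<forall>t\<in>carrier (mtensor A x y z).
        hmap f x z (mmult A x y z t)
          = mmult B (omap f x) (omap f y) (omap f z)
              (tensor_map (malg B (omap f y)) (mbim B (omap f x) (omap f y))
                (mbim B (omap f y) (omap f z)) (hmap f x y) (hmap f y z) t))}"

definition morita_transformations ::
  "('o, 'a, 'k) morita \<Rightarrow> ('o, 'a, 'k) morita
    \<Rightarrow> ('o, 'a) onecell \<Rightarrow> ('o, 'a) onecell \<Rightarrow> ('o \<Rightarrow> 'a) set" where
  "morita_transformations A B f g =
    {\<alpha> \<in> (\<Pi>\<^sub>E x\<in>mobj A. carrier (mbim B (omap g x) (omap f x))).
      \<forall>x\<in>mobj A. \<forall>y\<in>mobj A. \<forall>a\<in>carrier (mbim A x y).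
        mprod B (omap g x) (omap g y) (omap f y) (hmap g x y a) (\<alpha> y)
          = mprod B (omap g x) (omap f x) (omap f y) (\<alpha> x) (hmap f x y a)}"

definition kMor ::
  "('k, 'e) ring_scheme \<Rightarrow> (('o, 'a, 'k) morita, ('o, 'a) onecell, 'o \<Rightarrow> 'a) two_cat" where
  "kMor k =
    \<lparr>cells0 = morita_contexts k,
     cells1 = morita_maps k,
     cells2 = morita_transformations,
     id1 = (\<lambda>A. onecell_id (mobj A) (\<lambda>x y. carrier (mbim A x y))),
     comp1 = (\<lambda>A B D g f. onecell_comp (mobj A) (\<lambda>x y. carrier (mbim A x y)) g f),
     id2 = (\<lambda>A B f. \<lambda>x\<in>mobj A. monoid.one (malg B (omap f x))),
     vcomp = (\<lambda>A B f g h \<beta> \<alpha>. \<lambda>x\<in>mobj A.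
       mprod B (omap h x) (omap g x) (omap f x) (\<beta> x) (\<alpha> x)),
     hcomp = (\<lambda>A B D f f' g g' \<alpha> \<beta>. \<lambda>x\<in>mobj A.
       mprod D (omap g' (omap f' x)) (omap g' (omap f x)) (omap g (omap f x))
         (hmap g' (omap f' x) (omap f x) (\<alpha> x)) (\<beta> (omap f x)))\<rparr>"

end

theory Submission
  imports Defs
begin

text \<open>
  In a \<open>k\<close>-linear category the modules \<open>A\<^sub>x\<^sub>,\<^sub>x\<close> are algebras and the \<open>A\<^sub>x\<^sub>,\<^sub>y\<close> bimodules over them, all
  actions being instances of the composition; associativity says in particular that composition is
  balanced over \<open>A\<^sub>y\<^sub>,\<^sub>y\<close>, hence factors through \<open>A\<^sub>x\<^sub>,\<^sub>y \<otimes> A\<^sub>y\<^sub>,\<^sub>z\<close> taken over \<open>A\<^sub>y\<^sub>,\<^sub>y\<close>. Conversely, in a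
  Morita context \<open>k\<close> acts through the algebras, so the maps out of the tensor products over \<open>A\<^sub>y\<^sub>,\<^sub>y\<close>
  induce \<open>k\<close>-linear maps out of those over \<open>k\<close>. Both multiplications have the same values on
  pure tensors, so the two constructions are mutually inverse on 0-cells, and the 1-cells, 2-cells and
  compositions on both sides are literally the same. Only one side therefore has to be shown to be a
  2-category.
\<close>

section \<open>Transport along a bijection of 0-cells\<close>

text \<open>An isomorphism, unlike an equivalence, demands that each round trip return the very same
  record. Hence every induced multiplication and action is cut off to \<open>undefined\<close>
  outside its carrier, and equality of structure maps is reduced to equality on carriers. No map
  between the tensor products over \<open>k\<close> and over the middle algebra is ever formed. The
  universal property turns either multiplication into an operation on elements, \<open>lprod\<close>
  or \<open>mprod\<close>, and the two sides meet there; this loses nothing, since an additive map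
  out of a tensor product is determined by its values on pure tensors. The delicate conditions are
  those containing \<open>tensor_map\<close> or \<open>tensor_assoc\<close>: their values on pure
  tensors are known only after the map to be lifted is known to be balanced, so balancedness has to
  be extracted from other conditions first. The axioms of a 2-category are checked for
  \<open>k\<close>-linear categories, where they are equations between elements under one
  associative product.\<close>

lemma isomorphic_two_categories_transport:
  fixes S :: "('b0, 'c1, 'c2) two_cat" and T :: "('c0, 'c1, 'c2) two_cat"
  assumes "two_category S"
    and F0: "\<And>A. A \<in> cells0 S \<Longrightarrow> F A \<in> cells0 T"
    and G0: "\<And>A. A \<in> cells0 T \<Longrightarrow> G A \<in> cells0 S"
    and GF: "\<And>A. A \<in> cells0 S \<Longrightarrow> G (F A) = A"
    and FG: "\<And>A. A \<in> cells0 T \<Longrightarrow> F (G A) = A"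
    and cells1_eq: "\<And>A B. \<lbrakk>A \<in> cells0 S; B \<in> cells0 S\<rbrakk> \<Longrightarrow> cells1 T (F A) (F B) = cells1 S A B"
    and cells2_eq: "\<And>A B f g. \<lbrakk>A \<in> cells0 S; B \<in> cells0 S; f \<in> cells1 S A B; g \<in> cells1 S A B\<rbrakk>
      \<Longrightarrow> cells2 T (F A) (F B) f g = cells2 S A B f g"
    and id1_eq: "\<And>A. A \<in> cells0 S \<Longrightarrow> id1 T (F A) = id1 S A"
    and comp1_eq: "\<And>A B D f g. \<lbrakk>A \<in> cells0 S; B \<in> cells0 S; D \<in> cells0 S;
        f \<in> cells1 S A B; g \<in> cells1 S B D\<rbrakk>
      \<Longrightarrow> comp1 T (F A) (F B) (F D) g f = comp1 S A B D g f"
    and id2_eq: "\<And>A B f. \<lbrakk>A \<in> cells0 S; B \<in> cells0 S; f \<in> cells1 S A B\<rbrakk>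
      \<Longrightarrow> id2 T (F A) (F B) f = id2 S A B f"
    and vcomp_eq: "\<And>A B f g h \<alpha> \<beta>. \<lbrakk>A \<in> cells0 S; B \<in> cells0 S;
        f \<in> cells1 S A B; g \<in> cells1 S A B; h \<in> cells1 S A B;
        \<alpha> \<in> cells2 S A B f g; \<beta> \<in> cells2 S A B g h\<rbrakk>
      \<Longrightarrow> vcomp T (F A) (F B) f g h \<beta> \<alpha> = vcomp S A B f g h \<beta> \<alpha>"
    and hcomp_eq: "\<And>A B D f f' g g' \<alpha> \<beta>. \<lbrakk>A \<in> cells0 S; B \<in> cells0 S; D \<in> cells0 S;
        f \<in> cells1 S A B; f' \<in> cells1 S A B; g \<in> cells1 S B D; g' \<in> cells1 S B D;
        \<alpha> \<in> cells2 S A B f f'; \<beta> \<in> cells2 S B D g g'\<rbrakk>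
      \<Longrightarrow> hcomp T (F A) (F B) (F D) f f' g g' \<alpha> \<beta> = hcomp S A B D f f' g g' \<alpha> \<beta>"
  shows "isomorphic_two_categories S T"
proof -
  interpret S: two_category S by fact
  note eqs = cells1_eq cells2_eq id1_eq comp1_eq id2_eq vcomp_eq hcomp_eq
  note closed = S.id1_closed S.comp1_closed S.id2_closed S.vcomp_closed S.hcomp_closed
  \<comment> \<open>Every 0-cell of \<open>T\<close> is some \<open>F A\<close>, so each axiom of
    \<open>T\<close> becomes one of \<open>S\<close> after rewriting. The operations are assumed to
    agree on actual cells only; the closure axioms of \<open>S\<close> keep all intermediate
    composites within that range.\<close>
  have cells0_T: "cells0 T = F ` cells0 S"
    using F0 G0 FG by (metis image_eqI image_subsetI subsetI subset_antisym)
  interpret T: two_category T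
    apply unfold_locales
    subgoal by (auto simp: cells0_T eqs closed)
    subgoal by (auto simp: cells0_T eqs closed)
    subgoal by (auto simp: cells0_T eqs closed S.comp1_id_left)
    subgoal by (auto simp: cells0_T eqs closed S.comp1_id_right)
    subgoal by (auto simp: cells0_T eqs closed S.comp1_assoc)
    subgoal by (auto simp: cells0_T eqs closed)
    subgoal by (auto simp: cells0_T eqs closed)
    subgoal by (auto simp: cells0_T eqs closed S.vcomp_id_left)
    subgoal by (auto simp: cells0_T eqs closed S.vcomp_id_right)
    subgoal by (auto simp: cells0_T eqs closed S.vcomp_assoc)
    subgoal by (auto simp: cells0_T eqs closed)
    subgoal by (auto simp: cells0_T eqs closed S.hcomp_id_left)
    subgoal by (auto simp: cells0_T eqs closed S.hcomp_id_right)
    subgoal by (auto simp: cells0_T eqs closed S.hcomp_assoc)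
    subgoal by (auto simp: cells0_T eqs closed S.hcomp_id2)
    subgoal by (auto simp: cells0_T eqs closed S.interchange)
    done
  define F' :: "('b0, 'c1, 'c2, 'c0, 'c1, 'c2) two_fun"
    where "F' = \<lparr>map0 = F, map1 = (\<lambda>A B f. f), map2 = (\<lambda>A B f g \<alpha>. \<alpha>)\<rparr>"
  define G' :: "('c0, 'c1, 'c2, 'b0, 'c1, 'c2) two_fun"
    where "G' = \<lparr>map0 = G, map1 = (\<lambda>A B f. f), map2 = (\<lambda>A B f g \<alpha>. \<alpha>)\<rparr>"
  have "two_functor S T F'"
    by unfold_locales (simp_all add: F'_def F0 eqs)
  moreover have "two_functor T S G'"
    by unfold_locales (auto simp: G'_def cells0_T GF eqs)
  moreover have "left_inverse_two_fun S G' F'" "left_inverse_two_fun T F' G'"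
    by (simp_all add: left_inverse_two_fun_def F'_def G'_def GF FG)
  ultimately show ?thesis
    unfolding isomorphic_two_categories_def by blast
qed

section \<open>Universal property of the tensor product\<close>

text \<open>Only carriers and additions of the two records enter, so an additive map can be moved
  freely between a module, its symmetric bimodule and any other record on the same abelian
  group.\<close>

definition add_hom ::
  "('m, 'e) ring_scheme \<Rightarrow> ('n, 'f) ring_scheme \<Rightarrow> ('m \<Rightarrow> 'n) set" where
  "add_hom M N = hom (add_monoid M) (add_monoid N)"

lemma add_homI:
  assumes "\<And>x. x \<in> carrier M \<Longrightarrow> f x \<in> carrier N"
    and "\<And>x y. \<lbrakk>x \<in> carrier M; y \<in> carrier M\<rbrakk> \<Longrightarrow> f (x \<oplus>\<^bsub>M\<^esub> y) = f x \<oplus>\<^bsub>N\<^esub> f y"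
  shows "f \<in> add_hom M N"
  using assms by (simp add: add_hom_def hom_def)

lemma add_hom_closed: "\<lbrakk>f \<in> add_hom M N; x \<in> carrier M\<rbrakk> \<Longrightarrow> f x \<in> carrier N"
  by (auto simp: add_hom_def hom_def)

lemma add_hom_add:
  "\<lbrakk>f \<in> add_hom M N; x \<in> carrier M; y \<in> carrier M\<rbrakk> \<Longrightarrow> f (x \<oplus>\<^bsub>M\<^esub> y) = f x \<oplus>\<^bsub>N\<^esub> f y"
  by (auto simp: add_hom_def hom_def)

lemma add_hom_comp: "\<lbrakk>f \<in> add_hom M N; g \<in> add_hom N P\<rbrakk> \<Longrightarrow> (\<lambda>x. g (f x)) \<in> add_hom M P"
  unfolding add_hom_def using hom_compose by (fastforce simp: comp_def)

text \<open>Closure and one condition for each of the three families in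
  \<open>tensor_relations\<close>. The target carries no action, so the same notion serves tensor
  products over \<open>k\<close> and over the algebras.\<close>

definition balanced_map ::
  "('r, 'e) ring_scheme \<Rightarrow> ('k, 'l, 'r, 'm) bimodule \<Rightarrow> ('k, 'r, 's, 'n) bimodule
    \<Rightarrow> ('p, 'f) ring_scheme \<Rightarrow> ('m \<Rightarrow> 'n \<Rightarrow> 'p) \<Rightarrow> bool" where
  "balanced_map R M N P \<phi> \<longleftrightarrow>
    (\<forall>m\<in>carrier M. \<forall>n\<in>carrier N. \<phi> m n \<in> carrier P) \<and>
    (\<forall>m\<in>carrier M. \<forall>m'\<in>carrier M. \<forall>n\<in>carrier N. \<phi> (m \<oplus>\<^bsub>M\<^esub> m') n = \<phi> m n \<oplus>\<^bsub>P\<^esub> \<phi> m' n) \<and>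
    (\<forall>m\<in>carrier M. \<forall>n\<in>carrier N. \<forall>n'\<in>carrier N. \<phi> m (n \<oplus>\<^bsub>N\<^esub> n') = \<phi> m n \<oplus>\<^bsub>P\<^esub> \<phi> m n') \<and>
    (\<forall>m\<in>carrier M. \<forall>r\<in>carrier R. \<forall>n\<in>carrier N. \<phi> (ract M m r) n = \<phi> m (lact N r n))"

lemma balanced_mapI:
  assumes "\<And>m n. \<lbrakk>m \<in> carrier M; n \<in> carrier N\<rbrakk> \<Longrightarrow> \<phi> m n \<in> carrier P"
    and "\<And>m m' n. \<lbrakk>m \<in> carrier M; m' \<in> carrier M; n \<in> carrier N\<rbrakk>
      \<Longrightarrow> \<phi> (m \<oplus>\<^bsub>M\<^esub> m') n = \<phi> m n \<oplus>\<^bsub>P\<^esub> \<phi> m' n"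
    and "\<And>m n n'. \<lbrakk>m \<in> carrier M; n \<in> carrier N; n' \<in> carrier N\<rbrakk>
      \<Longrightarrow> \<phi> m (n \<oplus>\<^bsub>N\<^esub> n') = \<phi> m n \<oplus>\<^bsub>P\<^esub> \<phi> m n'"
    and "\<And>m r n. \<lbrakk>m \<in> carrier M; r \<in> carrier R; n \<in> carrier N\<rbrakk>
      \<Longrightarrow> \<phi> (ract M m r) n = \<phi> m (lact N r n)"
  shows "balanced_map R M N P \<phi>"
  using assms unfolding balanced_map_def by blast

section \<open>The quotient of the free abelian group on pairs\<close>

lemma keys_frag_diff: "Poly_Mapping.keys (a - b) \<subseteq> S"
  if "Poly_Mapping.keys a \<subseteq> S" "Poly_Mapping.keys b \<subseteq> S" for a b :: "'x \<Rightarrow>\<^sub>0 int"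
  using that keys_diff[of a b] by blast

lemma keys_frag_add: "Poly_Mapping.keys (a + b) \<subseteq> S"
  if "Poly_Mapping.keys a \<subseteq> S" "Poly_Mapping.keys b \<subseteq> S" for a b :: "'x \<Rightarrow>\<^sub>0 int"
  using that keys_add[of a b] by blast

text \<open>Just enough for the relations to lie in the free group and for the quotient to make
  sense. In this weak form the locale also covers factors that are tensor products themselves,
  without turning those into bimodules first.\<close>

locale tensor_factors = M: abelian_group M + N: abelian_group N
  for R :: "('r, 'e) ring_scheme" and M :: "('k, 'l, 'r, 'm) bimodule"
    and N :: "('k, 'r, 's, 'n) bimodule" +
  assumes ract_M_closed: "\<lbrakk>m \<in> carrier M; r \<in> carrier R\<rbrakk> \<Longrightarrow> ract M m r \<in> carrier M"
    and lact_N_closed: "\<lbrakk>r \<in> carrier R; n \<in> carrier N\<rbrakk> \<Longrightarrow> lact N r n \<in> carrier N"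
begin

abbreviation pairs where "pairs \<equiv> free_Abelian_group (carrier M \<times> carrier N)"
abbreviation relators where "relators \<equiv> tensor_kernel R M N"

lemma tensor_relations_subset: "tensor_relations R M N \<subseteq> carrier pairs"
  unfolding tensor_relations_def
  by (rule subsetI, elim UnE CollectE exE conjE)
    (simp_all add: ract_M_closed lact_N_closed keys_frag_diff)

lemma subgroup_relators: "subgroup relators pairs"
  unfolding tensor_kernel_def
  by (rule group.generate_is_subgroup[OF group_free_Abelian_group tensor_relations_subset])

lemma normal_relators: "relators \<lhd> pairs"
  using subgroup_relators comm_group.subgroup_imp_normal[OF abelian_free_Abelian_group] by blast

lemma relation_in_relators: "x \<in> tensor_relations R M N \<Longrightarrow> x \<in> relators"
  unfolding tensor_kernel_def by (rule generate.incl)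

lemma carrier_tensor_group: "carrier (tensor_group R M N) = (\<lambda>c. relators #>\<^bsub>pairs\<^esub> c) ` carrier pairs"
  by (simp add: tensor_group_def Let_def carrier_FactGroup)

text \<open>The additive structure is the factor group on the nose, so facts about factor groups
  apply to it.\<close>

lemma add_monoid_tensor_group_eq:
  "add_monoid (tensor_group R M N) = pairs Mod relators"
  by (simp add: tensor_group_def Let_def FactGroup_def)

lemma abelian_group_tensor_group: "abelian_group (tensor_group R M N)"
  by (rule comm_group_abelian_groupI, unfold add_monoid_tensor_group_eq)
    (rule comm_group.abelian_FactGroup[OF abelian_free_Abelian_group subgroup_relators])

lemma add_cosets:
  assumes "x \<in> carrier pairs" "y \<in> carrier pairs"
  shows "(relators #>\<^bsub>pairs\<^esub> x) \<oplus>\<^bsub>tensor_group R M N\<^esub> (relators #>\<^bsub>pairs\<^esub> y) = relators #>\<^bsub>pairs\<^esub> (x + y)"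
  using normal.rcos_sum[OF normal_relators assms] by (simp add: tensor_group_def Let_def)

lemma coset_hom: "(\<lambda>x. relators #>\<^bsub>pairs\<^esub> x) \<in> hom pairs (add_monoid (tensor_group R M N))"
  unfolding add_monoid_tensor_group_eq by (rule normal.r_coset_hom_Mod[OF normal_relators])

lemma coset_eqI:
  assumes "x \<in> carrier pairs" "y \<in> carrier pairs" "x - y \<in> relators"
  shows "relators #>\<^bsub>pairs\<^esub> x = relators #>\<^bsub>pairs\<^esub> y"
proof -
  have "x = (x - y) \<otimes>\<^bsub>pairs\<^esub> y" by simp
  then have "x \<in> relators #>\<^bsub>pairs\<^esub> y" using assms(3) unfolding r_coset_def by blast
  then show ?thesis
    using group.repr_independence[OF group_free_Abelian_group _ _ subgroup_relators] assms(2) by metis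
qed

lemma pure_tensor_closed:
  "\<lbrakk>m \<in> carrier M; n \<in> carrier N\<rbrakk> \<Longrightarrow> pure_tensor R M N m n \<in> carrier (tensor_group R M N)"
  by (auto simp: carrier_tensor_group pure_tensor_def)

text \<open>Two formal combinations have the same coset when their difference is a relator, and each
  clause is one of the three families of relators.\<close>

lemma pure_tensor_balanced: "balanced_map R M N (tensor_group R M N) (pure_tensor R M N)"
proof (rule balanced_mapI)
  fix m m' n assume *: "m \<in> carrier M" "m' \<in> carrier M" "n \<in> carrier N"
  then have "frag_of (m \<oplus>\<^bsub>M\<^esub> m', n) - frag_of (m, n) - frag_of (m', n) \<in> relators"
    by (intro relation_in_relators) (auto simp: tensor_relations_def)
  then have "frag_of (m \<oplus>\<^bsub>M\<^esub> m', n) - (frag_of (m, n) + frag_of (m', n)) \<in> relators"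
    by (simp add: diff_diff_add)
  with * show "pure_tensor R M N (m \<oplus>\<^bsub>M\<^esub> m') n
      = pure_tensor R M N m n \<oplus>\<^bsub>tensor_group R M N\<^esub> pure_tensor R M N m' n"
    unfolding pure_tensor_def
    by (simp add: add_cosets coset_eqI keys_frag_add)
next
  fix m n n' assume *: "m \<in> carrier M" "n \<in> carrier N" "n' \<in> carrier N"
  then have "frag_of (m, n \<oplus>\<^bsub>N\<^esub> n') - frag_of (m, n) - frag_of (m, n') \<in> relators"
    by (intro relation_in_relators) (auto simp: tensor_relations_def)
  then have "frag_of (m, n \<oplus>\<^bsub>N\<^esub> n') - (frag_of (m, n) + frag_of (m, n')) \<in> relators"
    by (simp add: diff_diff_add)
  with * show "pure_tensor R M N m (n \<oplus>\<^bsub>N\<^esub> n')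
      = pure_tensor R M N m n \<oplus>\<^bsub>tensor_group R M N\<^esub> pure_tensor R M N m n'"
    unfolding pure_tensor_def
    by (simp add: add_cosets coset_eqI keys_frag_add)
next
  fix m r n assume *: "m \<in> carrier M" "r \<in> carrier R" "n \<in> carrier N"
  then have "frag_of (ract M m r, n) - frag_of (m, lact N r n) \<in> relators"
    by (intro relation_in_relators) (auto simp: tensor_relations_def)
  with * show "pure_tensor R M N (ract M m r) n = pure_tensor R M N m (lact N r n)"
    unfolding pure_tensor_def
    by (intro coset_eqI) (auto simp: ract_M_closed lact_N_closed)
qed (rule pure_tensor_closed)

text \<open>Composed with the projection to cosets, both maps become homomorphisms on a free abelian
  group, and these are determined on the basis of pairs. Identities between maps out of tensor
  products are reduced to elements in this way throughout.\<close>

lemma tensor_group_hom_eqI: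
  assumes P: "abelian_group P"
    and f: "f \<in> add_hom (tensor_group R M N) P"
    and g: "g \<in> add_hom (tensor_group R M N) P"
    and pure: "\<And>m n. \<lbrakk>m \<in> carrier M; n \<in> carrier N\<rbrakk>
      \<Longrightarrow> f (pure_tensor R M N m n) = g (pure_tensor R M N m n)"
    and t: "t \<in> carrier (tensor_group R M N)"
  shows "f t = g t"
proof -
  interpret P: abelian_group P by fact
  let ?c = "\<lambda>x. relators #>\<^bsub>pairs\<^esub> x"
  have P': "group (add_monoid P)" by (rule P.a_group)
  have hf: "group_hom pairs (add_monoid P) (\<lambda>x. f (?c x))"
    using hom_compose[OF coset_hom f[unfolded add_hom_def]] P' by (simp add: group_hom_def group_hom_axioms_def comp_def)
  have hg: "group_hom pairs (add_monoid P) (\<lambda>x. g (?c x))"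
    using hom_compose[OF coset_hom g[unfolded add_hom_def]] P' by (simp add: group_hom_def group_hom_axioms_def comp_def)
  obtain x where x: "x \<in> carrier pairs" "t = ?c x"
    using t by (auto simp: carrier_tensor_group)
  from x(1) have "Poly_Mapping.keys x \<subseteq> carrier M \<times> carrier N" by simp
  then have "f (?c x) = g (?c x)"
  proof (rule free_Abelian_group_induct)
    show "f (?c 0) = g (?c 0)"
      using group_hom.hom_one[OF hf] group_hom.hom_one[OF hg] by simp
  next
    fix x y
    assume xy: "Poly_Mapping.keys x \<subseteq> carrier M \<times> carrier N" "Poly_Mapping.keys y \<subseteq> carrier M \<times> carrier N"
      and "f (?c x) = g (?c x)" "f (?c y) = g (?c y)"
    \<comment> \<open>The induction closes under differences, whereas homomorphisms respect the
      group operation and inverses.\<close>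
    moreover have "x - y = x \<otimes>\<^bsub>pairs\<^esub> inv\<^bsub>pairs\<^esub> y" "inv\<^bsub>pairs\<^esub> y \<in> carrier pairs" using xy by simp_all
    ultimately show "f (?c (x - y)) = g (?c (x - y))"
      using group_hom.hom_mult[OF hf, of x "inv\<^bsub>pairs\<^esub> y"] group_hom.hom_inv[OF hf, of y]
        group_hom.hom_mult[OF hg, of x "inv\<^bsub>pairs\<^esub> y"] group_hom.hom_inv[OF hg, of y] by simp
  next
    fix a assume "a \<in> carrier M \<times> carrier N"
    then show "f (?c (frag_of a)) = g (?c (frag_of a))"
      using pure[of "fst a" "snd a"] by (auto simp: pure_tensor_def)
  qed
  then show ?thesis using x by simp
qed

text \<open>The additive extension \<open>h\<close> of \<open>\<phi>\<close> to formal combinations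
  kills the relators, so it is constant on each coset; \<open>tensor_lift\<close> returns that
  constant.\<close>

lemma tensor_lift:
  assumes P: "abelian_group P" and \<phi>: "balanced_map R M N P \<phi>"
  shows tensor_lift_hom: "tensor_lift P (\<lambda>(m, n). \<phi> m n) \<in> add_hom (tensor_group R M N) P"
    and tensor_lift_pure: "\<lbrakk>m \<in> carrier M; n \<in> carrier N\<rbrakk>
      \<Longrightarrow> tensor_lift P (\<lambda>(m, n). \<phi> m n) (pure_tensor R M N m n) = \<phi> m n"
proof -
  interpret P: abelian_group P by fact
  let ?\<phi> = "\<lambda>(m, n). \<phi> m n"
  let ?X = "carrier M \<times> carrier N"
  define h where
    "h c = (\<Oplus>\<^bsub>P\<^esub>p\<in>Poly_Mapping.keys c. [Poly_Mapping.lookup c p] \<cdot>\<^bsub>P\<^esub> ?\<phi> p)"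
    for c :: "'m \<times> 'n \<Rightarrow>\<^sub>0 int"
  have img: "?\<phi> ` ?X \<subseteq> carrier P"
    using \<phi> by (auto simp: balanced_map_def)
  then have \<phi>_closed: "?\<phi> p \<in> carrier P" if "p \<in> ?X" for p
    using that by blast
  \<comment> \<open>The sum defining \<open>h\<close> runs over the keys of \<open>c\<close>, which
    change under addition. Coefficients outside the keys are zero, so any larger finite set of pairs
    may be used, in particular a common one for \<open>x\<close>, \<open>y\<close> and
    \<open>x + y\<close>.\<close>
  have ext: "h c = (\<Oplus>\<^bsub>P\<^esub>p\<in>B. [Poly_Mapping.lookup c p] \<cdot>\<^bsub>P\<^esub> ?\<phi> p)"
    if "finite B" "Poly_Mapping.keys c \<subseteq> B" "B \<subseteq> ?X" for B c
    unfolding h_def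
  proof (rule P.add.finprod_mono_neutral_cong_left[OF that(1,2)])
    have *: "?\<phi> p \<in> carrier P" if "p \<in> B" for p
      using \<phi>_closed \<open>B \<subseteq> ?X\<close> that by blast
    show "[Poly_Mapping.lookup c p] \<cdot>\<^bsub>P\<^esub> ?\<phi> p = \<zero>\<^bsub>P\<^esub>" if "p \<in> B - Poly_Mapping.keys c" for p
      using that by (simp add: in_keys_iff add_pow_def)
    show "(\<lambda>p. [Poly_Mapping.lookup c p] \<cdot>\<^bsub>P\<^esub> ?\<phi> p) \<in> B \<rightarrow> carrier P"
      by (rule funcsetI, rule P.add.int_pow_closed, rule *)
  qed simp_all
  have h_hom: "h \<in> hom pairs (add_monoid P)"
  proof (rule homI)
    fix x assume "x \<in> carrier pairs"
    then show "h x \<in> carrier (add_monoid P)"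
      unfolding h_def using \<phi>_closed by (auto intro!: P.finsum_closed)
  next
    fix x y assume xy: "x \<in> carrier pairs" "y \<in> carrier pairs"
    let ?B = "Poly_Mapping.keys x \<union> Poly_Mapping.keys y"
    have B: "?B \<subseteq> ?X" using xy by simp
    have "h (x + y) = (\<Oplus>\<^bsub>P\<^esub>p\<in>?B. [Poly_Mapping.lookup (x + y) p] \<cdot>\<^bsub>P\<^esub> ?\<phi> p)"
      by (rule ext) (use B keys_add[of x y] in auto)
    also have "\<dots> = (\<Oplus>\<^bsub>P\<^esub>p\<in>?B. [Poly_Mapping.lookup x p] \<cdot>\<^bsub>P\<^esub> ?\<phi> p \<oplus>\<^bsub>P\<^esub> [Poly_Mapping.lookup y p] \<cdot>\<^bsub>P\<^esub> ?\<phi> p)"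
      by (rule P.finsum_cong')
        (use B \<phi>_closed in \<open>auto simp: Poly_Mapping.lookup_add P.add.int_pow_mult simp del: split_paired_All\<close>)
    also have "\<dots> = h x \<oplus>\<^bsub>P\<^esub> h y"
      using B \<phi>_closed by (subst P.finsum_addf) (auto simp: ext[where B = ?B])
    finally show "h (x \<otimes>\<^bsub>pairs\<^esub> y) = h x \<otimes>\<^bsub>add_monoid P\<^esub> h y" by simp
  qed
  have h_of: "h (frag_of p) = ?\<phi> p" if "p \<in> ?X" for p
    using \<phi>_closed[OF that] by (auto simp: h_def)
  interpret h: group_hom pairs "add_monoid P" h
    using h_hom P.a_group by (simp add: group_hom_def group_hom_axioms_def)
  have h_diff: "h (x - y) = h x \<ominus>\<^bsub>P\<^esub> h y" if "x \<in> carrier pairs" "y \<in> carrier pairs" for x y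
  proof -
    have "h (x \<otimes>\<^bsub>pairs\<^esub> inv\<^bsub>pairs\<^esub> y) = h x \<oplus>\<^bsub>P\<^esub> \<ominus>\<^bsub>P\<^esub> h y"
      using that by (simp only: h.hom_mult h.hom_inv group.inv_closed[OF group_free_Abelian_group])
        (simp add: a_inv_def)
    then show ?thesis using that by (simp add: a_minus_def)
  qed
  have h_closed: "h x \<in> carrier P" if "x \<in> carrier pairs" for x
    using h.hom_closed[OF that] by simp
  \<comment> \<open>A kernel is a subgroup, so it contains all of \<open>relators\<close> once it
    contains the generators. The three cases are the three conditions in
    \<open>balanced_map\<close>.\<close>
  have "tensor_relations R M N \<subseteq> kernel pairs (add_monoid P) h"
  proof
    fix x assume x: "x \<in> tensor_relations R M N"
    have cancel: "(a \<oplus>\<^bsub>P\<^esub> b) \<ominus>\<^bsub>P\<^esub> a \<ominus>\<^bsub>P\<^esub> b = \<zero>\<^bsub>P\<^esub>" if "a \<in> carrier P" "b \<in> carrier P" for a b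
      using that by (simp add: P.minus_eq P.a_comm[of a b] P.a_assoc P.r_neg P.r_neg2)
    have "h x = \<zero>\<^bsub>P\<^esub>"
      using x unfolding tensor_relations_def
    proof (elim UnE CollectE exE conjE, goal_cases)
      case (1 m m' n)
      with \<phi> show ?case
        by (simp add: h_diff h_of keys_frag_diff balanced_map_def cancel)
    next
      case (2 m n n')
      with \<phi> show ?case
        by (simp add: h_diff h_of keys_frag_diff balanced_map_def cancel)
    next
      case (3 m r n)
      with \<phi> show ?case
        by (simp add: h_diff h_of ract_M_closed lact_N_closed balanced_map_def
            P.minus_eq P.r_neg)
    qed
    moreover have "x \<in> carrier pairs" using x tensor_relations_subset by blast
    ultimately show "x \<in> kernel pairs (add_monoid P) h" by (simp add: kernel_def)
  qed
  then have "relators \<subseteq> kernel pairs (add_monoid P) h"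
    unfolding tensor_kernel_def
    by (rule group.generate_subgroup_incl[OF group_free_Abelian_group _ h.subgroup_kernel])
  then have h_relators: "h x = \<zero>\<^bsub>P\<^esub>" "x \<in> carrier pairs" if "x \<in> relators" for x
    using that by (auto simp: kernel_def)
  have lift_coset: "tensor_lift P ?\<phi> (relators #>\<^bsub>pairs\<^esub> x) = h x" if x: "x \<in> carrier pairs" for x
  proof -
    have "h y = h x" if "y \<in> relators #>\<^bsub>pairs\<^esub> x" for y
    proof -
      obtain u where u: "u \<in> relators" "y = u \<otimes>\<^bsub>pairs\<^esub> x"
        using \<open>y \<in> relators #>\<^bsub>pairs\<^esub> x\<close> by (auto simp: r_coset_def)
      then show ?thesis using h_relators[OF u(1)] h.hom_mult[OF h_relators(2)[OF u(1)] x] h_closed[OF x] by simp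
    qed
    moreover have "x \<in> relators #>\<^bsub>pairs\<^esub> x"
      by (rule group.rcos_self[OF group_free_Abelian_group x subgroup_relators])
    \<comment> \<open>A coset is nonempty and \<open>h\<close> is constant on it, so the image is a
      singleton and \<open>the_elem\<close> is meaningful.\<close>
    ultimately have "h ` (relators #>\<^bsub>pairs\<^esub> x) = {h x}" by blast
    then show ?thesis by (simp add: tensor_lift_def h_def[abs_def])
  qed
  show "tensor_lift P ?\<phi> \<in> add_hom (tensor_group R M N) P"
  proof (rule add_homI)
    fix t assume "t \<in> carrier (tensor_group R M N)"
    then show "tensor_lift P ?\<phi> t \<in> carrier P"
      using lift_coset h_closed by (auto simp: carrier_tensor_group)
  next
    fix t u assume "t \<in> carrier (tensor_group R M N)" "u \<in> carrier (tensor_group R M N)"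
    then obtain x y where xy: "x \<in> carrier pairs" "t = relators #>\<^bsub>pairs\<^esub> x" "y \<in> carrier pairs" "u = relators #>\<^bsub>pairs\<^esub> y"
      by (auto simp: carrier_tensor_group)
    have "x + y \<in> carrier pairs" using xy by (simp add: keys_frag_add)
    then show "tensor_lift P ?\<phi> (t \<oplus>\<^bsub>tensor_group R M N\<^esub> u) = tensor_lift P ?\<phi> t \<oplus>\<^bsub>P\<^esub> tensor_lift P ?\<phi> u"
      using xy h.hom_mult[of x y] by (simp add: add_cosets lift_coset)
  qed
  show "tensor_lift P ?\<phi> (pure_tensor R M N m n) = \<phi> m n" if "m \<in> carrier M" "n \<in> carrier N"
    using that by (simp add: pure_tensor_def lift_coset h_of)
qed

end

section \<open>Tensor products of bimodules\<close>

lemma tensor_simps [simp]: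
  "carrier (tensor R M N) = carrier (tensor_group R M N)"
  "ring.add (tensor R M N) = ring.add (tensor_group R M N)"
  "ring.zero (tensor R M N) = ring.zero (tensor_group R M N)"
  by (simp_all add: tensor_def)

lemma add_hom_tensor [simp]:
  "add_hom (tensor R M N) P = add_hom (tensor_group R M N) P"
  "add_hom P (tensor R M N) = add_hom P (tensor_group R M N)"
  by (simp_all add: add_hom_def hom_def)

lemma abelian_group_cong:
  assumes "abelian_group M" and N: "carrier N = carrier M" "ring.add N = ring.add M" "ring.zero N = ring.zero M"
  shows "abelian_group N"
proof -
  interpret M: abelian_group M by fact
  have "\<exists>y\<in>carrier M. y \<oplus>\<^bsub>M\<^esub> x = \<zero>\<^bsub>M\<^esub>" if "x \<in> carrier M" for x
    using M.l_neg[OF that] M.a_inv_closed[OF that] by blast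
  then show ?thesis
    by (intro abelian_groupI) (simp_all add: N M.a_ac)
qed

lemma balanced_mapD:
  assumes "balanced_map R M N P \<phi>"
  shows balanced_map_closed: "\<lbrakk>m \<in> carrier M; n \<in> carrier N\<rbrakk> \<Longrightarrow> \<phi> m n \<in> carrier P"
    and balanced_map_add_left: "\<lbrakk>m \<in> carrier M; m' \<in> carrier M; n \<in> carrier N\<rbrakk>
      \<Longrightarrow> \<phi> (m \<oplus>\<^bsub>M\<^esub> m') n = \<phi> m n \<oplus>\<^bsub>P\<^esub> \<phi> m' n"
    and balanced_map_add_right: "\<lbrakk>m \<in> carrier M; n \<in> carrier N; n' \<in> carrier N\<rbrakk>
      \<Longrightarrow> \<phi> m (n \<oplus>\<^bsub>N\<^esub> n') = \<phi> m n \<oplus>\<^bsub>P\<^esub> \<phi> m n'"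
    and balanced_map_act: "\<lbrakk>m \<in> carrier M; r \<in> carrier R; n \<in> carrier N\<rbrakk>
      \<Longrightarrow> \<phi> (ract M m r) n = \<phi> m (lact N r n)"
  using assms unfolding balanced_map_def by blast+

context tensor_factors
begin

lemma abelian_group_tensor: "abelian_group (tensor R M N)"
  by (rule abelian_group_cong[OF abelian_group_tensor_group]) simp_all

lemmas pure_tensor_add_left = balanced_map_add_left[OF pure_tensor_balanced]
lemmas pure_tensor_add_right = balanced_map_add_right[OF pure_tensor_balanced]
lemmas pure_tensor_act = balanced_map_act[OF pure_tensor_balanced]

lemma pure_tensor_hom_left:
  "n \<in> carrier N \<Longrightarrow> (\<lambda>m. pure_tensor R M N m n) \<in> add_hom M (tensor_group R M N)"
  by (rule add_homI) (simp_all add: pure_tensor_closed pure_tensor_add_left)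

text \<open>For recognising a given map as one of the canonical isomorphisms
  \<open>tensor_lunit\<close> and \<open>tensor_runit\<close>, which are defined as lifts.\<close>

lemma tensor_lift_unique:
  assumes "abelian_group P" "f \<in> add_hom (tensor_group R M N) P"
    and "\<And>m n. \<lbrakk>m \<in> carrier M; n \<in> carrier N\<rbrakk> \<Longrightarrow> f (pure_tensor R M N m n) = \<phi> m n"
    and "balanced_map R M N P \<phi>"
    and "t \<in> carrier (tensor_group R M N)"
  shows "tensor_lift P (\<lambda>(m, n). \<phi> m n) t = f t"
  by (rule tensor_group_hom_eqI[OF assms(1) tensor_lift_hom[OF assms(1,4)] assms(2) _ assms(5)])
    (simp add: tensor_lift_pure[OF assms(1,4)] assms(3))

text \<open>The ring may change along \<open>\<rho>\<close>: the images of \<open>(m r, n)\<close>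
  and \<open>(m, r n)\<close> differ by moving \<open>\<rho> r\<close> across the tensor sign over
  \<open>R'\<close>. With \<open>\<rho>\<close> the identity this yields maps over a fixed ring;
  with \<open>\<rho>\<close> the component of a 1-cell at the middle object it yields the map that
  occurs in the definition of Morita morphisms.\<close>

lemma tensor_map:
  assumes T: "tensor_factors R' M' N'"
    and f: "f \<in> add_hom M M'" and g: "g \<in> add_hom N N'"
    and \<rho>: "\<And>r. r \<in> carrier R \<Longrightarrow> \<rho> r \<in> carrier R'"
    and f\<rho>: "\<And>m r. \<lbrakk>m \<in> carrier M; r \<in> carrier R\<rbrakk> \<Longrightarrow> f (ract M m r) = ract M' (f m) (\<rho> r)"
    and g\<rho>: "\<And>n r. \<lbrakk>r \<in> carrier R; n \<in> carrier N\<rbrakk> \<Longrightarrow> g (lact N r n) = lact N' (\<rho> r) (g n)"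
  shows tensor_map_hom: "tensor_map R' M' N' f g \<in> add_hom (tensor_group R M N) (tensor_group R' M' N')"
    and tensor_map_pure: "\<lbrakk>m \<in> carrier M; n \<in> carrier N\<rbrakk>
      \<Longrightarrow> tensor_map R' M' N' f g (pure_tensor R M N m n) = pure_tensor R' M' N' (f m) (g n)"
proof -
  interpret T: tensor_factors R' M' N' by fact
  have "balanced_map R M N (tensor_group R' M' N') (\<lambda>m n. pure_tensor R' M' N' (f m) (g n))"
    by (rule balanced_mapI)
      (simp_all add: T.pure_tensor_closed T.pure_tensor_add_left T.pure_tensor_add_right T.pure_tensor_act
        add_hom_closed[OF f] add_hom_closed[OF g] add_hom_add[OF f] add_hom_add[OF g] \<rho> f\<rho> g\<rho>)
  note lift = tensor_lift[OF T.abelian_group_tensor_group this]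
  show "tensor_map R' M' N' f g \<in> add_hom (tensor_group R M N) (tensor_group R' M' N')"
    unfolding tensor_map_def by (rule lift)
  show "\<lbrakk>m \<in> carrier M; n \<in> carrier N\<rbrakk>
      \<Longrightarrow> tensor_map R' M' N' f g (pure_tensor R M N m n) = pure_tensor R' M' N' (f m) (g n)"
    unfolding tensor_map_def by (rule lift)
qed

text \<open>Right linearity of \<open>f\<close> over \<open>R\<close> makes \<open>f\<close> times
  the identity respect the relations. The left action and the scalar action on a tensor product are
  maps of this kind.\<close>

lemma tensor_map_left:
  assumes "f \<in> add_hom M M"
    and "\<And>m r. \<lbrakk>m \<in> carrier M; r \<in> carrier R\<rbrakk> \<Longrightarrow> f (ract M m r) = ract M (f m) r"
  shows tensor_map_left_hom:
      "tensor_map R M N f (\<lambda>n. n) \<in> add_hom (tensor_group R M N) (tensor_group R M N)"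
    and tensor_map_left_pure: "\<lbrakk>m \<in> carrier M; n \<in> carrier N\<rbrakk>
      \<Longrightarrow> tensor_map R M N f (\<lambda>n. n) (pure_tensor R M N m n) = pure_tensor R M N (f m) n"
proof -
  have "(\<lambda>n. n) \<in> add_hom N N" by (rule add_homI) auto
  note * = tensor_map[OF tensor_factors_axioms assms(1) this, where \<rho> = "\<lambda>r. r"]
  show "tensor_map R M N f (\<lambda>n. n) \<in> add_hom (tensor_group R M N) (tensor_group R M N)"
    by (rule *(1)) (simp_all add: assms(2))
  show "\<lbrakk>m \<in> carrier M; n \<in> carrier N\<rbrakk>
      \<Longrightarrow> tensor_map R M N f (\<lambda>n. n) (pure_tensor R M N m n) = pure_tensor R M N (f m) n"
    by (rule *(2)) (simp_all add: assms(2))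
qed

lemma tensor_map_right:
  assumes "g \<in> add_hom N N"
    and "\<And>n r. \<lbrakk>r \<in> carrier R; n \<in> carrier N\<rbrakk> \<Longrightarrow> g (lact N r n) = lact N r (g n)"
  shows tensor_map_right_hom:
      "tensor_map R M N (\<lambda>m. m) g \<in> add_hom (tensor_group R M N) (tensor_group R M N)"
    and tensor_map_right_pure: "\<lbrakk>m \<in> carrier M; n \<in> carrier N\<rbrakk>
      \<Longrightarrow> tensor_map R M N (\<lambda>m. m) g (pure_tensor R M N m n) = pure_tensor R M N m (g n)"
proof -
  have "(\<lambda>m. m) \<in> add_hom M M" by (rule add_homI) auto
  note * = tensor_map[OF tensor_factors_axioms this assms(1), where \<rho> = "\<lambda>r. r"]
  show "tensor_map R M N (\<lambda>m. m) g \<in> add_hom (tensor_group R M N) (tensor_group R M N)"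
    by (rule *(1)) (simp_all add: assms(2))
  show "\<lbrakk>m \<in> carrier M; n \<in> carrier N\<rbrakk>
      \<Longrightarrow> tensor_map R M N (\<lambda>m. m) g (pure_tensor R M N m n) = pure_tensor R M N m (g n)"
    by (rule *(2)) (simp_all add: assms(2))
qed

end

section \<open>Outer actions and threefold tensor products\<close>

lemma is_bimodule_abelian_group: "is_bimodule k R S M \<Longrightarrow> abelian_group M"
  by (simp add: is_bimodule_def module_def)

lemma (in is_bimodule) lact_hom: "r \<in> carrier R \<Longrightarrow> lact M r \<in> add_hom M M"
  by (rule add_homI) (simp_all add: lact_closed lact_add_right)

lemma (in is_bimodule) ract_hom: "s \<in> carrier S \<Longrightarrow> (\<lambda>m. ract M m s) \<in> add_hom M M"
  by (rule add_homI) (simp_all add: ract_closed ract_add_left)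

lemma tensor_factors_bimodules:
  assumes "is_bimodule k Q R M" "is_bimodule k R S N"
  shows "tensor_factors R M N"
  by (intro tensor_factors.intro tensor_factors_axioms.intro is_bimodule_abelian_group[OF assms(1)]
      is_bimodule_abelian_group[OF assms(2)] is_bimodule.ract_closed[OF assms(1)]
      is_bimodule.lact_closed[OF assms(2)])

text \<open>The outer action commutes with the inner one by \<open>lact_ract\<close>, hence descends
  to the tensor product.\<close>

lemma tensor_lact:
  assumes "is_bimodule k Q R M" "is_bimodule k R S N" "q \<in> carrier Q"
  shows tensor_lact_hom: "lact (tensor R M N) q \<in> add_hom (tensor_group R M N) (tensor_group R M N)"
    and tensor_lact_pure: "\<lbrakk>m \<in> carrier M; n \<in> carrier N\<rbrakk>
      \<Longrightarrow> lact (tensor R M N) q (pure_tensor R M N m n) = pure_tensor R M N (lact M q m) n"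
  using tensor_factors.tensor_map_left[OF tensor_factors_bimodules[OF assms(1,2)]
      is_bimodule.lact_hom[OF assms(1,3)]] is_bimodule.lact_ract[OF assms(1,3)]
  by (simp_all add: tensor_def)

lemma tensor_ract:
  assumes "is_bimodule k Q R M" "is_bimodule k R S N" "s \<in> carrier S"
  shows tensor_ract_hom: "(\<lambda>t. ract (tensor R M N) t s) \<in> add_hom (tensor_group R M N) (tensor_group R M N)"
    and tensor_ract_pure: "\<lbrakk>m \<in> carrier M; n \<in> carrier N\<rbrakk>
      \<Longrightarrow> ract (tensor R M N) (pure_tensor R M N m n) s = pure_tensor R M N m (ract N n s)"
  using tensor_factors.tensor_map_right[OF tensor_factors_bimodules[OF assms(1,2)]
      is_bimodule.ract_hom[OF assms(2,3)]] is_bimodule.lact_ract[OF assms(2) _ _ assms(3)]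
  by (simp_all add: tensor_def)

lemma tensor_factors_tensor_left:
  assumes "is_bimodule k Q R M" "is_bimodule k R S N" "is_bimodule k S T P"
  shows "tensor_factors S (tensor R M N) P"
proof (intro tensor_factors.intro tensor_factors_axioms.intro)
  show "abelian_group (tensor R M N)"
    by (rule tensor_factors.abelian_group_tensor[OF tensor_factors_bimodules[OF assms(1,2)]])
  show "ract (tensor R M N) t s \<in> carrier (tensor R M N)"
    if "t \<in> carrier (tensor R M N)" "s \<in> carrier S" for t s
    using add_hom_closed[OF tensor_ract_hom[OF assms(1,2) that(2)]] that(1) by simp
qed (simp_all add: is_bimodule_abelian_group[OF assms(3)] is_bimodule.lact_closed[OF assms(3)])

lemma tensor_factors_tensor_right:
  assumes "is_bimodule k Q R M" "is_bimodule k R S N" "is_bimodule k S T P"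
  shows "tensor_factors R M (tensor S N P)"
proof (intro tensor_factors.intro tensor_factors_axioms.intro)
  show "abelian_group (tensor S N P)"
    by (rule tensor_factors.abelian_group_tensor[OF tensor_factors_bimodules[OF assms(2,3)]])
  show "lact (tensor S N P) r t \<in> carrier (tensor S N P)"
    if "r \<in> carrier R" "t \<in> carrier (tensor S N P)" for t r
    using add_hom_closed[OF tensor_lact_hom[OF assms(2,3) that(1)]] that(2) by simp
qed (simp_all add: is_bimodule_abelian_group[OF assms(1)] is_bimodule.ract_closed[OF assms(1)])

text \<open>Extensionality twice: on the outer tensor product and then, for fixed \<open>p\<close>,
  on the inner one, because \<open>u \<mapsto> u \<otimes> p\<close> is additive.\<close>

lemma triple_tensor_hom_eqI:
  assumes M: "is_bimodule k Q R M" and N: "is_bimodule k R S N" and P: "is_bimodule k S T P"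
    and G: "abelian_group G"
    and f: "f \<in> add_hom (tensor_group S (tensor R M N) P) G"
    and g: "g \<in> add_hom (tensor_group S (tensor R M N) P) G"
    and pure: "\<And>m n p. \<lbrakk>m \<in> carrier M; n \<in> carrier N; p \<in> carrier P\<rbrakk>
      \<Longrightarrow> f (pure_tensor S (tensor R M N) P (pure_tensor R M N m n) p)
        = g (pure_tensor S (tensor R M N) P (pure_tensor R M N m n) p)"
    and t: "t \<in> carrier (tensor_group S (tensor R M N) P)"
  shows "f t = g t"
proof -
  interpret MN: tensor_factors R M N by (rule tensor_factors_bimodules[OF M N])
  interpret MNP: tensor_factors S "tensor R M N" P by (rule tensor_factors_tensor_left[OF M N P])
  show ?thesis
  proof (rule MNP.tensor_group_hom_eqI[OF G f g _ t])
    fix u p assume u: "u \<in> carrier (tensor R M N)" and p: "p \<in> carrier P"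
    have hom: "(\<lambda>u. pure_tensor S (tensor R M N) P u p)
        \<in> add_hom (tensor_group R M N) (tensor_group S (tensor R M N) P)"
      using MNP.pure_tensor_hom_left[OF p] by simp
    show "f (pure_tensor S (tensor R M N) P u p) = g (pure_tensor S (tensor R M N) P u p)"
      by (rule MN.tensor_group_hom_eqI[OF G add_hom_comp[OF hom f] add_hom_comp[OF hom g]])
        (use u p pure in simp_all)
  qed
qed

text \<open>Two nested lifts. For fixed \<open>p\<close> the map
  \<open>(m, n) \<mapsto> m \<otimes> (n \<otimes> p)\<close> is balanced over \<open>R\<close> and
  lifts to \<open>\<psi>\<close>. Then \<open>\<psi>\<close> must be balanced over \<open>S\<close>;
  both sides of the conditions that vary \<open>p\<close> are additive in \<open>t\<close>, so those
  are checked for pure \<open>t\<close>.\<close>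

lemma tensor_assoc:
  assumes M: "is_bimodule k Q R M" and N: "is_bimodule k R S N" and P: "is_bimodule k S T P"
  shows tensor_assoc_hom: "tensor_assoc R S M N P
      \<in> add_hom (tensor_group S (tensor R M N) P) (tensor_group R M (tensor S N P))"
    and tensor_assoc_pure: "\<lbrakk>m \<in> carrier M; n \<in> carrier N; p \<in> carrier P\<rbrakk>
      \<Longrightarrow> tensor_assoc R S M N P (pure_tensor S (tensor R M N) P (pure_tensor R M N m n) p)
        = pure_tensor R M (tensor S N P) m (pure_tensor S N P n p)"
proof -
  interpret MN: tensor_factors R M N by (rule tensor_factors_bimodules[OF M N])
  interpret NP: tensor_factors S N P by (rule tensor_factors_bimodules[OF N P])
  interpret L: tensor_factors S "tensor R M N" P by (rule tensor_factors_tensor_left[OF M N P])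
  interpret R: tensor_factors R M "tensor S N P" by (rule tensor_factors_tensor_right[OF M N P])
  let ?T = "tensor_group R M (tensor S N P)"
  let ?\<phi> = "\<lambda>p m n. pure_tensor R M (tensor S N P) m (pure_tensor S N P n p)"
  define \<psi> where "\<psi> t p = tensor_lift ?T (\<lambda>(m, n). ?\<phi> p m n) t" for t p
  have AT: "abelian_group ?T" by (rule R.abelian_group_tensor_group)
  have \<phi>: "balanced_map R M N ?T (?\<phi> p)" if p: "p \<in> carrier P" for p
  proof (rule balanced_mapI)
    fix m r n assume *: "m \<in> carrier M" "r \<in> carrier R" "n \<in> carrier N"
    \<comment> \<open>First \<open>r\<close> crosses the outer tensor sign onto the tensor product
      of \<open>N\<close> and \<open>P\<close>, where it acts through \<open>N\<close>.\<close>
    have "?\<phi> p (ract M m r) n = pure_tensor R M (tensor S N P) m (lact (tensor S N P) r (pure_tensor S N P n p))"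
      using * p by (simp add: R.pure_tensor_act NP.pure_tensor_closed)
    then show "?\<phi> p (ract M m r) n = ?\<phi> p m (lact N r n)"
      using * p by (simp add: tensor_lact_pure[OF N P])
  next
    fix m n n' assume *: "m \<in> carrier M" "n \<in> carrier N" "n' \<in> carrier N"
    then show "?\<phi> p m (n \<oplus>\<^bsub>N\<^esub> n') = ?\<phi> p m n \<oplus>\<^bsub>?T\<^esub> ?\<phi> p m n'"
      using p R.pure_tensor_add_right[of m "pure_tensor S N P n p" "pure_tensor S N P n' p"]
      by (simp add: NP.pure_tensor_add_left NP.pure_tensor_closed)
  qed (use p in \<open>simp_all add: R.pure_tensor_closed R.pure_tensor_add_left NP.pure_tensor_closed\<close>)
  have \<psi>_hom: "(\<lambda>t. \<psi> t p) \<in> add_hom (tensor_group R M N) ?T" if "p \<in> carrier P" for p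
    unfolding \<psi>_def by (rule MN.tensor_lift_hom[OF AT \<phi>[OF that]])
  have \<psi>_pure: "\<psi> (pure_tensor R M N m n) p = ?\<phi> p m n"
    if "m \<in> carrier M" "n \<in> carrier N" "p \<in> carrier P" for m n p
    unfolding \<psi>_def using MN.tensor_lift_pure[OF AT \<phi>[OF that(3)] that(1,2)] .
  interpret T: abelian_group ?T by (rule AT)
  have \<psi>: "balanced_map S (tensor R M N) P ?T \<psi>"
  proof (rule balanced_mapI)
    fix t p p' assume *: "t \<in> carrier (tensor R M N)" "p \<in> carrier P" "p' \<in> carrier P"
    \<comment> \<open>The sum of two additive maps is additive because the target is commutative;
      this makes the right-hand side comparable on pure tensors.\<close>
    have h: "(\<lambda>t. \<psi> t p \<oplus>\<^bsub>?T\<^esub> \<psi> t p') \<in> add_hom (tensor_group R M N) ?T"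
      by (rule add_homI) (simp_all add: add_hom_closed[OF \<psi>_hom] add_hom_add[OF \<psi>_hom] * T.a_ac)
    have pp: "p \<oplus>\<^bsub>P\<^esub> p' \<in> carrier P" using * by simp
    show "\<psi> t (p \<oplus>\<^bsub>P\<^esub> p') = \<psi> t p \<oplus>\<^bsub>?T\<^esub> \<psi> t p'"
      by (rule MN.tensor_group_hom_eqI[OF AT \<psi>_hom[OF pp] h])
        (use * pp in \<open>simp_all add: \<psi>_pure NP.pure_tensor_add_right NP.pure_tensor_closed R.pure_tensor_add_right[simplified]\<close>)
  next
    fix t s p assume *: "t \<in> carrier (tensor R M N)" "s \<in> carrier S" "p \<in> carrier P"
    have sp: "lact P s p \<in> carrier P" using * by (simp add: L.lact_N_closed)
    show "\<psi> (ract (tensor R M N) t s) p = \<psi> t (lact P s p)"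
      by (rule MN.tensor_group_hom_eqI[OF AT add_hom_comp[OF tensor_ract_hom[OF M N *(2)] \<psi>_hom[OF *(3)]] \<psi>_hom[OF sp]])
        (use * sp in \<open>simp_all add: tensor_ract_pure[OF M N] MN.pure_tensor_closed \<psi>_pure
          NP.pure_tensor_act is_bimodule.ract_closed[OF N]\<close>)
  qed (simp_all add: add_hom_closed[OF \<psi>_hom] add_hom_add[OF \<psi>_hom])
  have eq: "tensor_assoc R S M N P = tensor_lift ?T (\<lambda>(t, p). \<psi> t p)"
    by (simp add: tensor_assoc_def \<psi>_def Let_def)
  show "tensor_assoc R S M N P \<in> add_hom (tensor_group S (tensor R M N) P) ?T"
    unfolding eq by (rule L.tensor_lift_hom[OF AT \<psi>])
  show "tensor_assoc R S M N P (pure_tensor S (tensor R M N) P (pure_tensor R M N m n) p)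
        = pure_tensor R M (tensor S N P) m (pure_tensor S N P n p)"
    if "m \<in> carrier M" "n \<in> carrier N" "p \<in> carrier P"
    unfolding eq using that
    by (simp add: L.tensor_lift_pure[OF AT \<psi>] MN.pure_tensor_closed \<psi>_pure)
qed

section \<open>The 2-category of \<open>k\<close>-linear categories\<close>

lemma linear_mapD:
  assumes "linear_map k M N f"
  shows linear_map_hom: "f \<in> add_hom M N"
    and linear_map_closed: "a \<in> carrier M \<Longrightarrow> f a \<in> carrier N"
    and linear_map_add: "\<lbrakk>a \<in> carrier M; b \<in> carrier M\<rbrakk> \<Longrightarrow> f (a \<oplus>\<^bsub>M\<^esub> b) = f a \<oplus>\<^bsub>N\<^esub> f b"
    and linear_map_smult: "\<lbrakk>c \<in> carrier k; a \<in> carrier M\<rbrakk> \<Longrightarrow> f (c \<odot>\<^bsub>M\<^esub> a) = c \<odot>\<^bsub>N\<^esub> f a"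
  using assms by (auto simp: linear_map_def intro: add_homI)

lemma symmetric_bimodule_simps [simp]:
  "carrier (symmetric_bimodule M) = carrier M"
  "ring.add (symmetric_bimodule M) = ring.add M"
  "ring.zero (symmetric_bimodule M) = ring.zero M"
  "smult (symmetric_bimodule M) = smult M"
  "lact (symmetric_bimodule M) = smult M"
  "ract (symmetric_bimodule M) = (\<lambda>m c. smult M c m)"
  by (simp_all add: symmetric_bimodule_def)

lemma add_hom_symmetric_bimodule [simp]:
  "add_hom (symmetric_bimodule M) P = add_hom M P"
  "add_hom P (symmetric_bimodule M) = add_hom P M"
  by (simp_all add: add_hom_def hom_def)

lemma tensor_factors_symmetric:
  assumes "Module.module k M" "Module.module k N"
  shows "tensor_factors k (symmetric_bimodule M) (symmetric_bimodule N)"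
  by (intro tensor_factors.intro tensor_factors_axioms.intro
      abelian_group_cong[OF module.axioms(2)[OF assms(1)]]
      abelian_group_cong[OF module.axioms(2)[OF assms(2)]])
    (simp_all add: module.smult_closed[OF assms(1)] module.smult_closed[OF assms(2)])

lemma tensor_symmetric_smult:
  assumes M: "Module.module k M" and N: "Module.module k N" and c: "c \<in> carrier k"
  shows tensor_symmetric_smult_hom:
    "smult (tensor k (symmetric_bimodule M) (symmetric_bimodule N)) c
      \<in> add_hom (tensor_group k (symmetric_bimodule M) (symmetric_bimodule N))
          (tensor_group k (symmetric_bimodule M) (symmetric_bimodule N))"
    and tensor_symmetric_smult_pure: "\<lbrakk>m \<in> carrier M; n \<in> carrier N\<rbrakk> \<Longrightarrow>
      smult (tensor k (symmetric_bimodule M) (symmetric_bimodule N)) c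
          (pure_tensor k (symmetric_bimodule M) (symmetric_bimodule N) m n)
        = pure_tensor k (symmetric_bimodule M) (symmetric_bimodule N) (c \<odot>\<^bsub>M\<^esub> m) n"
proof -
  interpret M: Module.module k M by fact
  have "smult M c \<in> add_hom M M"
    by (rule add_homI) (simp_all add: c M.smult_r_distr)
  \<comment> \<open>Commutativity of \<open>k\<close> makes multiplication by \<open>c\<close>
    linear over \<open>k\<close>, so it can act on the left factor alone and still be well
    defined.\<close>
  moreover have "c \<odot>\<^bsub>M\<^esub> (r \<odot>\<^bsub>M\<^esub> m) = r \<odot>\<^bsub>M\<^esub> (c \<odot>\<^bsub>M\<^esub> m)" if "r \<in> carrier k" "m \<in> carrier M" for r m
    using that c by (metis M.smult_assoc1 M.R.m_comm)
  ultimately show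
    "smult (tensor k (symmetric_bimodule M) (symmetric_bimodule N)) c
      \<in> add_hom (tensor_group k (symmetric_bimodule M) (symmetric_bimodule N))
          (tensor_group k (symmetric_bimodule M) (symmetric_bimodule N))"
    "\<lbrakk>m \<in> carrier M; n \<in> carrier N\<rbrakk> \<Longrightarrow>
      smult (tensor k (symmetric_bimodule M) (symmetric_bimodule N)) c
          (pure_tensor k (symmetric_bimodule M) (symmetric_bimodule N) m n)
        = pure_tensor k (symmetric_bimodule M) (symmetric_bimodule N) (c \<odot>\<^bsub>M\<^esub> m) n"
    using tensor_factors.tensor_map_left[OF tensor_factors_symmetric[OF M N], of "smult M c"]
    by (simp_all add: tensor_def)
qed

section \<open>Composition in a \<open>k\<close>-linear category as a product of elements\<close>

locale lincat =
  fixes k :: "('k, 'e) ring_scheme" and A :: "('o, 'a, 'k) lincat"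
  assumes lincat: "A \<in> lincats k"
begin

lemma lhom_module: "\<lbrakk>x \<in> lobj A; y \<in> lobj A\<rbrakk> \<Longrightarrow> Module.module k (lhom A x y)"
  using lincat by (auto simp: lincats_def khom_modules_def)

lemma lhom_tensor_factors: "\<lbrakk>x \<in> lobj A; y \<in> lobj A; z \<in> lobj A\<rbrakk> \<Longrightarrow>
    tensor_factors k (symmetric_bimodule (lhom A x y)) (symmetric_bimodule (lhom A y z))"
  by (simp add: tensor_factors_symmetric lhom_module)

lemma lmult_linear: "\<lbrakk>x \<in> lobj A; y \<in> lobj A; z \<in> lobj A\<rbrakk> \<Longrightarrow>
    linear_map k (ltensor k A x y z) (lhom A x z) (lmult A x y z)"
  using lincat by (simp add: lincats_def)

lemma lmult_hom: "\<lbrakk>x \<in> lobj A; y \<in> lobj A; z \<in> lobj A\<rbrakk> \<Longrightarrow> lmult A x y z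
    \<in> add_hom (tensor_group k (symmetric_bimodule (lhom A x y)) (symmetric_bimodule (lhom A y z)))
        (lhom A x z)"
  using linear_map_hom[OF lmult_linear] by (simp add: ltensor_def)

lemma lprod_balanced:
  assumes "x \<in> lobj A" "y \<in> lobj A" "z \<in> lobj A"
  shows "balanced_map k (symmetric_bimodule (lhom A x y)) (symmetric_bimodule (lhom A y z))
    (lhom A x z) (lprod k A x y z)"
proof -
  interpret T: tensor_factors k "symmetric_bimodule (lhom A x y)" "symmetric_bimodule (lhom A y z)"
    by (rule lhom_tensor_factors[OF assms])
  note mult_hom = lmult_hom[OF assms]
  show ?thesis
    by (rule balanced_mapI)
      (simp_all add: lprod_def add_hom_closed[OF mult_hom] T.pure_tensor_closed
        T.pure_tensor_add_left[simplified] T.pure_tensor_add_right[simplified]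
        T.pure_tensor_act[simplified] add_hom_add[OF mult_hom])
qed

lemma lprod_closed: "\<lbrakk>x \<in> lobj A; y \<in> lobj A; z \<in> lobj A; a \<in> carrier (lhom A x y); b \<in> carrier (lhom A y z)\<rbrakk>
    \<Longrightarrow> lprod k A x y z a b \<in> carrier (lhom A x z)"
  using balanced_map_closed[OF lprod_balanced] by simp

lemma lprod_add_left: "\<lbrakk>x \<in> lobj A; y \<in> lobj A; z \<in> lobj A;
      a \<in> carrier (lhom A x y); a' \<in> carrier (lhom A x y); b \<in> carrier (lhom A y z)\<rbrakk>
    \<Longrightarrow> lprod k A x y z (a \<oplus>\<^bsub>lhom A x y\<^esub> a') b = lprod k A x y z a b \<oplus>\<^bsub>lhom A x z\<^esub> lprod k A x y z a' b"
  using balanced_map_add_left[OF lprod_balanced] by simp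

lemma lprod_add_right: "\<lbrakk>x \<in> lobj A; y \<in> lobj A; z \<in> lobj A;
      a \<in> carrier (lhom A x y); b \<in> carrier (lhom A y z); b' \<in> carrier (lhom A y z)\<rbrakk>
    \<Longrightarrow> lprod k A x y z a (b \<oplus>\<^bsub>lhom A y z\<^esub> b') = lprod k A x y z a b \<oplus>\<^bsub>lhom A x z\<^esub> lprod k A x y z a b'"
  using balanced_map_add_right[OF lprod_balanced] by simp

text \<open>Scalars act on the tensor product through its left factor, so linearity of
  \<open>lmult\<close> gives exactly this side. The other side follows by moving the scalar across
  the tensor sign.\<close>

lemma lprod_smult_left:
  assumes "x \<in> lobj A" "y \<in> lobj A" "z \<in> lobj A" "c \<in> carrier k"
    "a \<in> carrier (lhom A x y)" "b \<in> carrier (lhom A y z)"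
  shows "lprod k A x y z (c \<odot>\<^bsub>lhom A x y\<^esub> a) b = c \<odot>\<^bsub>lhom A x z\<^esub> lprod k A x y z a b"
proof -
  interpret T: tensor_factors k "symmetric_bimodule (lhom A x y)" "symmetric_bimodule (lhom A y z)"
    by (rule lhom_tensor_factors[OF assms(1-3)])
  show ?thesis
    using linear_map_smult[OF lmult_linear[OF assms(1-3)] assms(4),
        of "pure_tensor k (symmetric_bimodule (lhom A x y)) (symmetric_bimodule (lhom A y z)) a b"]
      assms T.pure_tensor_closed[of a b]
      tensor_symmetric_smult_pure[OF lhom_module[OF assms(1,2)] lhom_module[OF assms(2,3)] assms(4-6)]
    by (simp add: lprod_def ltensor_def)
qed

lemma lprod_smult_right:
  assumes "x \<in> lobj A" "y \<in> lobj A" "z \<in> lobj A" "c \<in> carrier k"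
    "a \<in> carrier (lhom A x y)" "b \<in> carrier (lhom A y z)"
  shows "lprod k A x y z a (c \<odot>\<^bsub>lhom A y z\<^esub> b) = c \<odot>\<^bsub>lhom A x z\<^esub> lprod k A x y z a b"
  using balanced_map_act[OF lprod_balanced[OF assms(1-3)], of a c b] lprod_smult_left[OF assms] assms
  by simp

lemma lprod_assoc: "\<lbrakk>x \<in> lobj A; y \<in> lobj A; z \<in> lobj A; u \<in> lobj A;
      a \<in> carrier (lhom A x y); b \<in> carrier (lhom A y z); c \<in> carrier (lhom A z u)\<rbrakk>
    \<Longrightarrow> lprod k A x z u (lprod k A x y z a b) c = lprod k A x y u a (lprod k A y z u b c)"
  using lincat by (simp add: lincats_def)

lemma lunit_closed: "x \<in> lobj A \<Longrightarrow> lunit A x \<in> carrier (lhom A x x)"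
  using lincat by (auto simp: lincats_def)

lemma lprod_unit_left: "\<lbrakk>x \<in> lobj A; y \<in> lobj A; a \<in> carrier (lhom A x y)\<rbrakk>
    \<Longrightarrow> lprod k A x x y (lunit A x) a = a"
  using lincat by (simp add: lincats_def)

lemma lprod_unit_right: "\<lbrakk>x \<in> lobj A; y \<in> lobj A; a \<in> carrier (lhom A x y)\<rbrakk>
    \<Longrightarrow> lprod k A x y y a (lunit A y) = a"
  using lincat by (simp add: lincats_def)

end

section \<open>Equality, identities and composition of 1-cells\<close>

lemma onecell_eqI:
  assumes "f \<in> onecell_data X H Y K" "g \<in> onecell_data X H Y' K'"
    and "\<And>x. x \<in> X \<Longrightarrow> omap f x = omap g x"
    and "\<And>x y a. \<lbrakk>x \<in> X; y \<in> X; a \<in> H x y\<rbrakk> \<Longrightarrow> hmap f x y a = hmap g x y a"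
  shows "f = g"
proof -
  have "omap f = omap g"
    by (rule extensionalityI[where A = X]) (use assms(1-3) in \<open>auto simp: onecell_data_def PiE_def\<close>)
  \<comment> \<open>Since \<open>hmap\<close> is a curried extensional function, extensionality is
    applied once for each of its three arguments.\<close>
  moreover have "hmap f = hmap g"
  proof (rule extensionalityI[where A = X])
    show "hmap f \<in> extensional X" "hmap g \<in> extensional X"
      using assms(1,2) by (auto simp: onecell_data_def PiE_def)
    fix x assume x: "x \<in> X"
    show "hmap f x = hmap g x"
    proof (rule extensionalityI[where A = X])
      show "hmap f x \<in> extensional X" "hmap g x \<in> extensional X"
        using assms(1,2) x by (auto simp: onecell_data_def PiE_def Pi_def)
      fix y assume y: "y \<in> X"
      show "hmap f x y = hmap g x y"
      proof (rule extensionalityI[where A = "H x y"])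
        show "hmap f x y \<in> extensional (H x y)" "hmap g x y \<in> extensional (H x y)"
          using assms(1,2) x y by (auto simp: onecell_data_def PiE_def Pi_def)
      qed (rule assms(4)[OF x y])
    qed
  qed
  ultimately show ?thesis by simp
qed

lemma onecell_id_apply [simp]:
  "x \<in> X \<Longrightarrow> omap (onecell_id X H) x = x"
  "\<lbrakk>x \<in> X; y \<in> X; a \<in> H x y\<rbrakk> \<Longrightarrow> hmap (onecell_id X H) x y a = a"
  by (simp_all add: onecell_id_def)

lemma onecell_comp_apply [simp]:
  "x \<in> X \<Longrightarrow> omap (onecell_comp X H g f) x = omap g (omap f x)"
  "\<lbrakk>x \<in> X; y \<in> X; a \<in> H x y\<rbrakk>
    \<Longrightarrow> hmap (onecell_comp X H g f) x y a = hmap g (omap f x) (omap f y) (hmap f x y a)"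
  by (simp_all add: onecell_comp_def)

lemma onecell_dataD:
  assumes "f \<in> onecell_data X H Y K"
  shows onecell_omap_closed: "x \<in> X \<Longrightarrow> omap f x \<in> Y"
    and onecell_hmap_closed: "\<lbrakk>x \<in> X; y \<in> X; a \<in> H x y\<rbrakk> \<Longrightarrow> hmap f x y a \<in> K (omap f x) (omap f y)"
  using assms unfolding onecell_data_def by (blast dest: PiE_mem)+

lemma onecell_id_data: "onecell_id X H \<in> onecell_data X H X H"
  by (auto simp: onecell_data_def onecell_id_def)

lemma onecell_comp_data:
  assumes "f \<in> onecell_data X H Y K" "g \<in> onecell_data Y K Z L"
  shows "onecell_comp X H g f \<in> onecell_data X H Z L"
  unfolding onecell_data_def
  by (auto simp: onecell_comp_def onecell_dataD[OF assms(1)] onecell_dataD[OF assms(2)])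

lemma lin_functorD:
  assumes "f \<in> lin_functors k A B"
  shows lin_functor_data: "f \<in> onecell_data (lobj A) (\<lambda>x y. carrier (lhom A x y))
      (lobj B) (\<lambda>x y. carrier (lhom B x y))"
    and lin_functor_omap: "x \<in> lobj A \<Longrightarrow> omap f x \<in> lobj B"
    and lin_functor_hmap: "\<lbrakk>x \<in> lobj A; y \<in> lobj A; a \<in> carrier (lhom A x y)\<rbrakk>
      \<Longrightarrow> hmap f x y a \<in> carrier (lhom B (omap f x) (omap f y))"
    and lin_functor_linear: "\<lbrakk>x \<in> lobj A; y \<in> lobj A\<rbrakk>
      \<Longrightarrow> linear_map k (lhom A x y) (lhom B (omap f x) (omap f y)) (hmap f x y)"
    and lin_functor_lprod: "\<lbrakk>x \<in> lobj A; y \<in> lobj A; z \<in> lobj A;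
        a \<in> carrier (lhom A x y); b \<in> carrier (lhom A y z)\<rbrakk>
      \<Longrightarrow> hmap f x z (lprod k A x y z a b)
        = lprod k B (omap f x) (omap f y) (omap f z) (hmap f x y a) (hmap f y z b)"
    and lin_functor_lunit: "x \<in> lobj A \<Longrightarrow> hmap f x x (lunit A x) = lunit B (omap f x)"
proof -
  show data: "f \<in> onecell_data (lobj A) (\<lambda>x y. carrier (lhom A x y)) (lobj B) (\<lambda>x y. carrier (lhom B x y))"
    using assms by (simp add: lin_functors_def)
  show "x \<in> lobj A \<Longrightarrow> omap f x \<in> lobj B"
    "\<lbrakk>x \<in> lobj A; y \<in> lobj A; a \<in> carrier (lhom A x y)\<rbrakk>
      \<Longrightarrow> hmap f x y a \<in> carrier (lhom B (omap f x) (omap f y))"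
    by (rule onecell_dataD[OF data]; assumption)+
qed (use assms in \<open>simp_all add: lin_functors_def\<close>)

section \<open>2-cells, their compositions and the 2-category axioms\<close>

lemma lin_transformationD:
  assumes "\<alpha> \<in> lin_transformations k A B f g"
  shows lin_transformation_closed: "x \<in> lobj A \<Longrightarrow> \<alpha> x \<in> carrier (lhom B (omap g x) (omap f x))"
    and lin_transformation_ext: "\<alpha> \<in> extensional (lobj A)"
    and lin_transformation_natural: "\<lbrakk>x \<in> lobj A; y \<in> lobj A; a \<in> carrier (lhom A x y)\<rbrakk>
      \<Longrightarrow> lprod k B (omap g x) (omap g y) (omap f y) (hmap g x y a) (\<alpha> y)
        = lprod k B (omap g x) (omap f x) (omap f y) (\<alpha> x) (hmap f x y a)"
  using assms by (auto simp: lin_transformations_def PiE_def)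

lemma lin_transformationI:
  assumes "\<alpha> \<in> extensional (lobj A)"
    and "\<And>x. x \<in> lobj A \<Longrightarrow> \<alpha> x \<in> carrier (lhom B (omap g x) (omap f x))"
    and "\<And>x y a. \<lbrakk>x \<in> lobj A; y \<in> lobj A; a \<in> carrier (lhom A x y)\<rbrakk>
      \<Longrightarrow> lprod k B (omap g x) (omap g y) (omap f y) (hmap g x y a) (\<alpha> y)
        = lprod k B (omap g x) (omap f x) (omap f y) (\<alpha> x) (hmap f x y a)"
  shows "\<alpha> \<in> lin_transformations k A B f g"
  using assms by (auto simp: lin_transformations_def PiE_def)

lemma kCat_simps [simp]:
  "cells0 (kCat k) = lincats k"
  "cells1 (kCat k) = lin_functors k"
  "cells2 (kCat k) = lin_transformations k"
  "id1 (kCat k) A = onecell_id (lobj A) (\<lambda>x y. carrier (lhom A x y))"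
  "comp1 (kCat k) A B D g f = onecell_comp (lobj A) (\<lambda>x y. carrier (lhom A x y)) g f"
  "id2 (kCat k) A B f = (\<lambda>x\<in>lobj A. lunit B (omap f x))"
  "vcomp (kCat k) A B f g h \<beta> \<alpha> =
    (\<lambda>x\<in>lobj A. lprod k B (omap h x) (omap g x) (omap f x) (\<beta> x) (\<alpha> x))"
  "hcomp (kCat k) A B D f f' g g' \<alpha> \<beta> =
    (\<lambda>x\<in>lobj A. lprod k D (omap g' (omap f' x)) (omap g' (omap f x)) (omap g (omap f x))
       (hmap g' (omap f' x) (omap f x) (\<alpha> x)) (\<beta> (omap f x)))"
  by (simp_all add: kCat_def)

lemma onecell_id_lin_functor: "onecell_id (lobj A) (\<lambda>x y. carrier (lhom A x y)) \<in> lin_functors k A A"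
  if "A \<in> lincats k"
proof -
  interpret lincat k A by unfold_locales fact
  show ?thesis
    by (auto simp: lin_functors_def onecell_id_data linear_map_def lprod_closed lunit_closed
        abelian_monoid.a_closed[OF abelian_group.axioms(1)[OF module.axioms(2)[OF lhom_module]]]
        module.smult_closed[OF lhom_module])
qed

lemma onecell_comp_lin_functor:
  assumes "A \<in> lincats k" and f: "f \<in> lin_functors k A B" and g: "g \<in> lin_functors k B D"
  shows "onecell_comp (lobj A) (\<lambda>x y. carrier (lhom A x y)) g f \<in> lin_functors k A D"
proof -
  interpret lincat k A by unfold_locales fact
  note f' = lin_functorD(2-)[OF f] and g' = lin_functorD(2-)[OF g]
  show ?thesis
    by (auto simp: lin_functors_def onecell_comp_data[OF lin_functor_data[OF f] lin_functor_data[OF g]]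
        linear_map_def f' g' lprod_closed lunit_closed
        abelian_monoid.a_closed[OF abelian_group.axioms(1)[OF module.axioms(2)[OF lhom_module]]]
        module.smult_closed[OF lhom_module] linear_map_add[OF lin_functor_linear[OF f]]
        linear_map_add[OF lin_functor_linear[OF g]] linear_map_smult[OF lin_functor_linear[OF f]]
        linear_map_smult[OF lin_functor_linear[OF g]])
qed

text \<open>Two naturality squares are pasted: the image of \<open>a\<close> moves first past
  \<open>\<beta>\<close> and then past \<open>\<alpha>\<close>, with associativity shifting the
  brackets in between.\<close>

lemma lin_vcomp_closed:
  assumes B: "B \<in> lincats k"
    and f: "f \<in> lin_functors k A B" and g: "g \<in> lin_functors k A B" and h: "h \<in> lin_functors k A B"
    and \<alpha>: "\<alpha> \<in> lin_transformations k A B f g" and \<beta>: "\<beta> \<in> lin_transformations k A B g h"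
  shows "vcomp (kCat k) A B f g h \<beta> \<alpha> \<in> lin_transformations k A B f h"
proof -
  interpret B: lincat k B by unfold_locales fact
  note f' = lin_functorD(2,3)[OF f] and g' = lin_functorD(2,3)[OF g] and h' = lin_functorD(2,3)[OF h]
  note \<alpha>' = lin_transformation_closed[OF \<alpha>] and \<beta>' = lin_transformation_closed[OF \<beta>]
  show ?thesis
  proof (rule lin_transformationI)
    fix x y a assume *: "x \<in> lobj A" "y \<in> lobj A" "a \<in> carrier (lhom A x y)"
    let ?p = "\<lambda>u v w. lprod k B u v w"
    have "?p (omap h x) (omap h y) (omap f y) (hmap h x y a) (?p (omap h y) (omap g y) (omap f y) (\<beta> y) (\<alpha> y))
        = ?p (omap h x) (omap g y) (omap f y) (?p (omap h x) (omap h y) (omap g y) (hmap h x y a) (\<beta> y)) (\<alpha> y)"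
      using * by (simp add: B.lprod_assoc f' g' h' \<alpha>' \<beta>')
    also have "\<dots> = ?p (omap h x) (omap g x) (omap f y) (\<beta> x) (?p (omap g x) (omap g y) (omap f y) (hmap g x y a) (\<alpha> y))"
      using * by (simp add: B.lprod_assoc f' g' h' \<alpha>' \<beta>' lin_transformation_natural[OF \<beta>])
    also have "\<dots> = ?p (omap h x) (omap f x) (omap f y) (?p (omap h x) (omap g x) (omap f x) (\<beta> x) (\<alpha> x)) (hmap f x y a)"
      using * by (simp add: B.lprod_assoc f' g' h' \<alpha>' \<beta>' lin_transformation_natural[OF \<alpha>])
    finally show "?p (omap h x) (omap h y) (omap f y) (hmap h x y a) (vcomp (kCat k) A B f g h \<beta> \<alpha> y)
        = ?p (omap h x) (omap f x) (omap f y) (vcomp (kCat k) A B f g h \<beta> \<alpha> x) (hmap f x y a)"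
      using * by simp
  qed (simp_all add: B.lprod_closed f' g' h' \<alpha>' \<beta>')
qed

text \<open>Functoriality of \<open>g'\<close> carries the naturality square of
  \<open>\<alpha>\<close> at \<open>a\<close> from \<open>B\<close> to \<open>D\<close>; there it is
  pasted with the square of \<open>\<beta>\<close> at the element
  \<open>hmap f x y a\<close>.\<close>

lemma lin_hcomp_closed:
  assumes D: "D \<in> lincats k"
    and f: "f \<in> lin_functors k A B" and f': "f' \<in> lin_functors k A B"
    and g: "g \<in> lin_functors k B D" and g': "g' \<in> lin_functors k B D"
    and \<alpha>: "\<alpha> \<in> lin_transformations k A B f f'" and \<beta>: "\<beta> \<in> lin_transformations k B D g g'"
  shows "hcomp (kCat k) A B D f f' g g' \<alpha> \<beta>
    \<in> lin_transformations k A D (comp1 (kCat k) A B D g f) (comp1 (kCat k) A B D g' f')"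
proof -
  interpret D: lincat k D by unfold_locales fact
  note fs = lin_functorD(2,3)[OF f] lin_functorD(2,3)[OF f']
    lin_functorD(2,3)[OF g] lin_functorD(2,3)[OF g']
    lin_transformation_closed[OF \<alpha>] lin_transformation_closed[OF \<beta>]
  show ?thesis
  proof (rule lin_transformationI)
    fix x y a assume *: "x \<in> lobj A" "y \<in> lobj A" "a \<in> carrier (lhom A x y)"
    let ?p = "lprod k D" and ?G = "omap g" and ?G' = "omap g'" and ?F = "omap f" and ?F' = "omap f'"
    have "?p (?G' (?F' x)) (?G' (?F' y)) (?G (?F y)) (hmap g' (?F' x) (?F' y) (hmap f' x y a))
          (?p (?G' (?F' y)) (?G' (?F y)) (?G (?F y)) (hmap g' (?F' y) (?F y) (\<alpha> y)) (\<beta> (?F y)))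
        = ?p (?G' (?F' x)) (?G' (?F y)) (?G (?F y))
          (hmap g' (?F' x) (?F y) (lprod k B (?F' x) (?F' y) (?F y) (hmap f' x y a) (\<alpha> y))) (\<beta> (?F y))"
      using * by (simp add: D.lprod_assoc fs lin_functor_lprod[OF g'])
    also have "\<dots> = ?p (?G' (?F' x)) (?G' (?F x)) (?G (?F y)) (hmap g' (?F' x) (?F x) (\<alpha> x))
          (?p (?G' (?F x)) (?G' (?F y)) (?G (?F y)) (hmap g' (?F x) (?F y) (hmap f x y a)) (\<beta> (?F y)))"
      using * by (simp add: D.lprod_assoc fs lin_functor_lprod[OF g'] lin_transformation_natural[OF \<alpha>])
    also have "\<dots> = ?p (?G' (?F' x)) (?G (?F x)) (?G (?F y))
          (?p (?G' (?F' x)) (?G' (?F x)) (?G (?F x)) (hmap g' (?F' x) (?F x) (\<alpha> x)) (\<beta> (?F x)))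
          (hmap g (?F x) (?F y) (hmap f x y a))"
      using * by (simp add: D.lprod_assoc fs lin_transformation_natural[OF \<beta>, of "?F x" "?F y" "hmap f x y a"])
    finally show "?p (omap (comp1 (kCat k) A B D g' f') x) (omap (comp1 (kCat k) A B D g' f') y)
          (omap (comp1 (kCat k) A B D g f) y) (hmap (comp1 (kCat k) A B D g' f') x y a)
          (hcomp (kCat k) A B D f f' g g' \<alpha> \<beta> y)
        = ?p (omap (comp1 (kCat k) A B D g' f') x) (omap (comp1 (kCat k) A B D g f) x)
          (omap (comp1 (kCat k) A B D g f) y) (hcomp (kCat k) A B D f f' g g' \<alpha> \<beta> x)
          (hmap (comp1 (kCat k) A B D g f) x y a)"
      using * by simp
  qed (simp_all add: D.lprod_closed fs)
qed

text \<open>Associativity and units of the product and functoriality of the 1-cells settle the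
  equations between 2-cells; interchange in addition needs the naturality of
  \<open>\<beta>'\<close>.\<close>

lemma two_category_kCat:
  "two_category (kCat k :: (('o, 'a, 'k) lincat, ('o, 'a) onecell, 'o \<Rightarrow> 'a) two_cat)"
  (is "two_category ?C")
proof
  fix A B D E assume cats: "A \<in> cells0 ?C" "B \<in> cells0 ?C" "D \<in> cells0 ?C" "E \<in> cells0 ?C"
  fix f g h assume funs: "f \<in> cells1 ?C A B" "g \<in> cells1 ?C B D" "h \<in> cells1 ?C D E"
  note data = funs[simplified, THEN lin_functor_data]
  note fs = funs[simplified, THEN lin_functor_omap] funs[simplified, THEN lin_functor_hmap]
  show "comp1 ?C A B E (comp1 ?C B D E h g) f = comp1 ?C A D E h (comp1 ?C A B D g f)"
    unfolding kCat_simps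
    by (rule onecell_eqI[OF onecell_comp_data[OF data(1) onecell_comp_data[OF data(2,3)]]
          onecell_comp_data[OF onecell_comp_data[OF data(1,2)] data(3)]])
      (simp_all add: fs)
next
  fix A B f assume *: "A \<in> cells0 ?C" "B \<in> cells0 ?C" "f \<in> cells1 ?C A B"
  note f = *(3)[simplified]
  note data = lin_functor_data[OF f] and fs = lin_functorD(2,3)[OF f]
  interpret A: lincat k A using * by unfold_locales simp
  interpret B: lincat k B using * by unfold_locales simp
  show "comp1 ?C A B B (id1 ?C B) f = f"
    unfolding kCat_simps
    by (rule onecell_eqI[OF onecell_comp_data[OF data onecell_id_data] data]) (simp_all add: fs)
  show "comp1 ?C A A B f (id1 ?C A) = f"
    unfolding kCat_simps
    by (rule onecell_eqI[OF onecell_comp_data[OF onecell_id_data data] data]) (simp_all add: fs)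
  show "id2 ?C A B f \<in> cells2 ?C A B f f"
    unfolding kCat_simps
    by (rule lin_transformationI)
      (simp_all add: B.lunit_closed B.lprod_unit_left B.lprod_unit_right fs)
next
  fix A B f g \<alpha>
  assume *: "A \<in> cells0 ?C" "B \<in> cells0 ?C" "f \<in> cells1 ?C A B"
    "g \<in> cells1 ?C A B" "\<alpha> \<in> cells2 ?C A B f g"
  note f = *(3)[simplified] and g = *(4)[simplified] and \<alpha> = *(5)[simplified]
  note fs = lin_functorD(2,3)[OF f] lin_functorD(2,3)[OF g] lin_transformation_closed[OF \<alpha>]
  interpret A: lincat k A using * by unfold_locales simp
  interpret B: lincat k B using * by unfold_locales simp
  note ext = extensionalityI[OF restrict_extensional lin_transformation_ext[OF \<alpha>]]
  show "vcomp ?C A B f g g (id2 ?C A B g) \<alpha> = \<alpha>"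
    unfolding kCat_simps by (rule ext) (simp add: B.lprod_unit_left fs)
  show "vcomp ?C A B f f g \<alpha> (id2 ?C A B f) = \<alpha>"
    unfolding kCat_simps by (rule ext) (simp add: B.lprod_unit_right fs)
  show "hcomp ?C A A B (id1 ?C A) (id1 ?C A) f g (id2 ?C A A (id1 ?C A)) \<alpha> = \<alpha>"
    unfolding kCat_simps
    by (rule ext) (simp add: B.lprod_unit_left fs A.lunit_closed lin_functor_lunit[OF g])
  show "hcomp ?C A B B f g (id1 ?C B) (id1 ?C B) \<alpha> (id2 ?C B B (id1 ?C B)) = \<alpha>"
    unfolding kCat_simps by (rule ext) (simp add: B.lprod_unit_right fs)
next
  fix A B e f g h \<alpha> \<beta> \<gamma>
  assume *: "A \<in> cells0 ?C" "B \<in> cells0 ?C" "e \<in> cells1 ?C A B"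
    "f \<in> cells1 ?C A B" "g \<in> cells1 ?C A B" "h \<in> cells1 ?C A B"
    and \<alpha>: "\<alpha> \<in> cells2 ?C A B e f" and \<beta>: "\<beta> \<in> cells2 ?C A B f g"
    and \<gamma>: "\<gamma> \<in> cells2 ?C A B g h"
  note fs = *(3-6)[simplified, THEN lin_functor_omap] lin_transformation_closed[OF \<alpha>[simplified]]
    lin_transformation_closed[OF \<beta>[simplified]] lin_transformation_closed[OF \<gamma>[simplified]]
  interpret B: lincat k B using * by unfold_locales simp
  show "vcomp ?C A B e f h (vcomp ?C A B f g h \<gamma> \<beta>) \<alpha>
      = vcomp ?C A B e g h \<gamma> (vcomp ?C A B e f g \<beta> \<alpha>)"
    unfolding kCat_simps by (rule restrict_ext) (simp add: B.lprod_assoc fs)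
next
  fix A B D E f f' g g' h h' \<alpha> \<beta> \<gamma>
  assume *: "A \<in> cells0 ?C" "B \<in> cells0 ?C" "D \<in> cells0 ?C" "E \<in> cells0 ?C"
    "f \<in> cells1 ?C A B" "f' \<in> cells1 ?C A B" "g \<in> cells1 ?C B D"
    "g' \<in> cells1 ?C B D" "h \<in> cells1 ?C D E" "h' \<in> cells1 ?C D E"
    and \<alpha>: "\<alpha> \<in> cells2 ?C A B f f'" and \<beta>: "\<beta> \<in> cells2 ?C B D g g'"
    and \<gamma>: "\<gamma> \<in> cells2 ?C D E h h'"
  note fs = *(5-10)[simplified, THEN lin_functor_omap] *(5-10)[simplified, THEN lin_functor_hmap]
    *(5-10)[simplified, THEN lin_functor_lprod] lin_transformation_closed[OF \<alpha>[simplified]]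
    lin_transformation_closed[OF \<beta>[simplified]] lin_transformation_closed[OF \<gamma>[simplified]]
  interpret D: lincat k D using * by unfold_locales simp
  interpret E: lincat k E using * by unfold_locales simp
  show "hcomp ?C A D E (comp1 ?C A B D g f) (comp1 ?C A B D g' f') h h'
        (hcomp ?C A B D f f' g g' \<alpha> \<beta>) \<gamma>
      = hcomp ?C A B E f f' (comp1 ?C B D E h g) (comp1 ?C B D E h' g')
        \<alpha> (hcomp ?C B D E g g' h h' \<beta> \<gamma>)"
    unfolding kCat_simps by (rule restrict_ext) (simp add: E.lprod_assoc fs)
next
  fix A B D f g
  assume *: "A \<in> cells0 ?C" "B \<in> cells0 ?C" "D \<in> cells0 ?C"
    "f \<in> cells1 ?C A B" "g \<in> cells1 ?C B D"
  note fs = *(4,5)[simplified, THEN lin_functor_omap] *(4,5)[simplified, THEN lin_functor_lunit]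
  interpret D: lincat k D using * by unfold_locales simp
  show "hcomp ?C A B D f f g g (id2 ?C A B f) (id2 ?C B D g)
      = id2 ?C A D (comp1 ?C A B D g f)"
    unfolding kCat_simps by (rule restrict_ext) (simp add: fs D.lprod_unit_left D.lunit_closed)
next
  fix A B D f f' f'' g g' g'' \<alpha> \<alpha>' \<beta> \<beta>'
  assume *: "A \<in> cells0 ?C" "B \<in> cells0 ?C" "D \<in> cells0 ?C"
    "f \<in> cells1 ?C A B" "f' \<in> cells1 ?C A B" "f'' \<in> cells1 ?C A B"
    "g \<in> cells1 ?C B D" "g' \<in> cells1 ?C B D" "g'' \<in> cells1 ?C B D"
    and \<alpha>: "\<alpha> \<in> cells2 ?C A B f f'" and \<alpha>': "\<alpha>' \<in> cells2 ?C A B f' f''"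
    and \<beta>: "\<beta> \<in> cells2 ?C B D g g'" and \<beta>': "\<beta>' \<in> cells2 ?C B D g' g''"
  note fs = *(4-9)[simplified, THEN lin_functor_omap] *(4-9)[simplified, THEN lin_functor_hmap]
    *(4-9)[simplified, THEN lin_functor_lprod] lin_transformation_closed[OF \<alpha>[simplified]]
    lin_transformation_closed[OF \<alpha>'[simplified]]
    lin_transformation_closed[OF \<beta>[simplified]] lin_transformation_closed[OF \<beta>'[simplified]]
  interpret D: lincat k D using * by unfold_locales simp
  let ?p = "lprod k D" and ?F = "omap f" and ?F' = "omap f'" and ?F'' = "omap f''"
    and ?G = "omap g" and ?G' = "omap g'" and ?G'' = "omap g''"
  \<comment> \<open>Interchange at \<open>x\<close>, with the image under \<open>g''\<close> of the
    vertical composite already split by functoriality.\<close>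
  have "?p (?G'' (?F'' x)) (?G'' (?F x)) (?G (?F x))
        (?p (?G'' (?F'' x)) (?G'' (?F' x)) (?G'' (?F x)) (hmap g'' (?F'' x) (?F' x) (\<alpha>' x)) (hmap g'' (?F' x) (?F x) (\<alpha> x)))
        (?p (?G'' (?F x)) (?G' (?F x)) (?G (?F x)) (\<beta>' (?F x)) (\<beta> (?F x)))
      = ?p (?G'' (?F'' x)) (?G' (?F' x)) (?G (?F x))
        (?p (?G'' (?F'' x)) (?G'' (?F' x)) (?G' (?F' x)) (hmap g'' (?F'' x) (?F' x) (\<alpha>' x)) (\<beta>' (?F' x)))
        (?p (?G' (?F' x)) (?G' (?F x)) (?G (?F x)) (hmap g' (?F' x) (?F x) (\<alpha> x)) (\<beta> (?F x)))"
    (is "?l = ?r") if x: "x \<in> lobj A" for x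
  proof -
    have "?l = ?p (?G'' (?F'' x)) (?G'' (?F' x)) (?G (?F x)) (hmap g'' (?F'' x) (?F' x) (\<alpha>' x))
        (?p (?G'' (?F' x)) (?G' (?F x)) (?G (?F x))
          (?p (?G'' (?F' x)) (?G'' (?F x)) (?G' (?F x)) (hmap g'' (?F' x) (?F x) (\<alpha> x)) (\<beta>' (?F x))) (\<beta> (?F x)))"
      using x by (simp add: D.lprod_assoc D.lprod_closed fs)
    \<comment> \<open>The two middle factors are one side of the naturality square of
      \<open>\<beta>'\<close> at the element \<open>\<alpha> x\<close>.\<close>
    also have "\<dots> = ?r"
      using x by (simp add: D.lprod_assoc D.lprod_closed fs lin_transformation_natural[OF \<beta>'[simplified], of "?F' x" "?F x" "\<alpha> x"])
    finally show ?thesis .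
  qed
  then show "hcomp ?C A B D f f'' g g'' (vcomp ?C A B f f' f'' \<alpha>' \<alpha>) (vcomp ?C B D g g' g'' \<beta>' \<beta>)
      = vcomp ?C A D (comp1 ?C A B D g f) (comp1 ?C A B D g' f') (comp1 ?C A B D g'' f'')
        (hcomp ?C A B D f' f'' g' g'' \<alpha>' \<beta>') (hcomp ?C A B D f f' g g' \<alpha> \<beta>)"
    unfolding kCat_simps by (intro restrict_ext) (simp add: fs)
next
  show "vcomp ?C A B f g h \<beta> \<alpha> \<in> cells2 ?C A B f h"
    if "A \<in> cells0 ?C" "B \<in> cells0 ?C" "f \<in> cells1 ?C A B" "g \<in> cells1 ?C A B"
      "h \<in> cells1 ?C A B" "\<alpha> \<in> cells2 ?C A B f g" "\<beta> \<in> cells2 ?C A B g h"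
    for A B f g h \<alpha> \<beta>
    using that lin_vcomp_closed unfolding kCat_simps(1-3) by blast
  show "hcomp ?C A B D f f' g g' \<alpha> \<beta>
      \<in> cells2 ?C A D (comp1 ?C A B D g f) (comp1 ?C A B D g' f')"
    if "A \<in> cells0 ?C" "B \<in> cells0 ?C" "D \<in> cells0 ?C"
      "f \<in> cells1 ?C A B" "f' \<in> cells1 ?C A B" "g \<in> cells1 ?C B D" "g' \<in> cells1 ?C B D"
      "\<alpha> \<in> cells2 ?C A B f f'" "\<beta> \<in> cells2 ?C B D g g'"
    for A B D f f' g g' \<alpha> \<beta>
    using that lin_hcomp_closed unfolding kCat_simps(1-3) by blast
qed (simp_all add: onecell_id_lin_functor onecell_comp_lin_functor)

section \<open>The Morita context of a \<open>k\<close>-linear category\<close>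

context tensor_factors
begin

text \<open>The cut-off makes the lift extensional, as the structure maps of 0-cells have to be. It
  remains additive because the carrier is closed under addition.\<close>

lemma tensor_restrict_lift:
  assumes P: "abelian_group P" and \<phi>: "balanced_map R M N P \<phi>"
  shows tensor_restrict_lift_hom: "(\<lambda>t\<in>carrier (tensor_group R M N). tensor_lift P (\<lambda>(m, n). \<phi> m n) t)
      \<in> add_hom (tensor_group R M N) P"
    and tensor_restrict_lift_pure: "\<lbrakk>m \<in> carrier M; n \<in> carrier N\<rbrakk>
      \<Longrightarrow> (\<lambda>t\<in>carrier (tensor_group R M N). tensor_lift P (\<lambda>(m, n). \<phi> m n) t) (pure_tensor R M N m n) = \<phi> m n"
proof -
  interpret T: abelian_group "tensor_group R M N" by (rule abelian_group_tensor_group)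
  note lift = tensor_lift_hom[OF P \<phi>]
  show "(\<lambda>t\<in>carrier (tensor_group R M N). tensor_lift P (\<lambda>(m, n). \<phi> m n) t)
      \<in> add_hom (tensor_group R M N) P"
    by (rule add_homI) (simp_all add: add_hom_closed[OF lift] add_hom_add[OF lift])
  show "\<lbrakk>m \<in> carrier M; n \<in> carrier N\<rbrakk>
      \<Longrightarrow> (\<lambda>t\<in>carrier (tensor_group R M N). tensor_lift P (\<lambda>(m, n). \<phi> m n) t) (pure_tensor R M N m n) = \<phi> m n"
    by (simp add: pure_tensor_closed tensor_lift_pure[OF P \<phi>])
qed

end

text \<open>For a fixed ring element both sides of a linearity condition are additive in the tensor,
  so pure tensors suffice.\<close>

lemma tensor_bimodule_mapI:
  assumes M: "is_bimodule k Q R M" and N: "is_bimodule k R S N" and P: "is_bimodule k Q S P"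
    and h: "h \<in> add_hom (tensor_group R M N) P"
    and l: "\<And>q m n. \<lbrakk>q \<in> carrier Q; m \<in> carrier M; n \<in> carrier N\<rbrakk>
      \<Longrightarrow> h (pure_tensor R M N (lact M q m) n) = lact P q (h (pure_tensor R M N m n))"
    and r: "\<And>s m n. \<lbrakk>s \<in> carrier S; m \<in> carrier M; n \<in> carrier N\<rbrakk>
      \<Longrightarrow> h (pure_tensor R M N m (ract N n s)) = ract P (h (pure_tensor R M N m n)) s"
  shows "bimodule_map Q S (tensor R M N) P h"
proof -
  interpret T: tensor_factors R M N by (rule tensor_factors_bimodules[OF M N])
  have "h (lact (tensor R M N) q t) = lact P q (h t)"
    if q: "q \<in> carrier Q" and t: "t \<in> carrier (tensor_group R M N)" for q t
    by (rule T.tensor_group_hom_eqI[OF is_bimodule_abelian_group[OF P]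
          add_hom_comp[OF tensor_lact_hom[OF M N q] h] add_hom_comp[OF h is_bimodule.lact_hom[OF P q]] _ t])
      (simp add: tensor_lact_pure[OF M N q] l q)
  moreover have "h (ract (tensor R M N) t s) = ract P (h t) s"
    if s: "s \<in> carrier S" and t: "t \<in> carrier (tensor_group R M N)" for s t
    by (rule T.tensor_group_hom_eqI[OF is_bimodule_abelian_group[OF P]
          add_hom_comp[OF tensor_ract_hom[OF M N s] h] add_hom_comp[OF h is_bimodule.ract_hom[OF P s]] _ t])
      (simp add: tensor_ract_pure[OF M N s] r s)
  ultimately show ?thesis
    by (simp add: bimodule_map_def add_hom_closed[OF h] add_hom_add[OF h])
qed

lemma tensor_linear_mapI:
  assumes M: "Module.module k M" and N: "Module.module k N" and P: "Module.module k P"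
    and h: "h \<in> add_hom (tensor_group k (symmetric_bimodule M) (symmetric_bimodule N)) P"
    and l: "\<And>c m n. \<lbrakk>c \<in> carrier k; m \<in> carrier M; n \<in> carrier N\<rbrakk>
      \<Longrightarrow> h (pure_tensor k (symmetric_bimodule M) (symmetric_bimodule N) (c \<odot>\<^bsub>M\<^esub> m) n)
        = c \<odot>\<^bsub>P\<^esub> h (pure_tensor k (symmetric_bimodule M) (symmetric_bimodule N) m n)"
  shows "linear_map k (tensor k (symmetric_bimodule M) (symmetric_bimodule N)) P h"
proof -
  interpret T: tensor_factors k "symmetric_bimodule M" "symmetric_bimodule N"
    by (rule tensor_factors_symmetric[OF M N])
  interpret P: Module.module k P by (rule P)
  have "smult P c \<in> add_hom P P" if "c \<in> carrier k" for c
    by (rule add_homI) (simp_all add: that P.smult_r_distr)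
  then have "h (smult (tensor k (symmetric_bimodule M) (symmetric_bimodule N)) c t) = c \<odot>\<^bsub>P\<^esub> h t"
    if c: "c \<in> carrier k" and t: "t \<in> carrier (tensor_group k (symmetric_bimodule M) (symmetric_bimodule N))" for c t
    by (intro T.tensor_group_hom_eqI[OF module.axioms(2)[OF P]
          add_hom_comp[OF tensor_symmetric_smult_hom[OF M N c] h] add_hom_comp[OF h] _ t])
      (simp_all add: tensor_symmetric_smult_pure[OF M N c] l c)
  then show ?thesis
    by (simp add: linear_map_def add_hom_closed[OF h] add_hom_add[OF h])
qed

lemma bimodule_mapD:
  assumes "bimodule_map R S M N f"
  shows bimodule_map_hom: "f \<in> add_hom M N"
    and bimodule_map_lact: "\<lbrakk>r \<in> carrier R; a \<in> carrier M\<rbrakk> \<Longrightarrow> f (lact M r a) = lact N r (f a)"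
    and bimodule_map_ract: "\<lbrakk>s \<in> carrier S; a \<in> carrier M\<rbrakk> \<Longrightarrow> f (ract M a s) = ract N (f a) s"
  using assms by (auto simp: bimodule_map_def intro: add_homI)

text \<open>Both composites are additive on the threefold tensor product, so the diagram commutes
  exactly when it does on elements \<open>(m \<otimes> n) \<otimes> p\<close>. One direction
  establishes the associativity axiom of a Morita context, the other extracts associativity of
  \<open>mprod\<close> from it.\<close>

lemma tensor_assoc_commutes_iff:
  assumes M: "is_bimodule k Q R M" and N: "is_bimodule k R S N" and P: "is_bimodule k S T P"
    and MN: "is_bimodule k Q S MN" and NP: "is_bimodule k R T NP" and W: "abelian_group W"
    and f: "bimodule_map Q S (tensor R M N) MN f" and g: "bimodule_map R T (tensor S N P) NP g"
    and f': "f' \<in> add_hom (tensor_group S MN P) W" and g': "g' \<in> add_hom (tensor_group R M NP) W"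
  shows "(\<forall>t\<in>carrier (tensor S (tensor R M N) P).
        g' (tensor_map R M NP (\<lambda>a. a) g (tensor_assoc R S M N P t))
          = f' (tensor_map S MN P f (\<lambda>c. c) t)) \<longleftrightarrow>
      (\<forall>m\<in>carrier M. \<forall>n\<in>carrier N. \<forall>p\<in>carrier P.
        g' (pure_tensor R M NP m (g (pure_tensor S N P n p)))
          = f' (pure_tensor S MN P (f (pure_tensor R M N m n)) p))"
    (is "?L \<longleftrightarrow> ?R")
proof -
  interpret MN: tensor_factors R M N by (rule tensor_factors_bimodules[OF M N])
  interpret NP: tensor_factors S N P by (rule tensor_factors_bimodules[OF N P])
  interpret L: tensor_factors S "tensor R M N" P by (rule tensor_factors_tensor_left[OF M N P])
  interpret R: tensor_factors R M "tensor S N P" by (rule tensor_factors_tensor_right[OF M N P])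
  have id_M: "(\<lambda>a. a) \<in> add_hom M M" and id_P: "(\<lambda>c. c) \<in> add_hom P P" by (rule add_homI; simp)+
  \<comment> \<open>Left linearity of \<open>g\<close> over \<open>R\<close> makes the identity
    times \<open>g\<close> well defined; right linearity of \<open>f\<close> over \<open>S\<close>
    does the same for \<open>f\<close> times the identity.\<close>
  note map_g = R.tensor_map[OF tensor_factors_bimodules[OF M NP] id_M bimodule_map_hom[OF g],
      of "\<lambda>r. r", OF _ refl bimodule_map_lact[OF g], simplified]
  note map_f = L.tensor_map[OF tensor_factors_bimodules[OF MN P] bimodule_map_hom[OF f] id_P,
      of "\<lambda>r. r", OF _ bimodule_map_ract[OF f] refl, simplified]
  let ?l = "\<lambda>t. g' (tensor_map R M NP (\<lambda>a. a) g (tensor_assoc R S M N P t))"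
  let ?r = "\<lambda>t. f' (tensor_map S MN P f (\<lambda>c. c) t)"
  have l: "?l \<in> add_hom (tensor_group S (tensor R M N) P) W"
    by (rule add_hom_comp[OF add_hom_comp[OF tensor_assoc_hom[OF M N P] map_g(1)] g'])
  have r: "?r \<in> add_hom (tensor_group S (tensor R M N) P) W"
    by (rule add_hom_comp[OF map_f(1) f'])
  have pure: "?l (pure_tensor S (tensor R M N) P (pure_tensor R M N m n) p)
        = g' (pure_tensor R M NP m (g (pure_tensor S N P n p)))"
      "?r (pure_tensor S (tensor R M N) P (pure_tensor R M N m n) p)
        = f' (pure_tensor S MN P (f (pure_tensor R M N m n)) p)"
    if "m \<in> carrier M" "n \<in> carrier N" "p \<in> carrier P" for m n p
    using that
    by (simp_all add: tensor_assoc_pure[OF M N P] map_g(2) map_f(2) MN.pure_tensor_closed NP.pure_tensor_closed)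
  show ?thesis
  proof
    assume L: ?L
    show ?R
    proof (intro ballI)
      fix m n p assume *: "m \<in> carrier M" "n \<in> carrier N" "p \<in> carrier P"
      then have "pure_tensor S (tensor R M N) P (pure_tensor R M N m n) p \<in> carrier (tensor S (tensor R M N) P)"
        by (simp add: L.pure_tensor_closed MN.pure_tensor_closed)
      from bspec[OF L this] show "g' (pure_tensor R M NP m (g (pure_tensor S N P n p)))
          = f' (pure_tensor S MN P (f (pure_tensor R M N m n)) p)"
        using pure[OF *] by simp
    qed
  next
    assume R: ?R
    show ?L
    proof
      fix t assume "t \<in> carrier (tensor S (tensor R M N) P)"
      then have t: "t \<in> carrier (tensor_group S (tensor R M N) P)" by simp
      show "?l t = ?r t"
        by (rule triple_tensor_hom_eqI[OF M N P W l r _ t]) (use R in \<open>simp only: pure\<close>)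
    qed
  qed
qed

section \<open>Hom modules as algebras and bimodules\<close>

lemma regular_bimodule_simps [simp]:
  "carrier (regular_bimodule A) = carrier A"
  "ring.add (regular_bimodule A) = ring.add A"
  "ring.zero (regular_bimodule A) = ring.zero A"
  "smult (regular_bimodule A) = smult A"
  "lact (regular_bimodule A) = monoid.mult A"
  "ract (regular_bimodule A) = monoid.mult A"
  by (simp_all add: regular_bimodule_def)

lemma module_cong:
  assumes "Module.module k M" and N: "carrier N = carrier M" "ring.add N = ring.add M"
    "ring.zero N = ring.zero M" "smult N = smult M"
  shows "Module.module k N"
proof -
  interpret M: Module.module k M by fact
  show ?thesis
    by (intro moduleI abelian_group_cong[OF M.abelian_group_axioms] M.R.cring_axioms N)
      (simp_all add: N M.smult_l_distr M.smult_r_distr M.smult_assoc1)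
qed

definition hom_algebra ::
  "('k, 'e) ring_scheme \<Rightarrow> ('o, 'a, 'k) lincat \<Rightarrow> 'o \<Rightarrow> ('k, 'a) module" where
  "hom_algebra k A x =
    \<lparr>carrier = carrier (lhom A x x),
     monoid.mult = (\<lambda>a\<in>carrier (lhom A x x). \<lambda>b\<in>carrier (lhom A x x). lprod k A x x x a b),
     monoid.one = lunit A x, ring.zero = ring.zero (lhom A x x), ring.add = ring.add (lhom A x x),
     smult = smult (lhom A x x)\<rparr>"

text \<open>With both actions cut off to the carriers, the case \<open>x = y\<close> is literally
  the regular bimodule of \<open>hom_algebra\<close>, as a Morita context demands.\<close>

definition hom_bimodule ::
  "('k, 'e) ring_scheme \<Rightarrow> ('o, 'a, 'k) lincat \<Rightarrow> 'o \<Rightarrow> 'o \<Rightarrow> ('k, 'a, 'a, 'a) bimodule" where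
  "hom_bimodule k A x y =
    \<lparr>carrier = carrier (lhom A x y), monoid.mult = undefined, monoid.one = undefined,
     ring.zero = ring.zero (lhom A x y), ring.add = ring.add (lhom A x y), smult = smult (lhom A x y),
     lact = (\<lambda>a\<in>carrier (lhom A x x). \<lambda>b\<in>carrier (lhom A x y). lprod k A x x y a b),
     ract = (\<lambda>a\<in>carrier (lhom A x y). \<lambda>b\<in>carrier (lhom A y y). lprod k A x y y a b)\<rparr>"

definition morita_of_lincat ::
  "('k, 'e) ring_scheme \<Rightarrow> ('o, 'a, 'k) lincat \<Rightarrow> ('o, 'a, 'k) morita" where
  "morita_of_lincat k A =
    \<lparr>mobj = lobj A,
     malg = (\<lambda>x\<in>lobj A. hom_algebra k A x),
     mbim = (\<lambda>x\<in>lobj A. \<lambda>y\<in>lobj A. hom_bimodule k A x y),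
     mmult = (\<lambda>x\<in>lobj A. \<lambda>y\<in>lobj A. \<lambda>z\<in>lobj A.
       \<lambda>t\<in>carrier (tensor_group (hom_algebra k A y) (hom_bimodule k A x y) (hom_bimodule k A y z)).
         tensor_lift (lhom A x z) (\<lambda>(a, b). lprod k A x y z a b) t)\<rparr>"

lemma hom_algebra_simps [simp]:
  "carrier (hom_algebra k A x) = carrier (lhom A x x)"
  "monoid.one (hom_algebra k A x) = lunit A x"
  "ring.zero (hom_algebra k A x) = ring.zero (lhom A x x)"
  "ring.add (hom_algebra k A x) = ring.add (lhom A x x)"
  "smult (hom_algebra k A x) = smult (lhom A x x)"
  "\<lbrakk>a \<in> carrier (lhom A x x); b \<in> carrier (lhom A x x)\<rbrakk>
    \<Longrightarrow> a \<otimes>\<^bsub>hom_algebra k A x\<^esub> b = lprod k A x x x a b"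
  by (simp_all add: hom_algebra_def)

lemma hom_bimodule_simps [simp]:
  "carrier (hom_bimodule k A x y) = carrier (lhom A x y)"
  "monoid.mult (hom_bimodule k A x y) = undefined"
  "monoid.one (hom_bimodule k A x y) = undefined"
  "ring.zero (hom_bimodule k A x y) = ring.zero (lhom A x y)"
  "ring.add (hom_bimodule k A x y) = ring.add (lhom A x y)"
  "smult (hom_bimodule k A x y) = smult (lhom A x y)"
  "\<lbrakk>r \<in> carrier (lhom A x x); a \<in> carrier (lhom A x y)\<rbrakk>
    \<Longrightarrow> lact (hom_bimodule k A x y) r a = lprod k A x x y r a"
  "\<lbrakk>a \<in> carrier (lhom A x y); s \<in> carrier (lhom A y y)\<rbrakk>
    \<Longrightarrow> ract (hom_bimodule k A x y) a s = lprod k A x y y a s"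
  by (simp_all add: hom_bimodule_def)

lemma hom_bimodule_self: "hom_bimodule k A x x = regular_bimodule (hom_algebra k A x)"
  by (simp add: hom_bimodule_def regular_bimodule_def hom_algebra_def)

lemma add_hom_hom_bimodule [simp]:
  "add_hom (hom_bimodule k A x y) P = add_hom (lhom A x y) P"
  "add_hom P (hom_bimodule k A x y) = add_hom P (lhom A x y)"
  by (simp_all add: add_hom_def hom_def)

lemma morita_of_lincat_simps [simp]:
  "mobj (morita_of_lincat k A) = lobj A"
  "x \<in> lobj A \<Longrightarrow> malg (morita_of_lincat k A) x = hom_algebra k A x"
  "\<lbrakk>x \<in> lobj A; y \<in> lobj A\<rbrakk> \<Longrightarrow> mbim (morita_of_lincat k A) x y = hom_bimodule k A x y"
  by (simp_all add: morita_of_lincat_def)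

context lincat
begin

lemma lhom_add_closed:
  "\<lbrakk>x \<in> lobj A; y \<in> lobj A; a \<in> carrier (lhom A x y); b \<in> carrier (lhom A x y)\<rbrakk>
    \<Longrightarrow> a \<oplus>\<^bsub>lhom A x y\<^esub> b \<in> carrier (lhom A x y)"
  by (rule abelian_monoid.a_closed[OF abelian_group.axioms(1)[OF module.axioms(2)[OF lhom_module]]])

lemma lhom_smult_closed:
  "\<lbrakk>x \<in> lobj A; y \<in> lobj A; c \<in> carrier k; a \<in> carrier (lhom A x y)\<rbrakk>
    \<Longrightarrow> c \<odot>\<^bsub>lhom A x y\<^esub> a \<in> carrier (lhom A x y)"
  by (rule module.smult_closed[OF lhom_module])

lemma lhom_extensional: "\<lbrakk>x \<in> lobj A; y \<in> lobj A\<rbrakk> \<Longrightarrow> extensional_module k (lhom A x y)"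
  and lhom_mult: "\<lbrakk>x \<in> lobj A; y \<in> lobj A\<rbrakk> \<Longrightarrow> monoid.mult (lhom A x y) = undefined"
  and lhom_one: "\<lbrakk>x \<in> lobj A; y \<in> lobj A\<rbrakk> \<Longrightarrow> monoid.one (lhom A x y) = undefined"
  using lincat by (auto simp: lincats_def khom_modules_def)

lemma hom_algebra: "assoc_algebra k (hom_algebra k A x)" if x: "x \<in> lobj A"
proof (intro assoc_algebra.intro assoc_algebra_axioms.intro ringI monoidI)
  show "Module.module k (hom_algebra k A x)"
    by (rule module_cong[OF lhom_module[OF x x]]) simp_all
  then show "abelian_group (hom_algebra k A x)"
    by (rule module.axioms(2))
qed (simp_all add: x lprod_closed lunit_closed lprod_assoc lprod_unit_left lprod_unit_right
    lprod_add_left lprod_add_right lhom_add_closed lprod_smult_left lprod_smult_right lhom_smult_closed)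

lemma hom_algebra_kalgebra: "x \<in> lobj A \<Longrightarrow> hom_algebra k A x \<in> kalgebras k"
  using lhom_extensional[of x x] hom_algebra[of x]
  by (auto simp: kalgebras_def extensional_module_def hom_algebra_def lprod_closed)

text \<open>Symmetry over \<open>k\<close> is bilinearity together with the unit law: multiplying by
  \<open>c\<close> times a unit, on either side, is multiplying by \<open>c\<close>.\<close>

lemma hom_bimodule: "is_bimodule k (hom_algebra k A x) (hom_algebra k A y) (hom_bimodule k A x y)"
  if x: "x \<in> lobj A" and y: "y \<in> lobj A"
proof (intro is_bimodule.intro is_bimodule_axioms.intro hom_algebra x y)
  show "Module.module k (hom_bimodule k A x y)"
    by (rule module_cong[OF lhom_module[OF x y]]) simp_all
qed (simp_all add: x y lprod_closed lunit_closed lprod_assoc lprod_unit_left lprod_unit_right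
    lprod_add_left lprod_add_right lhom_add_closed lprod_smult_left lprod_smult_right lhom_smult_closed)

lemma hom_bimodule_kbimodule:
  "\<lbrakk>x \<in> lobj A; y \<in> lobj A\<rbrakk>
    \<Longrightarrow> hom_bimodule k A x y \<in> kbimodules k (hom_algebra k A x) (hom_algebra k A y)"
  using lhom_extensional[of x y] hom_bimodule[of x y]
  by (auto simp: kbimodules_def extensional_module_def hom_bimodule_def lprod_closed)

lemma lprod_hom_balanced:
  assumes "x \<in> lobj A" "y \<in> lobj A" "z \<in> lobj A"
  shows "balanced_map (hom_algebra k A y) (hom_bimodule k A x y) (hom_bimodule k A y z)
    (lhom A x z) (lprod k A x y z)"
  by (rule balanced_mapI)
    (simp_all add: assms lprod_closed lprod_add_left lprod_add_right lprod_assoc)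

lemma morita_mmult:
  assumes x: "x \<in> lobj A" and y: "y \<in> lobj A" and z: "z \<in> lobj A"
  shows morita_mmult_hom: "mmult (morita_of_lincat k A) x y z
      \<in> add_hom (tensor_group (hom_algebra k A y) (hom_bimodule k A x y) (hom_bimodule k A y z)) (lhom A x z)"
    and morita_mmult_pure: "\<lbrakk>a \<in> carrier (lhom A x y); b \<in> carrier (lhom A y z)\<rbrakk>
      \<Longrightarrow> mmult (morita_of_lincat k A) x y z
          (pure_tensor (hom_algebra k A y) (hom_bimodule k A x y) (hom_bimodule k A y z) a b)
        = lprod k A x y z a b"
proof -
  interpret T: tensor_factors "hom_algebra k A y" "hom_bimodule k A x y" "hom_bimodule k A y z"
    by (rule tensor_factors_bimodules[OF hom_bimodule[OF x y] hom_bimodule[OF y z]])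
  have eq: "mmult (morita_of_lincat k A) x y z =
      (\<lambda>t\<in>carrier (tensor_group (hom_algebra k A y) (hom_bimodule k A x y) (hom_bimodule k A y z)).
         tensor_lift (lhom A x z) (\<lambda>(a, b). lprod k A x y z a b) t)"
    by (simp add: morita_of_lincat_def x y z)
  note * = T.tensor_restrict_lift[OF module.axioms(2)[OF lhom_module[OF x z]] lprod_hom_balanced[OF x y z]]
  show "mmult (morita_of_lincat k A) x y z
      \<in> add_hom (tensor_group (hom_algebra k A y) (hom_bimodule k A x y) (hom_bimodule k A y z)) (lhom A x z)"
    unfolding eq by (rule *(1))
  show "\<lbrakk>a \<in> carrier (lhom A x y); b \<in> carrier (lhom A y z)\<rbrakk>
      \<Longrightarrow> mmult (morita_of_lincat k A) x y z
          (pure_tensor (hom_algebra k A y) (hom_bimodule k A x y) (hom_bimodule k A y z) a b)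
        = lprod k A x y z a b"
    unfolding eq by (rule *(2)) simp_all
qed

lemma morita_mprod:
  "\<lbrakk>x \<in> lobj A; y \<in> lobj A; z \<in> lobj A; a \<in> carrier (lhom A x y); b \<in> carrier (lhom A y z)\<rbrakk>
    \<Longrightarrow> mprod (morita_of_lincat k A) x y z a b = lprod k A x y z a b"
  by (simp add: mprod_def morita_mmult_pure)

text \<open>Linearity on the two sides is associativity with an endomorphism of \<open>x\<close> or
  of \<open>z\<close> as an outer factor.\<close>

lemma morita_mmult_bimodule_map:
  assumes x: "x \<in> lobj A" and y: "y \<in> lobj A" and z: "z \<in> lobj A"
  shows "bimodule_map (hom_algebra k A x) (hom_algebra k A z)
    (tensor (hom_algebra k A y) (hom_bimodule k A x y) (hom_bimodule k A y z)) (hom_bimodule k A x z)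
    (mmult (morita_of_lincat k A) x y z)"
  by (rule tensor_bimodule_mapI[OF hom_bimodule[OF x y] hom_bimodule[OF y z] hom_bimodule[OF x z]])
    (simp_all add: x y z morita_mmult_hom morita_mmult_pure lprod_closed lprod_assoc)

lemma morita_mmult_assoc:
  assumes x: "x \<in> lobj A" and y: "y \<in> lobj A" and z: "z \<in> lobj A" and u: "u \<in> lobj A"
  shows "\<forall>t\<in>carrier (tensor (hom_algebra k A z)
        (tensor (hom_algebra k A y) (hom_bimodule k A x y) (hom_bimodule k A y z)) (hom_bimodule k A z u)).
      mmult (morita_of_lincat k A) x y u
        (tensor_map (hom_algebra k A y) (hom_bimodule k A x y) (hom_bimodule k A y u) (\<lambda>a. a)
          (mmult (morita_of_lincat k A) y z u)
          (tensor_assoc (hom_algebra k A y) (hom_algebra k A z) (hom_bimodule k A x y)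
            (hom_bimodule k A y z) (hom_bimodule k A z u) t))
      = mmult (morita_of_lincat k A) x z u
          (tensor_map (hom_algebra k A z) (hom_bimodule k A x z) (hom_bimodule k A z u)
            (mmult (morita_of_lincat k A) x y z) (\<lambda>c. c) t)"
  by (subst tensor_assoc_commutes_iff[OF hom_bimodule[OF x y] hom_bimodule[OF y z] hom_bimodule[OF z u]
        hom_bimodule[OF x z] hom_bimodule[OF y u] module.axioms(2)[OF lhom_module[OF x u]]
        morita_mmult_bimodule_map[OF x y z] morita_mmult_bimodule_map[OF y z u]
        morita_mmult_hom[OF x z u] morita_mmult_hom[OF x y u]])
    (simp add: x y z u morita_mmult_pure lprod_closed lprod_assoc)

text \<open>The canonical isomorphism is the lift of the left action, and the left action is
  composition; both maps therefore have the same values on pure tensors.\<close>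

lemma morita_mmult_left_unit:
  assumes x: "x \<in> lobj A" and y: "y \<in> lobj A"
    and t: "t \<in> carrier (tensor_group (hom_algebra k A x) (hom_bimodule k A x x) (hom_bimodule k A x y))"
  shows "mmult (morita_of_lincat k A) x x y t = tensor_lunit (hom_bimodule k A x y) t"
proof -
  interpret T: tensor_factors "hom_algebra k A x" "hom_bimodule k A x x" "hom_bimodule k A x y"
    by (rule tensor_factors_bimodules[OF hom_bimodule[OF x x] hom_bimodule[OF x y]])
  show ?thesis
    unfolding tensor_lunit_def
    by (rule T.tensor_lift_unique[symmetric, OF is_bimodule_abelian_group[OF hom_bimodule[OF x y]] _ _ _ t])
      (simp_all add: x y morita_mmult_hom morita_mmult_pure balanced_map_def lprod_closed lprod_assoc
        lprod_add_left lprod_add_right lhom_add_closed)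
qed

lemma morita_mmult_right_unit:
  assumes x: "x \<in> lobj A" and y: "y \<in> lobj A"
    and t: "t \<in> carrier (tensor_group (hom_algebra k A y) (hom_bimodule k A x y) (hom_bimodule k A y y))"
  shows "mmult (morita_of_lincat k A) x y y t = tensor_runit (hom_bimodule k A x y) t"
proof -
  interpret T: tensor_factors "hom_algebra k A y" "hom_bimodule k A x y" "hom_bimodule k A y y"
    by (rule tensor_factors_bimodules[OF hom_bimodule[OF x y] hom_bimodule[OF y y]])
  show ?thesis
    unfolding tensor_runit_def
    by (rule T.tensor_lift_unique[symmetric, OF is_bimodule_abelian_group[OF hom_bimodule[OF x y]] _ _ _ t])
      (simp_all add: x y morita_mmult_hom morita_mmult_pure balanced_map_def lprod_closed lprod_assoc
        lprod_add_left lprod_add_right lhom_add_closed)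
qed

lemma morita_of_lincat_closed: "morita_of_lincat k A \<in> morita_contexts k"
proof -
  let ?M = "morita_of_lincat k A"
  have "malg ?M \<in> lobj A \<rightarrow>\<^sub>E kalgebras k"
    by (auto simp: morita_of_lincat_def hom_algebra_kalgebra)
  moreover have "mbim ?M \<in> (\<Pi>\<^sub>E x\<in>lobj A. \<Pi>\<^sub>E y\<in>lobj A. kbimodules k (malg ?M x) (malg ?M y))"
    by (auto simp: morita_of_lincat_def hom_bimodule_kbimodule)
  moreover have "mmult ?M \<in> (\<Pi>\<^sub>E x\<in>lobj A. \<Pi>\<^sub>E y\<in>lobj A. \<Pi>\<^sub>E z\<in>lobj A.
      carrier (mtensor ?M x y z) \<rightarrow>\<^sub>E carrier (mbim ?M x z))"
  proof (intro PiE_I)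
    fix x y z t assume xyz: "x \<in> lobj A" "y \<in> lobj A" "z \<in> lobj A"
    show "t \<in> carrier (mtensor ?M x y z) \<Longrightarrow> mmult ?M x y z t \<in> carrier (mbim ?M x z)"
      using add_hom_closed[OF morita_mmult_hom[OF xyz], of t] xyz by (simp add: mtensor_def)
    show "t \<notin> carrier (mtensor ?M x y z) \<Longrightarrow> mmult ?M x y z t = undefined"
      using xyz by (simp add: mtensor_def morita_of_lincat_def)
  qed (simp_all add: morita_of_lincat_def)
  moreover have "\<forall>x\<in>lobj A. mbim ?M x x = regular_bimodule (malg ?M x)"
    by (simp add: hom_bimodule_self)
  moreover have "\<forall>x\<in>lobj A. \<forall>y\<in>lobj A. \<forall>t\<in>carrier (mtensor ?M x x y).
      mmult ?M x x y t = tensor_lunit (mbim ?M x y) t"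
    by (simp add: mtensor_def morita_mmult_left_unit)
  moreover have "\<forall>x\<in>lobj A. \<forall>y\<in>lobj A. \<forall>t\<in>carrier (mtensor ?M x y y).
      mmult ?M x y y t = tensor_runit (mbim ?M x y) t"
    by (simp add: mtensor_def morita_mmult_right_unit)
  ultimately show ?thesis
    by (simp add: morita_contexts_def mtensor_def morita_mmult_bimodule_map morita_mmult_assoc
        del: tensor_simps)
qed

end

section \<open>The \<open>k\<close>-linear category of a Morita context\<close>

definition underlying_module :: "('k, 'r, 's, 'm) bimodule \<Rightarrow> ('k, 'm) module" where
  "underlying_module M =
    \<lparr>carrier = carrier M, monoid.mult = undefined, monoid.one = undefined,
     ring.zero = ring.zero M, ring.add = ring.add M, smult = smult M\<rparr>"

lemma underlying_module_simps [simp]: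
  "carrier (underlying_module M) = carrier M"
  "ring.zero (underlying_module M) = ring.zero M"
  "ring.add (underlying_module M) = ring.add M"
  "smult (underlying_module M) = smult M"
  by (simp_all add: underlying_module_def)

lemma add_hom_underlying_module [simp]:
  "add_hom (underlying_module M) P = add_hom M P"
  "add_hom P (underlying_module M) = add_hom P M"
  by (simp_all add: add_hom_def hom_def)

definition lincat_of_morita ::
  "('k, 'e) ring_scheme \<Rightarrow> ('o, 'a, 'k) morita \<Rightarrow> ('o, 'a, 'k) lincat" where
  "lincat_of_morita k A =
    \<lparr>lobj = mobj A,
     lhom = (\<lambda>x\<in>mobj A. \<lambda>y\<in>mobj A. underlying_module (mbim A x y)),
     lmult = (\<lambda>x\<in>mobj A. \<lambda>y\<in>mobj A. \<lambda>z\<in>mobj A.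
       \<lambda>t\<in>carrier (tensor_group k (symmetric_bimodule (underlying_module (mbim A x y)))
           (symmetric_bimodule (underlying_module (mbim A y z)))).
         tensor_lift (underlying_module (mbim A x z)) (\<lambda>(a, b). mprod A x y z a b) t),
     lunit = (\<lambda>x\<in>mobj A. monoid.one (malg A x))\<rparr>"

lemma lincat_of_morita_simps [simp]:
  "lobj (lincat_of_morita k A) = mobj A"
  "\<lbrakk>x \<in> mobj A; y \<in> mobj A\<rbrakk> \<Longrightarrow> lhom (lincat_of_morita k A) x y = underlying_module (mbim A x y)"
  "x \<in> mobj A \<Longrightarrow> lunit (lincat_of_morita k A) x = monoid.one (malg A x)"
  by (simp_all add: lincat_of_morita_def)

section \<open>The product of a Morita context on elements\<close>

locale morita_context =
  fixes k :: "('k, 'e) ring_scheme" and A :: "('o, 'a, 'k) morita"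
  assumes morita_context: "A \<in> morita_contexts k"
begin

lemma malg_kalgebra: "x \<in> mobj A \<Longrightarrow> malg A x \<in> kalgebras k"
  using morita_context by (auto simp: morita_contexts_def)

lemma malg_algebra: "x \<in> mobj A \<Longrightarrow> assoc_algebra k (malg A x)"
  using malg_kalgebra by (simp add: kalgebras_def)

lemma mbim_kbimodule: "\<lbrakk>x \<in> mobj A; y \<in> mobj A\<rbrakk> \<Longrightarrow> mbim A x y \<in> kbimodules k (malg A x) (malg A y)"
proof -
  assume xy: "x \<in> mobj A" "y \<in> mobj A"
  have "mbim A \<in> (\<Pi>\<^sub>E x\<in>mobj A. \<Pi>\<^sub>E y\<in>mobj A. kbimodules k (malg A x) (malg A y))"
    using morita_context by (simp add: morita_contexts_def)
  from PiE_mem[OF PiE_mem[OF this xy(1)] xy(2)] show ?thesis .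
qed

lemma mbim_bimodule: "\<lbrakk>x \<in> mobj A; y \<in> mobj A\<rbrakk> \<Longrightarrow> is_bimodule k (malg A x) (malg A y) (mbim A x y)"
  using mbim_kbimodule by (simp add: kbimodules_def)

lemma mbim_self: "x \<in> mobj A \<Longrightarrow> mbim A x x = regular_bimodule (malg A x)"
  using morita_context by (simp add: morita_contexts_def)

lemma mbim_module: "\<lbrakk>x \<in> mobj A; y \<in> mobj A\<rbrakk> \<Longrightarrow> Module.module k (mbim A x y)"
  using mbim_bimodule by (simp add: is_bimodule_def)

lemma mbim_tensor_factors: "\<lbrakk>x \<in> mobj A; y \<in> mobj A; z \<in> mobj A\<rbrakk>
    \<Longrightarrow> tensor_factors (malg A y) (mbim A x y) (mbim A y z)"
  by (rule tensor_factors_bimodules[OF mbim_bimodule mbim_bimodule])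

lemma mmult_bimodule_map: "\<lbrakk>x \<in> mobj A; y \<in> mobj A; z \<in> mobj A\<rbrakk> \<Longrightarrow> bimodule_map (malg A x) (malg A z)
    (tensor (malg A y) (mbim A x y) (mbim A y z)) (mbim A x z) (mmult A x y z)"
  using morita_context by (simp add: morita_contexts_def mtensor_def)

lemma mmult_hom: "\<lbrakk>x \<in> mobj A; y \<in> mobj A; z \<in> mobj A\<rbrakk>
    \<Longrightarrow> mmult A x y z \<in> add_hom (tensor_group (malg A y) (mbim A x y) (mbim A y z)) (mbim A x z)"
  using bimodule_map_hom[OF mmult_bimodule_map] by simp

lemma mprod_balanced:
  assumes "x \<in> mobj A" "y \<in> mobj A" "z \<in> mobj A"
  shows "balanced_map (malg A y) (mbim A x y) (mbim A y z) (mbim A x z) (mprod A x y z)"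
proof -
  interpret T: tensor_factors "malg A y" "mbim A x y" "mbim A y z"
    by (rule mbim_tensor_factors[OF assms])
  note mult_hom = mmult_hom[OF assms]
  show ?thesis
    by (rule balanced_mapI)
      (simp_all add: mprod_def add_hom_closed[OF mult_hom] T.pure_tensor_closed T.pure_tensor_add_left
        T.pure_tensor_add_right T.pure_tensor_act add_hom_add[OF mult_hom])
qed

lemmas mprod_closed = balanced_map_closed[OF mprod_balanced]

lemma mprod_lact:
  assumes "x \<in> mobj A" "y \<in> mobj A" "z \<in> mobj A" "r \<in> carrier (malg A x)"
    "a \<in> carrier (mbim A x y)" "b \<in> carrier (mbim A y z)"
  shows "mprod A x y z (lact (mbim A x y) r a) b = lact (mbim A x z) r (mprod A x y z a b)"
  using bimodule_map_lact[OF mmult_bimodule_map[OF assms(1-3)] assms(4)]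
    tensor_lact_pure[OF mbim_bimodule[OF assms(1,2)] mbim_bimodule[OF assms(2,3)] assms(4-6)]
    tensor_factors.pure_tensor_closed[OF mbim_tensor_factors[OF assms(1-3)] assms(5,6)]
  by (simp add: mprod_def flip: tensor_lact_pure[OF mbim_bimodule[OF assms(1,2)] mbim_bimodule[OF assms(2,3)] assms(4-6)])

lemma mprod_ract:
  assumes "x \<in> mobj A" "y \<in> mobj A" "z \<in> mobj A" "s \<in> carrier (malg A z)"
    "a \<in> carrier (mbim A x y)" "b \<in> carrier (mbim A y z)"
  shows "mprod A x y z a (ract (mbim A y z) b s) = ract (mbim A x z) (mprod A x y z a b) s"
  using bimodule_map_ract[OF mmult_bimodule_map[OF assms(1-3)] assms(4)]
    tensor_factors.pure_tensor_closed[OF mbim_tensor_factors[OF assms(1-3)] assms(5,6)]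
  by (simp add: mprod_def flip: tensor_ract_pure[OF mbim_bimodule[OF assms(1,2)] mbim_bimodule[OF assms(2,3)] assms(4-6)])

lemma malg_smult_one: "\<lbrakk>x \<in> mobj A; c \<in> carrier k\<rbrakk> \<Longrightarrow> c \<odot>\<^bsub>malg A x\<^esub> \<one>\<^bsub>malg A x\<^esub> \<in> carrier (malg A x)"
  using malg_algebra[of x] by (intro module.smult_closed[of k "malg A x"] monoid.one_closed)
    (simp_all add: assoc_algebra_def ring_def)

text \<open>By symmetry over \<open>k\<close> the scalar \<open>c\<close> acts as \<open>c\<close>
  times the unit of the algebra at \<open>x\<close>, and the multiplication is linear over that
  algebra. The version on the right uses the algebra at \<open>z\<close>.\<close>

lemma mprod_smult_left:
  assumes "x \<in> mobj A" "y \<in> mobj A" "z \<in> mobj A" "c \<in> carrier k"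
    "a \<in> carrier (mbim A x y)" "b \<in> carrier (mbim A y z)"
  shows "mprod A x y z (c \<odot>\<^bsub>mbim A x y\<^esub> a) b = c \<odot>\<^bsub>mbim A x z\<^esub> mprod A x y z a b"
  using mprod_lact[OF assms(1-3) malg_smult_one[OF assms(1,4)] assms(5,6)] assms
  by (simp add: is_bimodule.lact_symmetric[OF mbim_bimodule] mprod_closed)

lemma mprod_smult_right:
  assumes "x \<in> mobj A" "y \<in> mobj A" "z \<in> mobj A" "c \<in> carrier k"
    "a \<in> carrier (mbim A x y)" "b \<in> carrier (mbim A y z)"
  shows "mprod A x y z a (c \<odot>\<^bsub>mbim A y z\<^esub> b) = c \<odot>\<^bsub>mbim A x z\<^esub> mprod A x y z a b"
  using mprod_ract[OF assms(1-3) malg_smult_one[OF assms(3,4)] assms(5,6)] assms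
  by (simp add: is_bimodule.ract_symmetric[OF mbim_bimodule] mprod_closed)

text \<open>The multiplication with \<open>x\<close> repeated is the canonical isomorphism, whose
  value on \<open>r \<otimes> a\<close> is the action. This supplies the left unit law of the
  category and, in the round trip, the recovery of the left action.\<close>

lemma mprod_eq_lact:
  assumes x: "x \<in> mobj A" and y: "y \<in> mobj A" and r: "r \<in> carrier (malg A x)" and a: "a \<in> carrier (mbim A x y)"
  shows "mprod A x x y r a = lact (mbim A x y) r a"
proof -
  interpret M: is_bimodule k "malg A x" "malg A y" "mbim A x y" by (rule mbim_bimodule[OF x y])
  interpret T: tensor_factors "malg A x" "mbim A x x" "mbim A x y" by (rule mbim_tensor_factors[OF x x y])
  \<comment> \<open>On the regular bimodule the inner right action is multiplication in the algebra,
    so balancedness is \<open>lact_mult\<close>.\<close>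
  have bal: "balanced_map (malg A x) (mbim A x x) (mbim A x y) (mbim A x y) (lact (mbim A x y))"
    by (rule balanced_mapI)
      (simp_all add: mbim_self[OF x] M.lact_closed M.lact_add_left M.lact_add_right M.lact_mult)
  have r': "r \<in> carrier (mbim A x x)" using r by (simp add: mbim_self[OF x])
  have "mmult A x x y t = tensor_lunit (mbim A x y) t" if "t \<in> carrier (mtensor A x x y)" for t
    using morita_context x y that unfolding morita_contexts_def by blast
  then show ?thesis
    using T.tensor_lift_pure[OF is_bimodule_abelian_group[OF mbim_bimodule[OF x y]] bal r' a]
      T.pure_tensor_closed[OF r' a]
    by (simp add: mprod_def mtensor_def tensor_lunit_def)
qed

lemma mprod_eq_ract:
  assumes x: "x \<in> mobj A" and y: "y \<in> mobj A" and a: "a \<in> carrier (mbim A x y)" and s: "s \<in> carrier (malg A y)"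
  shows "mprod A x y y a s = ract (mbim A x y) a s"
proof -
  interpret M: is_bimodule k "malg A x" "malg A y" "mbim A x y" by (rule mbim_bimodule[OF x y])
  interpret T: tensor_factors "malg A y" "mbim A x y" "mbim A y y" by (rule mbim_tensor_factors[OF x y y])
  have bal: "balanced_map (malg A y) (mbim A x y) (mbim A y y) (mbim A x y) (ract (mbim A x y))"
    by (rule balanced_mapI)
      (simp_all add: mbim_self[OF y] M.ract_closed M.ract_add_left M.ract_add_right M.ract_mult)
  have s': "s \<in> carrier (mbim A y y)" using s by (simp add: mbim_self[OF y])
  have "mmult A x y y t = tensor_runit (mbim A x y) t" if "t \<in> carrier (mtensor A x y y)" for t
    using morita_context x y that unfolding morita_contexts_def by blast
  then show ?thesis
    using T.tensor_lift_pure[OF is_bimodule_abelian_group[OF mbim_bimodule[OF x y]] bal a s']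
      T.pure_tensor_closed[OF a s']
    by (simp add: mprod_def mtensor_def tensor_runit_def)
qed

lemma mprod_assoc:
  assumes x: "x \<in> mobj A" and y: "y \<in> mobj A" and z: "z \<in> mobj A" and u: "u \<in> mobj A"
    and abc: "a \<in> carrier (mbim A x y)" "b \<in> carrier (mbim A y z)" "c \<in> carrier (mbim A z u)"
  shows "mprod A x y u a (mprod A y z u b c) = mprod A x z u (mprod A x y z a b) c"
proof -
  have "\<forall>t\<in>carrier (tensor (malg A z) (tensor (malg A y) (mbim A x y) (mbim A y z)) (mbim A z u)).
      mmult A x y u (tensor_map (malg A y) (mbim A x y) (mbim A y u) (\<lambda>a. a) (mmult A y z u)
        (tensor_assoc (malg A y) (malg A z) (mbim A x y) (mbim A y z) (mbim A z u) t))
      = mmult A x z u (tensor_map (malg A z) (mbim A x z) (mbim A z u) (mmult A x y z) (\<lambda>c. c) t)"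
    using morita_context x y z u by (simp add: morita_contexts_def mtensor_def)
  then have "\<forall>a\<in>carrier (mbim A x y). \<forall>b\<in>carrier (mbim A y z). \<forall>c\<in>carrier (mbim A z u).
      mprod A x y u a (mprod A y z u b c) = mprod A x z u (mprod A x y z a b) c"
    unfolding mprod_def
    by (subst (asm) tensor_assoc_commutes_iff[OF mbim_bimodule[OF x y] mbim_bimodule[OF y z] mbim_bimodule[OF z u]
          mbim_bimodule[OF x z] mbim_bimodule[OF y u] is_bimodule_abelian_group[OF mbim_bimodule[OF x u]]
          mmult_bimodule_map[OF x y z] mmult_bimodule_map[OF y z u] mmult_hom[OF x z u] mmult_hom[OF x y u]])
  then show ?thesis using abc by blast
qed

section \<open>The induced composition over \<open>k\<close>\<close>

lemma underlying_module: "\<lbrakk>x \<in> mobj A; y \<in> mobj A\<rbrakk> \<Longrightarrow> Module.module k (underlying_module (mbim A x y))"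
  by (rule module_cong[OF mbim_module]) simp_all

lemma underlying_module_khom: "\<lbrakk>x \<in> mobj A; y \<in> mobj A\<rbrakk> \<Longrightarrow> underlying_module (mbim A x y) \<in> khom_modules k"
  using mbim_kbimodule[of x y] underlying_module[of x y]
  by (simp add: khom_modules_def kbimodules_def underlying_module_def extensional_module_def)

lemma lincat_lmult:
  assumes x: "x \<in> mobj A" and y: "y \<in> mobj A" and z: "z \<in> mobj A"
  shows lincat_lmult_hom: "lmult (lincat_of_morita k A) x y z
      \<in> add_hom (tensor_group k (symmetric_bimodule (underlying_module (mbim A x y)))
           (symmetric_bimodule (underlying_module (mbim A y z)))) (mbim A x z)"
    and lincat_lmult_pure: "\<lbrakk>a \<in> carrier (mbim A x y); b \<in> carrier (mbim A y z)\<rbrakk>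
      \<Longrightarrow> lmult (lincat_of_morita k A) x y z
          (pure_tensor k (symmetric_bimodule (underlying_module (mbim A x y)))
            (symmetric_bimodule (underlying_module (mbim A y z))) a b)
        = mprod A x y z a b"
proof -
  let ?M = "symmetric_bimodule (underlying_module (mbim A x y))"
    and ?N = "symmetric_bimodule (underlying_module (mbim A y z))"
  interpret T: tensor_factors k ?M ?N
    by (rule tensor_factors_symmetric[OF underlying_module[OF x y] underlying_module[OF y z]])
  have eq: "lmult (lincat_of_morita k A) x y z =
      (\<lambda>t\<in>carrier (tensor_group k ?M ?N). tensor_lift (underlying_module (mbim A x z)) (\<lambda>(a, b). mprod A x y z a b) t)"
    by (simp add: lincat_of_morita_def x y z)
  \<comment> \<open>A scalar comes out of either factor as the same scalar on the product, which is
    balancedness over \<open>k\<close>.\<close>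
  have bal: "balanced_map k ?M ?N (underlying_module (mbim A x z)) (mprod A x y z)"
    by (rule balanced_mapI)
      (simp_all add: x y z mprod_closed balanced_map_add_left[OF mprod_balanced]
        balanced_map_add_right[OF mprod_balanced] mprod_smult_left mprod_smult_right)
  note * = T.tensor_restrict_lift[OF module.axioms(2)[OF underlying_module[OF x z]] bal]
  show "lmult (lincat_of_morita k A) x y z \<in> add_hom (tensor_group k ?M ?N) (mbim A x z)"
    unfolding eq using *(1) by simp
  show "\<lbrakk>a \<in> carrier (mbim A x y); b \<in> carrier (mbim A y z)\<rbrakk>
      \<Longrightarrow> lmult (lincat_of_morita k A) x y z (pure_tensor k ?M ?N a b) = mprod A x y z a b"
    unfolding eq by (rule *(2)) simp_all
qed

lemma lincat_lprod:
  "\<lbrakk>x \<in> mobj A; y \<in> mobj A; z \<in> mobj A; a \<in> carrier (mbim A x y); b \<in> carrier (mbim A y z)\<rbrakk>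
    \<Longrightarrow> lprod k (lincat_of_morita k A) x y z a b = mprod A x y z a b"
  by (simp add: lprod_def lincat_lmult_pure)

lemma lincat_lmult_linear:
  assumes x: "x \<in> mobj A" and y: "y \<in> mobj A" and z: "z \<in> mobj A"
  shows "linear_map k (ltensor k (lincat_of_morita k A) x y z) (underlying_module (mbim A x z))
    (lmult (lincat_of_morita k A) x y z)"
  using tensor_linear_mapI[OF underlying_module[OF x y] underlying_module[OF y z] underlying_module[OF x z]]
    lincat_lmult_hom[OF x y z]
  by (simp add: ltensor_def x y z lincat_lmult_pure mprod_smult_left
      module.smult_closed[OF mbim_module])

lemma lincat_of_morita_closed: "lincat_of_morita k A \<in> lincats k"
proof -
  let ?L = "lincat_of_morita k A"
  have one: "\<one>\<^bsub>malg A x\<^esub> \<in> carrier (malg A x)" if "x \<in> mobj A" for x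
    using malg_algebra[OF that] by (intro monoid.one_closed) (simp add: assoc_algebra_def ring_def)
  then have one': "\<one>\<^bsub>malg A x\<^esub> \<in> carrier (mbim A x x)" if "x \<in> mobj A" for x
    using that by (simp add: mbim_self)
  have "lhom ?L \<in> mobj A \<rightarrow>\<^sub>E mobj A \<rightarrow>\<^sub>E khom_modules k"
    by (auto simp: lincat_of_morita_def underlying_module_khom)
  moreover have "lmult ?L \<in> (\<Pi>\<^sub>E x\<in>mobj A. \<Pi>\<^sub>E y\<in>mobj A. \<Pi>\<^sub>E z\<in>mobj A.
      carrier (ltensor k ?L x y z) \<rightarrow>\<^sub>E carrier (lhom ?L x z))"
  proof (intro PiE_I)
    fix x y z t assume xyz: "x \<in> mobj A" "y \<in> mobj A" "z \<in> mobj A"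
    show "t \<in> carrier (ltensor k ?L x y z) \<Longrightarrow> lmult ?L x y z t \<in> carrier (lhom ?L x z)"
      using add_hom_closed[OF lincat_lmult_hom[OF xyz], of t] xyz by (simp add: ltensor_def)
    show "t \<notin> carrier (ltensor k ?L x y z) \<Longrightarrow> lmult ?L x y z t = undefined"
      using xyz by (simp add: ltensor_def lincat_of_morita_def)
  qed (simp_all add: lincat_of_morita_def)
  moreover have "lunit ?L \<in> (\<Pi>\<^sub>E x\<in>mobj A. carrier (lhom ?L x x))"
    by (auto simp: lincat_of_morita_def one')
  \<comment> \<open>By \<open>mprod_eq_lact\<close> and \<open>mprod_eq_ract\<close> the unit laws
    become \<open>lact_one\<close> and \<open>ract_one\<close>.\<close>
  ultimately show ?thesis
    by (simp add: lincats_def lincat_lmult_linear lincat_lprod mprod_closed mprod_assoc one one'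
        mprod_eq_lact mprod_eq_ract is_bimodule.lact_one[OF mbim_bimodule] is_bimodule.ract_one[OF mbim_bimodule])
qed

end

section \<open>The isomorphism\<close>

lemma PiE2_eqI:
  assumes "f \<in> X \<rightarrow>\<^sub>E X \<rightarrow>\<^sub>E D" "g \<in> X \<rightarrow>\<^sub>E X \<rightarrow>\<^sub>E D'"
    and "\<And>x y. \<lbrakk>x \<in> X; y \<in> X\<rbrakk> \<Longrightarrow> f x y = g x y"
  shows "f = g"
  using assms by (intro extensionalityI[of f X g] extensionalityI[of "f _" X "g _"]) (auto simp: PiE_def Pi_def)

lemma PiE3_eqI:
  assumes f: "f \<in> (\<Pi>\<^sub>E x\<in>X. \<Pi>\<^sub>E y\<in>X. \<Pi>\<^sub>E z\<in>X. C x y z \<rightarrow>\<^sub>E D x y z)"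
    and g: "g \<in> (\<Pi>\<^sub>E x\<in>X. \<Pi>\<^sub>E y\<in>X. \<Pi>\<^sub>E z\<in>X. C x y z \<rightarrow>\<^sub>E D x y z)"
    and eq: "\<And>x y z t. \<lbrakk>x \<in> X; y \<in> X; z \<in> X; t \<in> C x y z\<rbrakk> \<Longrightarrow> f x y z t = g x y z t"
  shows "f = g"
proof (rule PiE_ext[OF f g])
  fix x assume x: "x \<in> X"
  show "f x = g x"
  proof (rule PiE_ext[OF PiE_mem[OF f x] PiE_mem[OF g x]])
    fix y assume y: "y \<in> X"
    show "f x y = g x y"
    proof (rule PiE_ext[OF PiE_mem[OF PiE_mem[OF f x] y] PiE_mem[OF PiE_mem[OF g x] y]])
      fix z assume z: "z \<in> X"
      show "f x y z = g x y z"
        by (rule PiE_ext[OF PiE_mem[OF PiE_mem[OF PiE_mem[OF f x] y] z] PiE_mem[OF PiE_mem[OF PiE_mem[OF g x] y] z]])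
          (rule eq[OF x y z])
    qed
  qed
qed

text \<open>Forgetting the actions of \<open>hom_bimodule\<close> leaves the original hom modules,
  whose multiplication and unit fields are fixed to \<open>undefined\<close>. The compositions are
  then compared on pure tensors.\<close>

lemma (in lincat) lincat_of_morita_of_lincat: "lincat_of_morita k (morita_of_lincat k A) = A"
proof -
  let ?A = "lincat_of_morita k (morita_of_lincat k A)"
  interpret M: morita_context k "morita_of_lincat k A"
    by unfold_locales (rule morita_of_lincat_closed)
  interpret A': lincat k ?A
    by unfold_locales (rule M.lincat_of_morita_closed)
  have hom_eq: "lhom ?A x y = lhom A x y" if "x \<in> lobj A" "y \<in> lobj A" for x y
    using that by (simp add: underlying_module_def lhom_mult lhom_one)
  \<comment> \<open>The hom modules must be equal first: they determine the tensor products on which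
    the two compositions are defined.\<close>
  have lhom: "lhom ?A = lhom A"
  proof (rule PiE2_eqI[where X = "lobj A" and D = "khom_modules k" and D' = "khom_modules k"])
    show "lhom A \<in> lobj A \<rightarrow>\<^sub>E lobj A \<rightarrow>\<^sub>E khom_modules k"
      using lincat by (simp add: lincats_def)
    have "lhom ?A \<in> lobj ?A \<rightarrow>\<^sub>E lobj ?A \<rightarrow>\<^sub>E khom_modules k"
      using A'.lincat unfolding lincats_def by blast
    then show "lhom ?A \<in> lobj A \<rightarrow>\<^sub>E lobj A \<rightarrow>\<^sub>E khom_modules k" by simp
  qed (rule hom_eq)
  then have ltensor: "ltensor k ?A = ltensor k A"
    by (simp add: ltensor_def fun_eq_iff)
  have lmult: "lmult ?A = lmult A"
  proof (rule PiE3_eqI)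
    show "lmult A \<in> (\<Pi>\<^sub>E x\<in>lobj A. \<Pi>\<^sub>E y\<in>lobj A. \<Pi>\<^sub>E z\<in>lobj A.
        carrier (ltensor k A x y z) \<rightarrow>\<^sub>E carrier (lhom A x z))"
      using lincat by (simp add: lincats_def)
    show "lmult ?A \<in> (\<Pi>\<^sub>E x\<in>lobj A. \<Pi>\<^sub>E y\<in>lobj A. \<Pi>\<^sub>E z\<in>lobj A.
        carrier (ltensor k A x y z) \<rightarrow>\<^sub>E carrier (lhom A x z))"
      using A'.lincat by (simp only: lincats_def mem_Collect_eq lhom ltensor lincat_of_morita_simps morita_of_lincat_simps)
    fix x y z t assume xyz: "x \<in> lobj A" "y \<in> lobj A" "z \<in> lobj A" and t: "t \<in> carrier (ltensor k A x y z)"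
    interpret T: tensor_factors k "symmetric_bimodule (lhom A x y)" "symmetric_bimodule (lhom A y z)"
      by (rule lhom_tensor_factors[OF xyz])
    show "lmult ?A x y z t = lmult A x y z t"
    proof (rule T.tensor_group_hom_eqI[OF module.axioms(2)[OF lhom_module[OF xyz(1,3)]] _ lmult_hom[OF xyz]])
      show "lmult ?A x y z \<in> add_hom (tensor_group k (symmetric_bimodule (lhom A x y))
          (symmetric_bimodule (lhom A y z))) (lhom A x z)"
        using A'.lmult_hom[of x y z] xyz by (simp only: lhom) simp
      \<comment> \<open>The product of the round trip is \<open>mprod\<close> of the intermediate
        Morita context, and that is \<open>lprod\<close> of \<open>A\<close> again.\<close>
      fix a b assume "a \<in> carrier (symmetric_bimodule (lhom A x y))" "b \<in> carrier (symmetric_bimodule (lhom A y z))"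
      then show "lmult ?A x y z (pure_tensor k (symmetric_bimodule (lhom A x y)) (symmetric_bimodule (lhom A y z)) a b)
          = lmult A x y z (pure_tensor k (symmetric_bimodule (lhom A x y)) (symmetric_bimodule (lhom A y z)) a b)"
        using M.lincat_lprod[of x y z a b] morita_mprod[of x y z a b] xyz
        by (simp add: lprod_def lhom)
    qed (use t in \<open>simp add: ltensor_def\<close>)
  qed
  have "lunit ?A = lunit A"
    by (rule extensionalityI[where A = "lobj A"])
      (use lincat A'.lincat in \<open>auto simp: lincats_def PiE_def\<close>)
  with lhom lmult show ?thesis by (intro lincat.equality) simp_all
qed

text \<open>More has to be recovered than in the other direction, as \<open>lincat_of_morita\<close>
  drops the actions and the algebra multiplications. The actions return as products with elements of
  the diagonal algebras, and the multiplication of an algebra returns as the action on its regular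
  bimodule.\<close>

lemma (in morita_context) morita_of_lincat_of_morita: "morita_of_lincat k (lincat_of_morita k A) = A"
proof -
  let ?A = "morita_of_lincat k (lincat_of_morita k A)"
  interpret L: lincat k "lincat_of_morita k A"
    by unfold_locales (rule lincat_of_morita_closed)
  interpret A': morita_context k ?A
    by unfold_locales (rule L.morita_of_lincat_closed)
  have carrier_self: "carrier (mbim A x x) = carrier (malg A x)" if "x \<in> mobj A" for x
    using that by (simp add: mbim_self)
  have bim_eq: "mbim ?A x y = mbim A x y" if x: "x \<in> mobj A" and y: "y \<in> mobj A" for x y
  proof -
    have b: "lact (mbim A x y) \<in> carrier (malg A x) \<rightarrow>\<^sub>E carrier (mbim A x y) \<rightarrow>\<^sub>E carrier (mbim A x y)"
      "ract (mbim A x y) \<in> carrier (mbim A x y) \<rightarrow>\<^sub>E carrier (malg A y) \<rightarrow>\<^sub>E carrier (mbim A x y)"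
      using mbim_kbimodule[OF x y] by (simp_all add: kbimodules_def)
    \<comment> \<open>The values agree on carriers by \<open>mprod_eq_lact\<close>; extensionality
      of the actions, demanded by \<open>kbimodules\<close>, turns this into equality of
      functions.\<close>
    have "(\<lambda>r\<in>carrier (malg A x). \<lambda>a\<in>carrier (mbim A x y). mprod A x x y r a) = lact (mbim A x y)"
      by (rule extensionalityI[OF restrict_extensional], use b in \<open>auto simp: PiE_def\<close>)
        (rule extensionalityI[OF restrict_extensional], use b in \<open>auto simp: PiE_def Pi_def mprod_eq_lact x y\<close>)
    moreover have "(\<lambda>a\<in>carrier (mbim A x y). \<lambda>s\<in>carrier (malg A y). mprod A x y y a s) = ract (mbim A x y)"
      by (rule extensionalityI[OF restrict_extensional], use b in \<open>auto simp: PiE_def\<close>)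
        (rule extensionalityI[OF restrict_extensional], use b in \<open>auto simp: PiE_def Pi_def mprod_eq_ract x y\<close>)
    ultimately show ?thesis
      using mbim_kbimodule[OF x y] x y
      by (intro bimodule.equality)
        (simp_all add: kbimodules_def hom_bimodule_def lincat_lprod carrier_self cong: restrict_cong)
  qed
  have alg_eq: "malg ?A x = malg A x" if x: "x \<in> mobj A" for x
  proof -
    \<comment> \<open>On a regular bimodule the left action is the multiplication, so equality of
      the bimodules at \<open>(x, x)\<close> yields equality of the algebra multiplications.\<close>
    have "lact (mbim ?A x x) = lact (mbim A x x)" using bim_eq[OF x x] by simp
    moreover have "mbim ?A x x = regular_bimodule (malg ?A x)"
      using x by (intro A'.mbim_self) simp
    ultimately have "monoid.mult (malg ?A x) = monoid.mult (malg A x)"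
      by (simp add: mbim_self[OF x])
    then show ?thesis
      using x by (intro module.equality) (simp_all add: mbim_self)
  qed
  have malg: "malg ?A = malg A"
    by (rule extensionalityI[where A = "mobj A"])
      (use morita_context A'.morita_context alg_eq in \<open>auto simp: morita_contexts_def PiE_def\<close>)
  have mbim: "mbim ?A = mbim A"
  \<comment> \<open>The sets of bimodules vary with \<open>x\<close> and \<open>y\<close>. What
    matters here is the value \<open>undefined\<close> outside the objects, so the codomain is
    enlarged to \<open>UNIV\<close>.\<close>
  proof (rule PiE2_eqI[where X = "mobj A" and D = UNIV and D' = UNIV])
    have "mbim A \<in> (\<Pi>\<^sub>E x\<in>mobj A. \<Pi>\<^sub>E y\<in>mobj A. kbimodules k (malg A x) (malg A y))"
      using morita_context by (simp add: morita_contexts_def)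
    then show "mbim A \<in> mobj A \<rightarrow>\<^sub>E mobj A \<rightarrow>\<^sub>E UNIV" by (auto simp: PiE_def Pi_def)
    show "mbim ?A \<in> mobj A \<rightarrow>\<^sub>E mobj A \<rightarrow>\<^sub>E UNIV" by (auto simp: morita_of_lincat_def)
  qed (rule bim_eq)
  have mtensor: "mtensor ?A = mtensor A"
    by (simp add: mtensor_def fun_eq_iff malg mbim)
  have mmult: "mmult ?A = mmult A"
  proof (rule PiE3_eqI)
    show "mmult A \<in> (\<Pi>\<^sub>E x\<in>mobj A. \<Pi>\<^sub>E y\<in>mobj A. \<Pi>\<^sub>E z\<in>mobj A.
        carrier (mtensor A x y z) \<rightarrow>\<^sub>E carrier (mbim A x z))"
      using morita_context by (simp add: morita_contexts_def)
    show "mmult ?A \<in> (\<Pi>\<^sub>E x\<in>mobj A. \<Pi>\<^sub>E y\<in>mobj A. \<Pi>\<^sub>E z\<in>mobj A.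
        carrier (mtensor A x y z) \<rightarrow>\<^sub>E carrier (mbim A x z))"
      using A'.morita_context by (simp only: morita_contexts_def mem_Collect_eq mtensor mbim lincat_of_morita_simps morita_of_lincat_simps)
    fix x y z t assume xyz: "x \<in> mobj A" "y \<in> mobj A" "z \<in> mobj A" and t: "t \<in> carrier (mtensor A x y z)"
    interpret T: tensor_factors "malg A y" "mbim A x y" "mbim A y z"
      by (rule mbim_tensor_factors[OF xyz])
    show "mmult ?A x y z t = mmult A x y z t"
    proof (rule T.tensor_group_hom_eqI[OF is_bimodule_abelian_group[OF mbim_bimodule[OF xyz(1,3)]] _ mmult_hom[OF xyz]])
      show "mmult ?A x y z \<in> add_hom (tensor_group (malg A y) (mbim A x y) (mbim A y z)) (mbim A x z)"
        using A'.mmult_hom[of x y z] xyz by (simp only: malg mbim) simp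
      fix a b assume "a \<in> carrier (mbim A x y)" "b \<in> carrier (mbim A y z)"
      then show "mmult ?A x y z (pure_tensor (malg A y) (mbim A x y) (mbim A y z) a b)
          = mmult A x y z (pure_tensor (malg A y) (mbim A x y) (mbim A y z) a b)"
        using L.morita_mprod[of x y z a b] lincat_lprod[of x y z a b] xyz
        by (simp add: mprod_def malg mbim)
    qed (use t in \<open>simp add: mtensor_def\<close>)
  qed
  show ?thesis using malg mbim mmult by (intro morita.equality) simp_all
qed

section \<open>Agreement of 1-cells and 2-cells\<close>

lemma onecell_data_cong:
  assumes "\<And>x y. \<lbrakk>x \<in> X; y \<in> X\<rbrakk> \<Longrightarrow> H x y = H' x y" "\<And>x y. \<lbrakk>x \<in> Y; y \<in> Y\<rbrakk> \<Longrightarrow> K x y = K' x y"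
  shows "onecell_data X H Y K = onecell_data X H' Y K'"
proof -
  have "(\<Pi>\<^sub>E x\<in>X. \<Pi>\<^sub>E y\<in>X. H x y \<rightarrow>\<^sub>E K (omap f x) (omap f y))
      = (\<Pi>\<^sub>E x\<in>X. \<Pi>\<^sub>E y\<in>X. H' x y \<rightarrow>\<^sub>E K' (omap f x) (omap f y))"
    if "omap f \<in> X \<rightarrow>\<^sub>E Y" for f :: "('a, 'b) onecell"
    using that assms by (intro PiE_cong) (auto simp: PiE_def Pi_def)
  then show ?thesis unfolding onecell_data_def by blast
qed

text \<open>For \<open>p\<close> and \<open>q\<close> to induce a map of tensor products along
  \<open>r\<close>, compatibility with the middle algebra is enough. The claim is stated for bare
  maps because it must be available before a Morita morphism is known to be a functor.\<close>

lemma tensor_map_hom_bimodule: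
  assumes A: "A \<in> lincats k" and B: "B \<in> lincats k"
    and xyz: "x \<in> lobj A" "y \<in> lobj A" "z \<in> lobj A" and uvw: "u \<in> lobj B" "v \<in> lobj B" "w \<in> lobj B"
    and p: "linear_map k (lhom A x y) (lhom B u v) p" and q: "linear_map k (lhom A y z) (lhom B v w) q"
    and r: "linear_map k (lhom A y y) (lhom B v v) r"
    and pr: "\<And>a s. \<lbrakk>a \<in> carrier (lhom A x y); s \<in> carrier (lhom A y y)\<rbrakk>
      \<Longrightarrow> p (lprod k A x y y a s) = lprod k B u v v (p a) (r s)"
    and rq: "\<And>s b. \<lbrakk>s \<in> carrier (lhom A y y); b \<in> carrier (lhom A y z)\<rbrakk>
      \<Longrightarrow> q (lprod k A y y z s b) = lprod k B v v w (r s) (q b)"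
  shows tensor_map_hom_bimodule_hom:
    "tensor_map (hom_algebra k B v) (hom_bimodule k B u v) (hom_bimodule k B v w) p q
      \<in> add_hom (tensor_group (hom_algebra k A y) (hom_bimodule k A x y) (hom_bimodule k A y z))
          (tensor_group (hom_algebra k B v) (hom_bimodule k B u v) (hom_bimodule k B v w))"
    and tensor_map_hom_bimodule_pure:
    "\<lbrakk>a \<in> carrier (lhom A x y); b \<in> carrier (lhom A y z)\<rbrakk> \<Longrightarrow>
      tensor_map (hom_algebra k B v) (hom_bimodule k B u v) (hom_bimodule k B v w) p q
        (pure_tensor (hom_algebra k A y) (hom_bimodule k A x y) (hom_bimodule k A y z) a b)
      = pure_tensor (hom_algebra k B v) (hom_bimodule k B u v) (hom_bimodule k B v w) (p a) (q b)"
proof -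
  interpret A: lincat k A by unfold_locales fact
  interpret B: lincat k B by unfold_locales fact
  interpret T: tensor_factors "hom_algebra k A y" "hom_bimodule k A x y" "hom_bimodule k A y z"
    by (rule tensor_factors_bimodules[OF A.hom_bimodule[OF xyz(1,2)] A.hom_bimodule[OF xyz(2,3)]])
  have hom: "p \<in> add_hom (hom_bimodule k A x y) (hom_bimodule k B u v)"
    "q \<in> add_hom (hom_bimodule k A y z) (hom_bimodule k B v w)"
    using linear_map_hom[OF p] linear_map_hom[OF q] by simp_all
  note closed = linear_map_closed[OF p] linear_map_closed[OF q] linear_map_closed[OF r]
  note tmap = T.tensor_map[OF tensor_factors_bimodules[OF B.hom_bimodule[OF uvw(1,2)] B.hom_bimodule[OF uvw(2,3)]] hom,
      where \<rho> = r]
  show "tensor_map (hom_algebra k B v) (hom_bimodule k B u v) (hom_bimodule k B v w) p q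
      \<in> add_hom (tensor_group (hom_algebra k A y) (hom_bimodule k A x y) (hom_bimodule k A y z))
          (tensor_group (hom_algebra k B v) (hom_bimodule k B u v) (hom_bimodule k B v w))"
    by (rule tmap(1)) (simp_all add: closed pr rq)
  show "\<lbrakk>a \<in> carrier (lhom A x y); b \<in> carrier (lhom A y z)\<rbrakk> \<Longrightarrow>
      tensor_map (hom_algebra k B v) (hom_bimodule k B u v) (hom_bimodule k B v w) p q
        (pure_tensor (hom_algebra k A y) (hom_bimodule k A x y) (hom_bimodule k A y z) a b)
      = pure_tensor (hom_algebra k B v) (hom_bimodule k B u v) (hom_bimodule k B v w) (p a) (q b)"
    by (rule tmap(2)) (simp_all add: closed pr rq)
qed

text \<open>For a functor, compatibility with the multiplications is an equation of additive maps
  that holds on pure tensors. Conversely, that condition can be evaluated on a pure tensor only once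
  the tensor product of the components is well defined, which is first extracted from the two-sided
  bimodule condition.\<close>

lemma morita_maps_morita_of_lincat:
  assumes A: "A \<in> lincats k" and B: "B \<in> lincats k"
  shows "morita_maps k (morita_of_lincat k A) (morita_of_lincat k B) = lin_functors k A B"
proof -
  interpret A: lincat k A by unfold_locales fact
  interpret B: lincat k B by unfold_locales fact
  let ?A = "morita_of_lincat k A" and ?B = "morita_of_lincat k B"
  have data: "onecell_data (lobj A) (\<lambda>x y. carrier (mbim ?A x y)) (lobj B) (\<lambda>x y. carrier (mbim ?B x y))
      = onecell_data (lobj A) (\<lambda>x y. carrier (lhom A x y)) (lobj B) (\<lambda>x y. carrier (lhom B x y))"
    by (rule onecell_data_cong) simp_all
  show ?thesis
  proof (intro subset_antisym subsetI)
    fix f assume f: "f \<in> lin_functors k A B"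
    note fs = lin_functorD(2,3)[OF f]
    note linear = lin_functor_linear[OF f]
    have "hmap f x z (mmult ?A x y z t) = mmult ?B (omap f x) (omap f y) (omap f z)
        (tensor_map (hom_algebra k B (omap f y)) (hom_bimodule k B (omap f x) (omap f y))
          (hom_bimodule k B (omap f y) (omap f z)) (hmap f x y) (hmap f y z) t)"
      if x: "x \<in> lobj A" and y: "y \<in> lobj A" and z: "z \<in> lobj A"
        and t: "t \<in> carrier (tensor_group (hom_algebra k A y) (hom_bimodule k A x y) (hom_bimodule k A y z))"
      for x y z t
    proof -
      note fx = fs(1)[OF x] and fy = fs(1)[OF y] and fz = fs(1)[OF z]
      interpret T: tensor_factors "hom_algebra k A y" "hom_bimodule k A x y" "hom_bimodule k A y z"
        by (rule tensor_factors_bimodules[OF A.hom_bimodule[OF x y] A.hom_bimodule[OF y z]])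
      note tmap = tensor_map_hom_bimodule[OF A B x y z fx fy fz linear[OF x y] linear[OF y z] linear[OF y y]
          lin_functor_lprod[OF f x y y] lin_functor_lprod[OF f y y z], simplified]
      show ?thesis
      proof (rule T.tensor_group_hom_eqI[OF module.axioms(2)[OF B.lhom_module[OF fx fz]]
            add_hom_comp[OF A.morita_mmult_hom[OF x y z] linear_map_hom[OF linear[OF x z]]]
            add_hom_comp[OF tmap(1) B.morita_mmult_hom[OF fx fy fz]] _ t])
        fix a b assume "a \<in> carrier (hom_bimodule k A x y)" "b \<in> carrier (hom_bimodule k A y z)"
        then have ab: "a \<in> carrier (lhom A x y)" "b \<in> carrier (lhom A y z)" by simp_all
        show "hmap f x z (mmult ?A x y z (pure_tensor (hom_algebra k A y) (hom_bimodule k A x y) (hom_bimodule k A y z) a b))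
            = mmult ?B (omap f x) (omap f y) (omap f z)
              (tensor_map (hom_algebra k B (omap f y)) (hom_bimodule k B (omap f x) (omap f y))
                (hom_bimodule k B (omap f y) (omap f z)) (hmap f x y) (hmap f y z)
                (pure_tensor (hom_algebra k A y) (hom_bimodule k A x y) (hom_bimodule k A y z) a b))"
          unfolding tmap(2)[OF ab] using x y z ab
          by (simp add: fs A.morita_mmult_pure B.morita_mmult_pure lin_functor_lprod[OF f])
      qed
    qed
    moreover have "linear_map k (hom_bimodule k A x y) (hom_bimodule k B (omap f x) (omap f y)) (hmap f x y)"
      if "x \<in> lobj A" "y \<in> lobj A" for x y
      using linear[OF that] by (simp add: linear_map_def)
    moreover have "algebra_map k (hom_algebra k A x) (hom_algebra k B (omap f x)) (hmap f x x)"
      if "x \<in> lobj A" for x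
      using linear[OF that that] that
      by (auto simp: algebra_map_def ring_hom_def linear_map_def fs lin_functor_lprod[OF f] lin_functor_lunit[OF f])
    ultimately show "f \<in> morita_maps k ?A ?B"
      by (simp add: morita_maps_def data lin_functor_data[OF f] fs mtensor_def A.lprod_closed B.lprod_closed
          lin_functor_lprod[OF f])
  next
    fix f assume f: "f \<in> morita_maps k ?A ?B"
    then have f_data: "f \<in> onecell_data (lobj A) (\<lambda>x y. carrier (lhom A x y)) (lobj B) (\<lambda>x y. carrier (lhom B x y))"
      by (simp add: morita_maps_def data)
    note fs = onecell_dataD[OF f_data]
    have linear: "linear_map k (lhom A x y) (lhom B (omap f x) (omap f y)) (hmap f x y)"
      if "x \<in> lobj A" "y \<in> lobj A" for x y
    proof -
      have "linear_map k (hom_bimodule k A x y) (hom_bimodule k B (omap f x) (omap f y)) (hmap f x y)"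
        using f that fs(1) by (simp add: morita_maps_def)
      then show ?thesis by (simp add: linear_map_def)
    qed
    have unit: "hmap f x x (lunit A x) = lunit B (omap f x)" if "x \<in> lobj A" for x
    proof -
      have "algebra_map k (hom_algebra k A x) (hom_algebra k B (omap f x)) (hmap f x x)"
        using f that fs(1) by (simp add: morita_maps_def)
      then show ?thesis by (simp add: algebra_map_def ring_hom_def)
    qed
    have bimod: "hmap f x y (lprod k A x y y (lprod k A x x y r a) s)
        = lprod k B (omap f x) (omap f y) (omap f y)
            (lprod k B (omap f x) (omap f x) (omap f y) (hmap f x x r) (hmap f x y a)) (hmap f y y s)"
      if "x \<in> lobj A" "y \<in> lobj A" "r \<in> carrier (lhom A x x)" "a \<in> carrier (lhom A x y)"
        "s \<in> carrier (lhom A y y)" for x y r a s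
    proof -
      have "\<forall>x\<in>lobj A. \<forall>y\<in>lobj A. \<forall>r\<in>carrier (malg ?A x). \<forall>a\<in>carrier (mbim ?A x y). \<forall>s\<in>carrier (malg ?A y).
          hmap f x y (ract (mbim ?A x y) (lact (mbim ?A x y) r a) s)
            = ract (mbim ?B (omap f x) (omap f y))
                (lact (mbim ?B (omap f x) (omap f y)) (hmap f x x r) (hmap f x y a)) (hmap f y y s)"
        using f unfolding morita_maps_def morita_of_lincat_simps(1) by blast
      then show ?thesis using that by (simp add: fs A.lprod_closed B.lprod_closed)
    qed
    \<comment> \<open>A unit on one side of the two-sided condition leaves compatibility with the
      other action, since the diagonal components preserve units.\<close>
    have right: "hmap f x y (lprod k A x y y a s)
        = lprod k B (omap f x) (omap f y) (omap f y) (hmap f x y a) (hmap f y y s)"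
      if "x \<in> lobj A" "y \<in> lobj A" "a \<in> carrier (lhom A x y)" "s \<in> carrier (lhom A y y)" for x y a s
      using bimod[OF that(1,2) A.lunit_closed that(3,4)] that
      by (simp add: A.lprod_unit_left B.lprod_unit_left unit fs)
    have left: "hmap f x y (lprod k A x x y r a)
        = lprod k B (omap f x) (omap f x) (omap f y) (hmap f x x r) (hmap f x y a)"
      if "x \<in> lobj A" "y \<in> lobj A" "r \<in> carrier (lhom A x x)" "a \<in> carrier (lhom A x y)" for x y r a
      using bimod[OF that A.lunit_closed] that
      by (simp add: A.lprod_unit_right B.lprod_unit_right A.lprod_closed B.lprod_closed unit fs)
    have mult: "hmap f x z (lprod k A x y z a b)
        = lprod k B (omap f x) (omap f y) (omap f z) (hmap f x y a) (hmap f y z b)"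
      if x: "x \<in> lobj A" and y: "y \<in> lobj A" and z: "z \<in> lobj A"
        and a: "a \<in> carrier (lhom A x y)" and b: "b \<in> carrier (lhom A y z)"
      for x y z a b
    proof -
      note fx = fs(1)[OF x] and fy = fs(1)[OF y] and fz = fs(1)[OF z]
      interpret T: tensor_factors "hom_algebra k A y" "hom_bimodule k A x y" "hom_bimodule k A y z"
        by (rule tensor_factors_bimodules[OF A.hom_bimodule[OF x y] A.hom_bimodule[OF y z]])
      have "\<forall>x\<in>lobj A. \<forall>y\<in>lobj A. \<forall>z\<in>lobj A. \<forall>t\<in>carrier (mtensor ?A x y z).
          hmap f x z (mmult ?A x y z t) = mmult ?B (omap f x) (omap f y) (omap f z)
            (tensor_map (malg ?B (omap f y)) (mbim ?B (omap f x) (omap f y))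
              (mbim ?B (omap f y) (omap f z)) (hmap f x y) (hmap f y z) t)"
        using f unfolding morita_maps_def morita_of_lincat_simps(1) by blast
      \<comment> \<open>The Morita condition at a pure tensor; \<open>right\<close> at
        \<open>(x, y)\<close> and \<open>left\<close> at \<open>(y, z)\<close> then allow
        \<open>tensor_map\<close> to be evaluated.\<close>
      then have "hmap f x z (mmult ?A x y z (pure_tensor (hom_algebra k A y) (hom_bimodule k A x y) (hom_bimodule k A y z) a b))
          = mmult ?B (omap f x) (omap f y) (omap f z)
            (tensor_map (hom_algebra k B (omap f y)) (hom_bimodule k B (omap f x) (omap f y))
              (hom_bimodule k B (omap f y) (omap f z)) (hmap f x y) (hmap f y z)
              (pure_tensor (hom_algebra k A y) (hom_bimodule k A x y) (hom_bimodule k A y z) a b))"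
        using x y z a b fx fy fz by (simp add: mtensor_def T.pure_tensor_closed)
      then show ?thesis
        using tensor_map_hom_bimodule_pure[OF A B x y z fx fy fz linear[OF x y] linear[OF y z] linear[OF y y]
            right[OF x y] left[OF y z] a b] x y z a b
        by (simp add: A.morita_mmult_pure B.morita_mmult_pure fs)
    qed
    from unit show "f \<in> lin_functors k A B"
      by (simp add: lin_functors_def f_data linear mult)
  qed
qed

text \<open>Both sides admit the same families of elements, and on elements of the hom modules
  \<open>mprod\<close> is \<open>lprod\<close>, so the naturality conditions coincide.\<close>

lemma morita_transformations_morita_of_lincat:
  assumes B: "B \<in> lincats k"
    and f: "f \<in> lin_functors k A B" and g: "g \<in> lin_functors k A B"
  shows "morita_transformations (morita_of_lincat k A) (morita_of_lincat k B) f g = lin_transformations k A B f g"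
proof -
  interpret B: lincat k B by unfold_locales fact
  note fs = lin_functorD(2,3)[OF f] lin_functorD(2,3)[OF g]
  have "(\<Pi>\<^sub>E x\<in>lobj A. carrier (mbim (morita_of_lincat k B) (omap g x) (omap f x)))
      = (\<Pi>\<^sub>E x\<in>lobj A. carrier (lhom B (omap g x) (omap f x)))"
    by (rule PiE_cong) (simp add: fs)
  moreover have "\<alpha> x \<in> carrier (lhom B (omap g x) (omap f x))"
    if "\<alpha> \<in> (\<Pi>\<^sub>E x\<in>lobj A. carrier (lhom B (omap g x) (omap f x)))" "x \<in> lobj A" for \<alpha> x
    using that by (rule PiE_mem)
  ultimately show ?thesis
    unfolding morita_transformations_def lin_transformations_def morita_of_lincat_simps(1)
    by (intro Collect_cong conj_cong ball_cong)
      (simp_all add: B.morita_mprod fs)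
qed

theorem theorem8p2:
  fixes k :: "'k ring"
  assumes "cring k"
  shows "isomorphic_two_categories
    (kCat k :: (('o, 'a, 'k) lincat, ('o, 'a) onecell, 'o \<Rightarrow> 'a) two_cat)
    (kMor k :: (('o, 'a, 'k) morita, ('o, 'a) onecell, 'o \<Rightarrow> 'a) two_cat)"
proof (rule isomorphic_two_categories_transport[OF two_category_kCat,
      where F = "morita_of_lincat k" and G = "lincat_of_morita k"])
  fix A :: "('o, 'a, 'k) lincat" assume A: "A \<in> cells0 (kCat k)"
  then interpret A: lincat k A by unfold_locales simp
  show "morita_of_lincat k A \<in> cells0 (kMor k)"
    using A.morita_of_lincat_closed by (simp add: kMor_def)
  show "lincat_of_morita k (morita_of_lincat k A) = A"
    by (rule A.lincat_of_morita_of_lincat)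
  \<comment> \<open>Hom modules and hom bimodules have the same carriers on objects, and both
    identities are cut off elsewhere.\<close>
  show "id1 (kMor k) (morita_of_lincat k A) = id1 (kCat k) A"
    by (simp add: kMor_def onecell_id_def cong: restrict_cong)
next
  fix A :: "('o, 'a, 'k) morita" assume A: "A \<in> cells0 (kMor k)"
  then interpret A: morita_context k A by unfold_locales (simp add: kMor_def)
  show "lincat_of_morita k A \<in> cells0 (kCat k)"
    using A.lincat_of_morita_closed by simp
  show "morita_of_lincat k (lincat_of_morita k A) = A"
    by (rule A.morita_of_lincat_of_morita)
next
  fix A B :: "('o, 'a, 'k) lincat" assume AB: "A \<in> cells0 (kCat k)" "B \<in> cells0 (kCat k)"
  then show "cells1 (kMor k) (morita_of_lincat k A) (morita_of_lincat k B) = cells1 (kCat k) A B"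
    by (simp add: kMor_def morita_maps_morita_of_lincat)
  fix f g assume f: "f \<in> cells1 (kCat k) A B" and "g \<in> cells1 (kCat k) A B"
  with AB show "cells2 (kMor k) (morita_of_lincat k A) (morita_of_lincat k B) f g = cells2 (kCat k) A B f g"
    by (simp add: kMor_def morita_transformations_morita_of_lincat)
next
  fix A B D :: "('o, 'a, 'k) lincat" and f g
  show "comp1 (kMor k) (morita_of_lincat k A) (morita_of_lincat k B) (morita_of_lincat k D) g f
      = comp1 (kCat k) A B D g f"
    by (simp add: kMor_def onecell_comp_def cong: restrict_cong)
next
  fix A B :: "('o, 'a, 'k) lincat" and f
  assume "A \<in> cells0 (kCat k)" "B \<in> cells0 (kCat k)" and f: "f \<in> cells1 (kCat k) A B"
  then show "id2 (kMor k) (morita_of_lincat k A) (morita_of_lincat k B) f = id2 (kCat k) A B f"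
    using lin_functor_omap[OF f[simplified]] by (simp add: kMor_def cong: restrict_cong)
next
  fix A B :: "('o, 'a, 'k) lincat" and f g h \<alpha> \<beta>
  assume *: "A \<in> cells0 (kCat k)" "B \<in> cells0 (kCat k)"
    "f \<in> cells1 (kCat k) A B" "g \<in> cells1 (kCat k) A B" "h \<in> cells1 (kCat k) A B"
    "\<alpha> \<in> cells2 (kCat k) A B f g" "\<beta> \<in> cells2 (kCat k) A B g h"
  then interpret B: lincat k B by unfold_locales simp
  show "vcomp (kMor k) (morita_of_lincat k A) (morita_of_lincat k B) f g h \<beta> \<alpha> = vcomp (kCat k) A B f g h \<beta> \<alpha>"
    using *(3-5)[simplified, THEN lin_functor_omap] *(6,7)[simplified, THEN lin_transformation_closed]
    by (simp add: kMor_def B.morita_mprod cong: restrict_cong)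
next
  fix A B D :: "('o, 'a, 'k) lincat" and f f' g g' \<alpha> \<beta>
  assume *: "A \<in> cells0 (kCat k)" "B \<in> cells0 (kCat k)" "D \<in> cells0 (kCat k)"
    "f \<in> cells1 (kCat k) A B" "f' \<in> cells1 (kCat k) A B" "g \<in> cells1 (kCat k) B D" "g' \<in> cells1 (kCat k) B D"
    "\<alpha> \<in> cells2 (kCat k) A B f f'" "\<beta> \<in> cells2 (kCat k) B D g g'"
  then interpret D: lincat k D by unfold_locales simp
  \<comment> \<open>Both factors of each component lie in hom modules of \<open>D\<close>, where
    \<open>mprod\<close> agrees with \<open>lprod\<close>; for the first one this needs that
    \<open>g'\<close> maps hom modules of \<open>B\<close> to those of \<open>D\<close>.\<close>
  show "hcomp (kMor k) (morita_of_lincat k A) (morita_of_lincat k B) (morita_of_lincat k D) f f' g g' \<alpha> \<beta>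
      = hcomp (kCat k) A B D f f' g g' \<alpha> \<beta>"
    using *(4-7)[simplified, THEN lin_functor_omap] *(7)[simplified, THEN lin_functor_hmap]
      *(8,9)[simplified, THEN lin_transformation_closed]
    by (simp add: kMor_def D.morita_mprod cong: restrict_cong)
qed

end
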